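(* Let $G$ be an equilateral compact tree with $p\ge 2$ vertices (so $g=p-1$ edges of common length $\ell$), with identically zero potentials, and let $b_1,\dots,b_p\in\mathbb{R}$. Let $z_1=-1<z_2\le\dots\le z_{p-1}<z_p=1$ be the zeros of $\psi(z)=\det(-zD+A)$ listed with multiplicity. Then the spectrum (eigenvalues counted with multiplicity) of the Robin problem on $G$ is the union of $2p-3$ sequences $$\{\lambda^{(1)}_k\}_{k=0}^\infty,\qquad \{\lambda^{(l)}_k\}_{k=0}^\infty,\quad \{\lambda^{(-l)}_k\}_{k=1}^\infty,\quad l=2,\dots,p-1,$$ with asymptotics, as $k\to+\infty$, $$\sqrt{\lambda^{(1)}_k}=\frac{\pi k}{\ell}+o(1),\qquad \sqrt{\lambda^{(\pm l)}_k}=\frac{\pm\arccos z_l+2\pi k}{\ell}+o(1),\quad l=2,\dots,p-1.$$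
   Context: $G$ is a tree whose edges $e_1,\dots,e_g$ all have length $\ell>0$, each oriented arbitrarily and identified with $[0,\ell]$ ($x=0$ initial vertex, $x=\ell$ terminal vertex). On each edge $-y_j''=\lambda y_j$. For a vertex $v$ and incident edge $e_j$, $y_j(v)$ denotes $y_j(\ell)$ if $e_j$ is incoming to $v$, $y_j(0)$ if outgoing. Robin problem: at each vertex $v_i$, the values $y_j(v_i)$ over incident edges coincide (common value $y(v_i)$) and $\sum_{j\text{ incoming}}y_j'(\ell)-\sum_{k\text{ outgoing}}y_k'(0)+b_iy(v_i)=0$ (at a pendant vertex: $y_j'(\ell)+b_iy_j(\ell)=0$ or $-y_k'(0)+b_iy_k(0)=0$). Eigenvalues are the $\lambda$ for which a nontrivial solution exists. $D$ is the diagonal degree matrix and $A$ the adjacency matrix of $G$; the zeros of $\psi(z)=\det(-zD+A)$ are real, lie in $[-1,1]$, and for a tree $\pm1$ are simple zeros. Here $\arccos z_l\in[0,\pi]$, and the asymptotics concern large $k$, where the eigenvalues are positive and $\sqrt{\cdot}$ is the positive square root. *)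

theory Defs
  imports "HOL-Analysis.Analysis" "HOL-Computational_Algebra.Polynomial"
begin

text \<open>Graph encoding: vertices are 0..p-1, edges are j < p - 1, edge j is oriented
  from vertex fst (E j) (x = 0) to vertex snd (E j) (x = ell).\<close>

definition edge_rel :: "nat \<Rightarrow> (nat \<Rightarrow> nat \<times> nat) \<Rightarrow> (nat \<times> nat) set" where
  "edge_rel p E = {(fst (E j), snd (E j)) | j. j < p - 1} \<union> {(snd (E j), fst (E j)) | j. j < p - 1}"

text \<open>A tree with p >= 2 vertices and p - 1 edges: loop-free and connected.\<close>
definition is_tree :: "nat \<Rightarrow> (nat \<Rightarrow> nat \<times> nat) \<Rightarrow> bool" where
  "is_tree p E \<longleftrightarrow> 2 \<le> p
     \<and> (\<forall>j < p - 1. fst (E j) < p \<and> snd (E j) < p \<and> fst (E j) \<noteq> snd (E j))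
     \<and> (\<forall>v < p. (0, v) \<in> (edge_rel p E)\<^sup>*)"

definition deg :: "nat \<Rightarrow> (nat \<Rightarrow> nat \<times> nat) \<Rightarrow> nat \<Rightarrow> nat" where
  "deg p E v = card {j. j < p - 1 \<and> (fst (E j) = v \<or> snd (E j) = v)}"

definition degmat :: "nat \<Rightarrow> (nat \<Rightarrow> nat \<times> nat) \<Rightarrow> nat \<Rightarrow> nat \<Rightarrow> real" where
  "degmat p E i k = (if i = k then real (deg p E i) else 0)"

definition adjmat :: "nat \<Rightarrow> (nat \<Rightarrow> nat \<times> nat) \<Rightarrow> nat \<Rightarrow> nat \<Rightarrow> real" where
  "adjmat p E i k = (if (i, k) \<in> edge_rel p E then 1 else 0)"

text \<open>psi(z) = det(-z D + A) as a real polynomial in z (Leibniz formula).\<close>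
definition psi_poly :: "nat \<Rightarrow> (nat \<Rightarrow> nat \<times> nat) \<Rightarrow> real poly" where
  "psi_poly p E = (\<Sum>\<sigma> \<in> {\<sigma>. \<sigma> permutes {..<p}}.
      of_int (sign \<sigma>) * (\<Prod>i<p. [: adjmat p E i (\<sigma> i), - degmat p E i (\<sigma> i) :]))"

text \<open>Value of y_j at the vertex v (terminal end if incoming, initial end otherwise).\<close>
definition vval :: "(nat \<Rightarrow> nat \<times> nat) \<Rightarrow> real \<Rightarrow> (nat \<Rightarrow> real \<Rightarrow> complex) \<Rightarrow> nat \<Rightarrow> nat \<Rightarrow> complex" where
  "vval E ell Y j v = (if snd (E j) = v then Y j ell else Y j 0)"

text \<open>Y is a solution of the Robin problem with spectral parameter mu
  (zero potential; -y'' = mu y on each edge; continuity and Robin-Kirchhoff at each vertex).\<close>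
definition robin_sol :: "nat \<Rightarrow> (nat \<Rightarrow> nat \<times> nat) \<Rightarrow> real \<Rightarrow> (nat \<Rightarrow> real) \<Rightarrow> complex
     \<Rightarrow> (nat \<Rightarrow> real \<Rightarrow> complex) \<Rightarrow> bool" where
  "robin_sol p E ell b mu Y \<longleftrightarrow>
     (\<exists>Y' :: nat \<Rightarrow> real \<Rightarrow> complex.
       (\<forall>j < p - 1. \<exists>Y'' :: real \<Rightarrow> complex. \<forall>x \<in> {0..ell}.
          (Y j has_vector_derivative Y' j x) (at x within {0..ell}) \<and>
          (Y' j has_vector_derivative Y'' x) (at x within {0..ell}) \<and>
          - Y'' x = mu * Y j x) \<and>
       (\<forall>v < p. \<exists>c :: complex.
          (\<forall>j < p - 1. (fst (E j) = v \<or> snd (E j) = v) \<longrightarrow> vval E ell Y j v = c) \<and>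
          (\<Sum>j \<in> {j. j < p - 1 \<and> snd (E j) = v}. Y' j ell)
            - (\<Sum>j \<in> {j. j < p - 1 \<and> fst (E j) = v}. Y' j 0)
            + complex_of_real (b v) * c = 0))"

text \<open>Multiplicity of mu: maximal number of linearly independent solutions
  (dimension of the eigenspace; 0 if mu is not an eigenvalue).\<close>
definition robin_mult :: "nat \<Rightarrow> (nat \<Rightarrow> nat \<times> nat) \<Rightarrow> real \<Rightarrow> (nat \<Rightarrow> real) \<Rightarrow> complex \<Rightarrow> nat" where
  "robin_mult p E ell b mu = (GREATEST m. \<exists>Ys :: nat \<Rightarrow> nat \<Rightarrow> real \<Rightarrow> complex.
      (\<forall>i < m. robin_sol p E ell b mu (Ys i)) \<and>
      (\<forall>c :: nat \<Rightarrow> complex.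
         (\<forall>j < p - 1. \<forall>x \<in> {0..ell}. (\<Sum>i<m. c i * Ys i j x) = 0) \<longrightarrow> (\<forall>i < m. c i = 0)))"

text \<open>Index set of the 2p-3 sequences: label 1 (k >= 0), labels l (k >= 0) and -l (k >= 1)
  for l = 2..p-1.\<close>
definition seq_index :: "nat \<Rightarrow> (int \<times> nat) set" where
  "seq_index p = {(1, k) | k. True}
     \<union> {(int l, k) | l k. 2 \<le> l \<and> l \<le> p - 1}
     \<union> {(- int l, k) | l k. 2 \<le> l \<and> l \<le> p - 1 \<and> 1 \<le> k}"

end

theory Submission
  imports "Jordan_Normal_Form.Determinant" Defs
begin

text \<open>
  For a spectral parameter \<open>lambda = y * \<bar>y\<bar> / ell\<^sup>2\<close> that is not of the form \<open>(pi k / ell)\<^sup>2\<close> with \<open>k \<ge> 1\<close>,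
  a solution of the Robin problem is determined by its vertex values, and these form the kernel of
  \<open>A - C D - S b\<close>, where \<open>C\<close> and \<open>S\<close> are the values at \<open>ell\<close> of the cosine-like and the sine-like solution.
  Multiplicities are therefore the numbers of sorted eigenvalues \<open>f\<^sub>i(y)\<close> of this matrix (relative to \<open>D\<close>) that vanish.
  Between consecutive multiples of \<open>pi\<close> the curves \<open>f\<^sub>i / S\<close> are strictly increasing by Courant--Fischer, and
  \<open>f\<^sub>i(pi m) = z\<^sub>i - (-1)\<^sup>m\<close>. Hence each curve belonging to a zero \<open>z\<^sub>i\<close> of psi in the open interval (-1, 1) has
  exactly one zero in each such interval, where \<open>cos y\<close> tends to \<open>z\<^sub>i\<close> as \<open>y\<close> grows. The curves belonging to
  \<open>\<plusminus>1\<close> touch 0 at multiples of \<open>pi\<close>; there the sign of the sum of the Robin coefficients decides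
  on which side the eigenvalue lies, and it lies at the multiple itself if the sum is 0.
\<close>

text \<open>The claim is an exact matching with multiplicities, not only an asymptotic one, so
  locating zeros of a determinant for large \<open>k\<close> would not suffice: branches may cross,
  and the low part of the spectrum has to be counted too. Following each sorted eigenvalue
  separately settles this, since a common zero of several curves is counted once per curve.
  Monotonicity comes from the division by \<open>S\<close>. It makes the Robin term independent of
  \<open>y\<close>, and on each edge the remaining form is diagonal in the sum and the difference of
  the two end values, with coefficients \<open>(1 - C) / S\<close> and \<open>- (1 + C) / S\<close>.
  The absence of cycles is used twice: 1 and -1 are simple zeros of psi with explicit eigenvectors,
  and at a multiple of pi no eigenfunction can live on circulating slopes alone. The labels
  \<open>l\<close> and \<open>-l\<close> belong to one curve: cos y = z_l has one solution in each
  interval of length pi, and the even and the odd intervals are listed separately.\<close>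

section \<open>Symmetric eigenvalue problems with a weight\<close>

text \<open>Gaussian elimination: one equation is solved for an unknown \<open>u0\<close> with
  nonzero coefficient and substituted into the others. The dimension counts below rest on this
  statement: dependence of \<open>p + 1\<close> vectors, intersection of two spans, upper bounds for
  multiplicities, vertex functions with one relation per edge. Both real and complex coefficients
  occur, hence the general field.\<close>

lemma homogeneous_system:
  fixes M :: "'e \<Rightarrow> 'u \<Rightarrow> 'a::field"
  assumes "finite I" "finite U" "card I < card U"
  shows "\<exists>x. (\<exists>u\<in>U. x u \<noteq> 0) \<and> (\<forall>i\<in>I. (\<Sum>u\<in>U. M i u * x u) = 0)"
  using assms
proof (induction I arbitrary: M U rule: finite_induct)
  case empty
  then have "U \<noteq> {}" by auto
  then show ?case by (intro exI[of _ "\<lambda>_. 1"]) auto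
next
  case (insert i I)
  show ?case
  proof (cases "\<forall>u\<in>U. M i u = 0")
    case True
    have "card I < card U" using insert by simp
    from insert.IH[OF insert.prems(1) this, of M] show ?thesis using True by auto
  next
    case False
    then obtain u0 where u0: "u0 \<in> U" "M i u0 \<noteq> 0" by auto
    define U' where "U' = U - {u0}"
    have U': "finite U'" "card I < card U'" "u0 \<notin> U'" "U = insert u0 U'"
      using insert u0 by (auto simp: U'_def card_Diff_singleton)
    from insert.IH[OF U'(1,2), of "\<lambda>k u. M k u - M k u0 * M i u / M i u0"]
    obtain x where x: "\<exists>u\<in>U'. x u \<noteq> 0"
      "\<And>k. k \<in> I \<Longrightarrow> (\<Sum>u\<in>U'. (M k u - M k u0 * M i u / M i u0) * x u) = 0" by auto
    define s where "s = (\<Sum>u\<in>U'. M i u * x u)"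
    define x' where "x' = x(u0 := - s / M i u0)"
    have sum': "(\<Sum>u\<in>U. M k u * x' u) = - M k u0 * s / M i u0 + (\<Sum>u\<in>U'. M k u * x u)" for k
    proof -
      have "(\<Sum>u\<in>U'. M k u * x' u) = (\<Sum>u\<in>U'. M k u * x u)"
        by (rule sum.cong) (use U' in \<open>auto simp: x'_def\<close>)
      then show ?thesis using U' by (simp add: x'_def)
    qed
    have "(\<Sum>u\<in>U. M i u * x' u) = 0" using u0 by (simp add: sum' s_def)
    moreover have "(\<Sum>u\<in>U. M k u * x' u) = 0" if "k \<in> I" for k
    proof -
      have "0 = (\<Sum>u\<in>U'. M k u * x u) - (\<Sum>u\<in>U'. M k u0 / M i u0 * (M i u * x u))"
        using x(2)[OF that] by (simp add: left_diff_distrib sum_subtractf mult.assoc)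
      also have "\<dots> = (\<Sum>u\<in>U. M k u * x' u)"
        unfolding sum_distrib_left[symmetric] sum' s_def by simp
      finally show ?thesis by simp
    qed
    moreover have "\<exists>u\<in>U. x' u \<noteq> 0" using x(1) U' by (auto simp: x'_def)
    ultimately show ?thesis by (intro exI[of _ x']) auto
  qed
qed

definition wip :: "nat \<Rightarrow> (nat \<Rightarrow> real) \<Rightarrow> (nat \<Rightarrow> real) \<Rightarrow> (nat \<Rightarrow> real) \<Rightarrow> real" where
  "wip p d x y = (\<Sum>v<p. d v * x v * y v)"

definition mulv :: "nat \<Rightarrow> (nat \<Rightarrow> nat \<Rightarrow> real) \<Rightarrow> (nat \<Rightarrow> real) \<Rightarrow> nat \<Rightarrow> real" where
  "mulv p M x v = (\<Sum>u<p. M v u * x u)"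

definition bform :: "nat \<Rightarrow> (nat \<Rightarrow> nat \<Rightarrow> real) \<Rightarrow> (nat \<Rightarrow> real) \<Rightarrow> (nat \<Rightarrow> real) \<Rightarrow> real" where
  "bform p M x y = (\<Sum>v<p. mulv p M x v * y v)"

text \<open>The eigenvalue problem of \<open>M\<close> relative to the diagonal matrix of
  \<open>d\<close>, with eigenvalues ascending and repeated. Keeping the weight, instead of
  symmetrising it away, has the effect that adding a multiple of the weight to \<open>M\<close>
  shifts all eigenvalues by the same amount.\<close>

definition eigensys :: "nat \<Rightarrow> (nat \<Rightarrow> real) \<Rightarrow> (nat \<Rightarrow> nat \<Rightarrow> real) \<Rightarrow> (nat \<Rightarrow> real)
     \<Rightarrow> (nat \<Rightarrow> nat \<Rightarrow> real) \<Rightarrow> bool" where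
  "eigensys p d M th X \<longleftrightarrow>
     (\<forall>i<p. \<forall>j<p. i \<le> j \<longrightarrow> th i \<le> th j) \<and>
     (\<forall>i<p. \<forall>j<p. wip p d (X i) (X j) = of_bool (i = j)) \<and>
     (\<forall>i<p. \<forall>v<p. mulv p M (X i) v = th i * d v * X i v)"

lemma wip_commute: "wip p d x y = wip p d y x"
  unfolding wip_def by (simp add: mult_ac)

lemma wip_add: "wip p d (\<lambda>v. x v + y v) z = wip p d x z + wip p d y z"
  and wip_diff: "wip p d (\<lambda>v. x v - y v) z = wip p d x z - wip p d y z"
  and wip_scale: "wip p d (\<lambda>v. c * x v) z = c * wip p d x z"
  and wip_sum: "wip p d (\<lambda>v. \<Sum>j\<in>J. f j v) z = (\<Sum>j\<in>J. wip p d (f j) z)"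
  unfolding wip_def
  by (simp_all add: algebra_simps sum.distrib sum_subtractf sum_distrib_left sum_distrib_right)
     (subst sum.swap, simp add: algebra_simps sum_distrib_left)

lemma bform_add: "bform p M (\<lambda>v. x v + y v) z = bform p M x z + bform p M y z"
  and bform_scale: "bform p M (\<lambda>v. c * x v) z = c * bform p M x z"
  unfolding bform_def mulv_def
  by (simp_all add: algebra_simps sum.distrib sum_distrib_left sum_distrib_right)

lemma mulv_sum: "mulv p M (\<lambda>v. \<Sum>j\<in>J. f j v) w = (\<Sum>j\<in>J. mulv p M (f j) w)"
  unfolding mulv_def by (simp add: sum_distrib_left) (rule sum.swap)

lemma mulv_scale: "mulv p M (\<lambda>v. c * x v) w = c * mulv p M x w"
  unfolding mulv_def by (simp add: sum_distrib_left algebra_simps)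

lemma bform_commute:
  assumes "\<And>u v. u < p \<Longrightarrow> v < p \<Longrightarrow> M u v = M v u"
  shows "bform p M x y = bform p M y x"
  unfolding bform_def mulv_def sum_distrib_right
  by (subst sum.swap) (intro sum.cong refl, simp add: assms mult_ac)

lemma wip_self_pos:
  assumes "\<And>v. v < p \<Longrightarrow> d v > 0" "v < p" "x v \<noteq> 0"
  shows "wip p d x x > 0"
proof -
  have "0 < x v * x v" using assms(3) by (cases "x v > 0") (auto simp: mult_neg_neg)
  then have "0 < d v * x v * x v" using assms by (simp add: mult.assoc)
  also have "\<dots> \<le> wip p d x x"
    unfolding wip_def by (rule member_le_sum) (use assms in \<open>auto simp: mult.assoc less_imp_le\<close>)
  finally show ?thesis .
qed

text \<open>The first-order condition at a minimum: for nonzero \<open>a\<close> the trial value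
  \<open>- a / k\<close> with \<open>c < 2 * k\<close> makes the quadratic negative.\<close>

lemma linear_coeff_zero:
  fixes a c :: real
  assumes "\<And>t. 0 \<le> 2 * t * a + t\<^sup>2 * c"
  shows "a = 0"
proof (rule ccontr)
  assume a: "a \<noteq> 0"
  define k where "k = \<bar>c\<bar> + 1"
  have k: "k > 0" "c < 2 * k" unfolding k_def by auto
  have "2 * (- a / k) * a + (- a / k)\<^sup>2 * c = a\<^sup>2 * (c - 2 * k) / k\<^sup>2"
    using k by (simp add: field_simps power2_eq_square)
  also have "\<dots> < 0" using a k by (simp add: divide_neg_pos mult_pos_neg)
  finally show False using assms[of "- a / k"] by linarith
qed

lemma bform_quadratic:
  assumes "\<And>u v. u < p \<Longrightarrow> v < p \<Longrightarrow> M u v = M v u"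
  shows "bform p M (\<lambda>v. x v + t * h v) (\<lambda>v. x v + t * h v)
    = bform p M x x + 2 * t * bform p M x h + t\<^sup>2 * bform p M h h"
  using bform_commute[of p M x h, OF assms] bform_commute[of p M x "\<lambda>v. x v + t * h v", OF assms]
    bform_commute[of p M h "\<lambda>v. x v + t * h v", OF assms]
  by (simp add: bform_add bform_scale power2_eq_square algebra_simps)

lemma wip_quadratic:
  "wip p d (\<lambda>v. x v + t * h v) (\<lambda>v. x v + t * h v)
    = wip p d x x + 2 * t * wip p d x h + t\<^sup>2 * wip p d h h"
  using wip_commute[of p d x h] wip_commute[of p d x "\<lambda>v. x v + t * h v"]
    wip_commute[of p d h "\<lambda>v. x v + t * h v"]
  by (simp add: wip_add wip_scale power2_eq_square algebra_simps)

lemma continuous_on_coord: "continuous_on K (\<lambda>x::nat \<Rightarrow> real. x v)"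
  by (rule continuous_on_subset[OF continuous_on_product_coordinates]) auto

text \<open>Vectors are functions on all naturals, so the coordinates from \<open>p\<close> on are
  fixed at 0; the set is then closed in a product of compact intervals.\<close>

lemma compact_wsphere:
  assumes "\<And>v. v < p \<Longrightarrow> d v > 0"
  shows "compact {x. (\<forall>v\<ge>p. x v = 0) \<and> wip p d x x = 1}"
proof -
  define R where "R v = (if v < p then {- sqrt (1 / d v) .. sqrt (1 / d v)} else {0::real})" for v
  have "compact (PiE UNIV R)"
    using compactin_PiE[of "\<lambda>_. euclidean" UNIV R]
    by (auto simp: euclidean_product_topology R_def)
  moreover have "closed {x. (\<forall>v\<ge>p. x v = 0) \<and> wip p d x x = 1}"
  proof -
    have eq: "{x. (\<forall>v\<ge>p. x v = 0) \<and> wip p d x x = 1}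
        = (\<Inter>v\<in>{p..}. {x. x v = 0}) \<inter> {x. wip p d x x = 1}" by auto
    show ?thesis unfolding eq unfolding wip_def
      by (intro closed_Int closed_INT ballI closed_Collect_eq continuous_intros continuous_on_coord)
  qed
  ultimately have "compact (PiE UNIV R \<inter> {x. (\<forall>v\<ge>p. x v = 0) \<and> wip p d x x = 1})"
    by (rule compact_Int_closed)
  moreover have "{x. (\<forall>v\<ge>p. x v = 0) \<and> wip p d x x = 1} \<subseteq> PiE UNIV R"
  proof (clarsimp simp: PiE_def Pi_def)
    fix x v assume x: "\<forall>v\<ge>p. x v = 0" "wip p d x x = 1"
    show "x v \<in> R v"
    proof (cases "v < p")
      case True
      have "d v * x v * x v \<le> wip p d x x"
        unfolding wip_def by (rule member_le_sum) (use assms True in \<open>auto simp: mult.assoc less_imp_le\<close>)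
      then have "(x v)\<^sup>2 \<le> 1 / d v"
        using x assms[OF True] by (simp add: field_simps power2_eq_square)
      then have "\<bar>x v\<bar> \<le> sqrt (1 / d v)" using real_le_rsqrt by force
      then show ?thesis using True by (auto simp: R_def)
    qed (use x in \<open>auto simp: R_def\<close>)
  qed
  ultimately show ?thesis by (simp only: Int_absorb1)
qed

lemma wip_cong: "(\<And>v. v < p \<Longrightarrow> x v = x' v) \<Longrightarrow> (\<And>v. v < p \<Longrightarrow> y v = y' v)
    \<Longrightarrow> wip p d x y = wip p d x' y'"
  unfolding wip_def by (rule sum.cong) auto

lemma mulv_cong: "(\<And>v. v < p \<Longrightarrow> x v = x' v) \<Longrightarrow> mulv p M x w = mulv p M x' w"
  unfolding mulv_def by (rule sum.cong) auto

lemma bform_cong: "(\<And>v. v < p \<Longrightarrow> x v = x' v) \<Longrightarrow> (\<And>v. v < p \<Longrightarrow> y v = y' v)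
    \<Longrightarrow> bform p M x y = bform p M x' y'"
  unfolding bform_def using mulv_cong[of p x x'] by (intro sum.cong) auto

lemma bform_scale2: "bform p M (\<lambda>v. c * x v) (\<lambda>v. c * x v) = c\<^sup>2 * bform p M x x"
  unfolding bform_def by (simp add: mulv_scale power2_eq_square sum_distrib_left algebra_simps)

lemma wip_scale2: "wip p d (\<lambda>v. c * x v) (\<lambda>v. c * x v) = c\<^sup>2 * wip p d x x"
  unfolding wip_def by (simp add: power2_eq_square sum_distrib_left algebra_simps)

text \<open>Minimisation of the Rayleigh quotient on the weighted complement of the eigenvectors
  found so far. The first variation gives the eigenvalue equation only against test vectors in that
  complement; symmetry of \<open>M\<close> supplies the other directions. The minimality clause
  stays in the conclusion because it orders the eigenvalues.\<close>

lemma rayleigh_step: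
  assumes d: "\<And>v. v < p \<Longrightarrow> d v > 0"
    and sym: "\<And>u v. u < p \<Longrightarrow> v < p \<Longrightarrow> M u v = M v u"
    and k: "k < p"
    and orth: "\<And>i j. i < k \<Longrightarrow> j < k \<Longrightarrow> wip p d (X i) (X j) = of_bool (i = j)"
    and eig: "\<And>i v. i < k \<Longrightarrow> v < p \<Longrightarrow> mulv p M (X i) v = th i * d v * X i v"
  shows "\<exists>t x. wip p d x x = 1 \<and> (\<forall>j<k. wip p d x (X j) = 0) \<and>
     (\<forall>v<p. mulv p M x v = t * d v * x v) \<and>
     (\<forall>y. (\<forall>j<k. wip p d y (X j) = 0) \<longrightarrow> t * wip p d y y \<le> bform p M y y)"
proof -
  define K where "K = {x. (\<forall>v\<ge>p. x v = 0) \<and> wip p d x x = 1} \<inter> {x. \<forall>j<k. wip p d x (X j) = 0}"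
  have normalise: "\<exists>c>0. (\<lambda>v. c * (if v < p then y v else 0)) \<in> K"
    if "\<And>j. j < k \<Longrightarrow> wip p d y (X j) = 0" "wip p d y y > 0" for y
  proof (intro exI conjI)
    let ?c = "1 / sqrt (wip p d y y)"
    show "?c > 0" using that by simp
    have "wip p d (\<lambda>v. if v < p then y v else 0) z = wip p d y z" for z
      by (rule wip_cong) auto
    moreover have "wip p d (\<lambda>v. if v < p then y v else 0) (\<lambda>v. if v < p then y v else 0) = wip p d y y"
      by (rule wip_cong) auto
    moreover have "?c\<^sup>2 * wip p d y y = 1" using that by (simp add: power_divide)
    ultimately show "(\<lambda>v. ?c * (if v < p then y v else 0)) \<in> K"
      unfolding K_def mem_Collect_eq Int_iff wip_scale2 wip_scale using that by simp
  qed
  have "compact K"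
  proof -
    have eq: "{x. \<forall>j<k. wip p d x (X j) = 0} = (\<Inter>j\<in>{..<k}. {x. wip p d x (X j) = 0})" by auto
    have "closed {x. \<forall>j<k. wip p d x (X j) = 0}"
      unfolding eq unfolding wip_def by (intro closed_INT ballI closed_Collect_eq continuous_intros continuous_on_coord)
    then show ?thesis unfolding K_def using compact_wsphere[of p d, OF d] by (rule_tac compact_Int_closed)
  qed
  moreover have "K \<noteq> {}"
  proof -
    have "card {..<k} < card {..<p}" using k by simp
    from homogeneous_system[OF _ _ this, of "\<lambda>j v. d v * X j v"]
    obtain x where x: "\<exists>u<p. x u \<noteq> 0" "\<forall>j<k. (\<Sum>u<p. d u * X j u * x u) = 0" by auto
    then have "wip p d x x > 0" using wip_self_pos d by blast
    moreover have "wip p d x (X j) = 0" if "j < k" for j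
      using x(2) that unfolding wip_def by (simp add: mult_ac)
    ultimately show ?thesis using normalise[of x] by blast
  qed
  moreover have "continuous_on K (\<lambda>x. bform p M x x)"
    unfolding bform_def mulv_def by (intro continuous_intros continuous_on_coord)
  ultimately obtain x where x: "x \<in> K" "\<And>y. y \<in> K \<Longrightarrow> bform p M x x \<le> bform p M y y"
    using continuous_attains_inf[of K "\<lambda>x. bform p M x x"] by auto
  define t where "t = bform p M x x"
  have xx: "wip p d x x = 1" and xX: "\<And>j. j < k \<Longrightarrow> wip p d x (X j) = 0" using x(1) by (auto simp: K_def)
  have min: "t * wip p d y y \<le> bform p M y y" if y: "\<And>j. j < k \<Longrightarrow> wip p d y (X j) = 0" for y
  proof (cases "\<exists>v<p. y v \<noteq> 0")
    case True
    then have pos: "wip p d y y > 0" using wip_self_pos d by blast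
    from normalise[OF y this] obtain c where c: "c > 0" "(\<lambda>v. c * (if v < p then y v else 0)) \<in> K" by auto
    have "wip p d (\<lambda>v. c * (if v < p then y v else 0)) (\<lambda>v. c * (if v < p then y v else 0))
        = c\<^sup>2 * wip p d y y" unfolding wip_scale2 by (intro arg_cong2[of _ _ _ _ "(*)"] wip_cong) auto
    then have w: "c\<^sup>2 * wip p d y y = 1" using c(2) by (simp add: K_def)
    have "bform p M (\<lambda>v. c * (if v < p then y v else 0)) (\<lambda>v. c * (if v < p then y v else 0))
        = c\<^sup>2 * bform p M y y" unfolding bform_scale2 by (intro arg_cong2[of _ _ _ _ "(*)"] bform_cong) auto
    with x(2)[OF c(2)] have "t * (c\<^sup>2 * wip p d y y) \<le> c\<^sup>2 * bform p M y y"
      unfolding w t_def by simp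
    then show ?thesis using c(1) by (simp add: mult.left_commute)
  next
    case False
    then have "wip p d y y = 0" "bform p M y y = 0" by (auto simp: wip_def bform_def)
    then show ?thesis by simp
  qed
  have crit: "bform p M x h = t * wip p d x h" if h: "\<And>j. j < k \<Longrightarrow> wip p d h (X j) = 0" for h
  proof -
    have "0 \<le> 2 * s * (bform p M x h - t * wip p d x h) + s\<^sup>2 * (bform p M h h - t * wip p d h h)" for s
    proof -
      have "t * wip p d (\<lambda>v. x v + s * h v) (\<lambda>v. x v + s * h v)
          \<le> bform p M (\<lambda>v. x v + s * h v) (\<lambda>v. x v + s * h v)"
        by (rule min) (simp add: wip_add wip_scale h xX)
      then show ?thesis
        by (simp add: bform_quadratic[OF sym] wip_quadratic xx t_def[symmetric] algebra_simps)
    qed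
    from linear_coeff_zero[OF this] show ?thesis by simp
  qed
  \<comment> \<open>An arbitrary \<open>h\<close> is split into its projection \<open>g\<close> onto
    the old eigenvectors, against which both sides vanish, and a remainder to which
    \<open>crit\<close> applies.\<close>
  have all: "bform p M x h = t * wip p d x h" for h
  proof -
    define g where "g v = (\<Sum>j<k. wip p d h (X j) * X j v)" for v
    have gX: "wip p d g (X i) = wip p d h (X i)" if "i < k" for i
    proof -
      have "wip p d g (X i) = (\<Sum>j<k. wip p d h (X j) * wip p d (X j) (X i))"
        unfolding g_def wip_sum wip_scale ..
      also have "\<dots> = (\<Sum>j<k. if j = i then wip p d h (X j) else 0)"
        by (rule sum.cong) (use orth that in auto)
      finally show ?thesis using that by simp
    qed
    have "wip p d g x = 0"
      unfolding g_def wip_sum wip_scale using xX by (simp add: wip_commute[of p d _ x])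
    moreover have "bform p M g x = 0"
    proof -
      have "bform p M g x = (\<Sum>v<p. (\<Sum>j<k. wip p d h (X j) * (th j * d v * X j v)) * x v)"
        unfolding bform_def g_def mulv_sum mulv_scale by (intro sum.cong refl) (simp add: eig)
      also have "\<dots> = (\<Sum>j<k. wip p d h (X j) * th j * wip p d x (X j))"
        unfolding wip_def sum_distrib_right sum_distrib_left
        by (subst sum.swap) (simp add: algebra_simps)
      finally show ?thesis using xX by simp
    qed
    moreover have "bform p M x (\<lambda>v. h v + - 1 * g v) = t * wip p d x (\<lambda>v. h v + - 1 * g v)"
      by (rule crit) (simp add: wip_diff gX)
    ultimately show ?thesis
      using bform_commute[OF sym, where x=x and y=h] bform_commute[OF sym, where x=x and y="\<lambda>v. h v + - 1 * g v"]
        wip_commute[of p d x h] wip_commute[of p d x "\<lambda>v. h v + - 1 * g v"]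
      by (simp only: bform_add bform_scale wip_add wip_scale)
         (simp add: wip_commute[of p d x] bform_commute[OF sym, where x=x])
  qed
  have eigx: "mulv p M x v = t * d v * x v" if v: "v < p" for v
  proof -
    have "(\<Sum>u<p. mulv p M x u * of_bool (u = v)) = mulv p M x v"
      using v by (simp add: of_bool_def sum.delta if_distrib cong: if_cong)
    moreover have "(\<Sum>u<p. d u * x u * of_bool (u = v)) = d v * x v"
      using v by (simp add: of_bool_def sum.delta if_distrib cong: if_cong)
    ultimately show ?thesis using all[of "\<lambda>u. of_bool (u = v)"] unfolding bform_def wip_def by simp
  qed
  show ?thesis using xx xX eigx min by blast
qed

lemma bform_eigen:
  assumes "\<And>v. v < p \<Longrightarrow> mulv p M x v = t * d v * x v"
  shows "bform p M x y = t * wip p d x y"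
  unfolding bform_def wip_def using assms by (simp add: sum_distrib_left mult_ac)

theorem eigensys_exists:
  assumes d: "\<And>v. v < p \<Longrightarrow> d v > 0"
    and sym: "\<And>u v. u < p \<Longrightarrow> v < p \<Longrightarrow> M u v = M v u"
  shows "\<exists>th X. eigensys p d M th X"
proof -
  \<comment> \<open>The third clause is the variational characterisation of \<open>th i\<close>;
    tested on a later vector \<open>X j\<close> it yields \<open>th i \<le> th j\<close>.\<close>
  define G where "G k th X \<longleftrightarrow> (\<forall>i<k. \<forall>j<k. wip p d (X i) (X j) = of_bool (i = j)) \<and>
     (\<forall>i<k. \<forall>v<p. mulv p M (X i) v = th i * d v * X i v) \<and>
     (\<forall>i<k. \<forall>y. (\<forall>j<i. wip p d y (X j) = 0) \<longrightarrow> th i * wip p d y y \<le> bform p M y y)"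
    for k :: nat and th X
  have "k \<le> p \<Longrightarrow> \<exists>th X. G k th X" for k
  proof (induction k)
    case 0
    show ?case by (simp add: G_def)
  next
    case (Suc k)
    then obtain th X where G: "G k th X" by auto
    have orth: "\<And>i j. i < k \<Longrightarrow> j < k \<Longrightarrow> wip p d (X i) (X j) = of_bool (i = j)"
      and eig: "\<And>i v. i < k \<Longrightarrow> v < p \<Longrightarrow> mulv p M (X i) v = th i * d v * X i v"
      and min: "\<And>i y. i < k \<Longrightarrow> (\<forall>j<i. wip p d y (X j) = 0) \<Longrightarrow> th i * wip p d y y \<le> bform p M y y"
      using G by (simp_all add: G_def)
    have "k < p" using Suc by simp
    from rayleigh_step[OF d sym this orth eig] obtain t x where
      x: "wip p d x x = 1" "\<forall>j<k. wip p d x (X j) = 0" "\<forall>v<p. mulv p M x v = t * d v * x v"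
      "\<And>y. (\<forall>j<k. wip p d y (X j) = 0) \<Longrightarrow> t * wip p d y y \<le> bform p M y y" by auto
    have "G (Suc k) (th(k := t)) (X(k := x))"
      unfolding G_def
    proof (intro conjI allI impI)
      fix i j assume "i < Suc k" "j < Suc k"
      moreover have "wip p d (X j) x = 0" if "j < k" for j
        using x(2) that by (subst wip_commute) simp
      ultimately show "wip p d ((X(k := x)) i) ((X(k := x)) j) = of_bool (i = j)"
        using orth x(1,2) by (auto simp: less_Suc_eq)
    next
      fix i v assume "i < Suc k" "v < p"
      then show "mulv p M ((X(k := x)) i) v = (th(k := t)) i * d v * (X(k := x)) i v"
        using eig x(3) by (auto simp: less_Suc_eq)
    next
      fix i y assume i: "i < Suc k" and "\<forall>j<i. wip p d y ((X(k := x)) j) = 0"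
      then have "\<forall>j<i. wip p d y (X j) = 0" by auto
      then show "(th(k := t)) i * wip p d y y \<le> bform p M y y"
        using min[of i y] x(4)[of y] i by (cases "i = k") auto
    qed
    then show ?case by blast
  qed
  from this[of p] obtain th X where G: "G p th X" by auto
  have orth: "\<And>i j. i < p \<Longrightarrow> j < p \<Longrightarrow> wip p d (X i) (X j) = of_bool (i = j)"
    and eig: "\<And>i v. i < p \<Longrightarrow> v < p \<Longrightarrow> mulv p M (X i) v = th i * d v * X i v"
    and min: "\<And>i y. i < p \<Longrightarrow> (\<forall>j<i. wip p d y (X j) = 0) \<Longrightarrow> th i * wip p d y y \<le> bform p M y y"
    using G by (simp_all add: G_def)
  have "th i \<le> th j" if "i \<le> j" "j < p" for i j
    using min[of i "X j"] that orth bform_eigen[of p M "X j" "th j" d "X j"] eig[of j] by auto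
  then show ?thesis unfolding eigensys_def using orth eig by blast
qed

text \<open>Completeness by counting: the eigenvectors together with \<open>x\<close> are
  \<open>p + 1\<close> vectors in \<open>p\<close> coordinates, hence dependent, and orthonormality
  forces the coefficient of \<open>x\<close> to be nonzero.\<close>

lemma eigensys_expand:
  assumes es: "eigensys p d M th X" and v: "v < p"
  shows "x v = (\<Sum>i<p. wip p d x (X i) * X i v)"
proof -
  have orth: "\<And>i j. i < p \<Longrightarrow> j < p \<Longrightarrow> wip p d (X i) (X j) = of_bool (i = j)"
    using es by (auto simp: eigensys_def)
  define V where "V i = (if i < p then X i else x)" for i
  have "card {..<p} < card {..<Suc p}" by simp
  from homogeneous_system[OF _ _ this, of "\<lambda>v i. V i v"] obtain c where
    c: "\<exists>i<Suc p. c i \<noteq> 0" "\<And>v. v < p \<Longrightarrow> (\<Sum>i<Suc p. V i v * c i) = 0" by auto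
  have c': "(\<Sum>i<p. c i * X i v) + c p * x v = 0" if "v < p" for v
    using c(2)[OF that] by (simp add: V_def mult.commute)
  have dot: "c i + c p * wip p d x (X i) = 0" if i: "i < p" for i
  proof -
    have "0 = wip p d (\<lambda>v. (\<Sum>i<p. c i * X i v) + c p * x v) (X i)"
      unfolding wip_def using c' by simp
    also have "\<dots> = (\<Sum>j<p. c j * wip p d (X j) (X i)) + c p * wip p d x (X i)"
      unfolding wip_add wip_sum wip_scale ..
    also have "(\<Sum>j<p. c j * wip p d (X j) (X i)) = (\<Sum>j<p. if j = i then c j else 0)"
      by (rule sum.cong) (use orth i in auto)
    finally show ?thesis using i by simp
  qed
  have "c p \<noteq> 0"
  proof
    assume "c p = 0"
    then have "c i = 0" if "i < p" for i using dot[OF that] by simp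
    then show False using c(1) \<open>c p = 0\<close> by (auto simp: less_Suc_eq)
  qed
  moreover have "c p * (x v - (\<Sum>i<p. wip p d x (X i) * X i v)) = 0"
  proof -
    have "(\<Sum>i<p. c i * X i v) = (\<Sum>i<p. - c p * (wip p d x (X i) * X i v))"
    proof (rule sum.cong)
      fix i assume "i \<in> {..<p}"
      then have "c i = - c p * wip p d x (X i)" using dot[of i] by simp
      then show "c i * X i v = - c p * (wip p d x (X i) * X i v)" by (simp add: mult.assoc)
    qed simp
    then show ?thesis using c'[OF v] by (simp add: sum_distrib_left[symmetric] sum_negf algebra_simps)
  qed
  ultimately show ?thesis by simp
qed

lemma eigensys_wip_sum:
  assumes es: "eigensys p d M th X" and J: "J \<subseteq> {..<p}"
  shows "wip p d (\<lambda>v. \<Sum>i\<in>J. a i * X i v) (\<lambda>v. \<Sum>i\<in>J. a i * X i v) = (\<Sum>i\<in>J. (a i)\<^sup>2)"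
    and "bform p M (\<lambda>v. \<Sum>i\<in>J. a i * X i v) (\<lambda>v. \<Sum>i\<in>J. a i * X i v) = (\<Sum>i\<in>J. th i * (a i)\<^sup>2)"
proof -
  have fin: "finite J" using J finite_subset by blast
  have orth: "\<And>i j. i < p \<Longrightarrow> j < p \<Longrightarrow> wip p d (X i) (X j) = of_bool (i = j)"
    and eig: "\<And>i v. i < p \<Longrightarrow> v < p \<Longrightarrow> mulv p M (X i) v = th i * d v * X i v"
    using es by (auto simp: eigensys_def)
  let ?x = "\<lambda>v. \<Sum>i\<in>J. a i * X i v"
  have 1: "wip p d ?x (X i) = a i" if "i \<in> J" for i
  proof -
    have "wip p d ?x (X i) = (\<Sum>j\<in>J. if j = i then a j else 0)"
      unfolding wip_sum wip_scale by (rule sum.cong) (use orth J that in \<open>auto simp: subset_eq\<close>)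
    then show ?thesis using that fin by simp
  qed
  have "wip p d ?x ?x = (\<Sum>i\<in>J. a i * wip p d (X i) ?x)" unfolding wip_sum wip_scale ..
  then show "wip p d ?x ?x = (\<Sum>i\<in>J. (a i)\<^sup>2)"
    using 1 by (simp add: wip_commute[of p d "X _"] power2_eq_square)
  have "bform p M ?x ?x = (\<Sum>v<p. \<Sum>i\<in>J. a i * th i * (d v * X i v * ?x v))"
    unfolding bform_def mulv_sum mulv_scale sum_distrib_right
    by (intro sum.cong refl) (use J eig in \<open>auto simp: subset_eq\<close>)
  also have "\<dots> = (\<Sum>i\<in>J. a i * th i * wip p d (X i) ?x)"
    unfolding wip_def sum_distrib_left by (rule sum.swap)
  finally show "bform p M ?x ?x = (\<Sum>i\<in>J. th i * (a i)\<^sup>2)"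
    using 1 by (simp add: wip_commute[of p d "X _"] power2_eq_square mult_ac)
qed

text \<open>Courant--Fischer comparison: the span of the upper eigenvectors of one form meets the span of
  the lower eigenvectors of the other one.\<close>
lemma eigensys_minmax:
  assumes es: "eigensys p d M th X" and es': "eigensys p d N ph Z" and i: "i < p"
  shows "\<exists>x. wip p d x x > 0 \<and> th i * wip p d x x \<le> bform p M x x \<and> bform p N x x \<le> ph i * wip p d x x"
proof -
  define V where "V = (\<lambda>c v. if c < p then X c v else Z (c - p) v)"
  \<comment> \<open>Indices below \<open>p\<close> refer to \<open>X\<close>, and
    \<open>p + j\<close> refers to \<open>Z j\<close>. The \<open>p - i\<close> upper vectors and
    the \<open>i + 1\<close> lower ones are together one too many to be independent.\<close>
  define U where "U = {i..<p} \<union> {p..p + i}"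
  have "card U = p - i + (i + 1)"
    unfolding U_def by (subst card_Un_disjoint) auto
  then have "card {..<p} < card U" using i by simp
  from homogeneous_system[OF _ _ this, of "\<lambda>v c. V c v"] obtain c where
    c: "\<exists>u\<in>U. c u \<noteq> 0" "\<And>v. v < p \<Longrightarrow> (\<Sum>u\<in>U. V u v * c u) = 0" by (auto simp: U_def)
  define x where "x = (\<lambda>v. \<Sum>j\<in>{i..<p}. c j * X j v)"
  define y where "y = (\<lambda>v. \<Sum>j\<in>{..i}. - c (p + j) * Z j v)"
  have xy: "x v = y v" if "v < p" for v
  proof -
    have "(\<Sum>u\<in>{p..p+i}. V u v * c u) = (\<Sum>j\<in>{..i}. Z j v * c (p + j))"
      by (rule sum.reindex_bij_witness[of _ "\<lambda>j. p + j" "\<lambda>u. u - p"]) (auto simp: V_def)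
    moreover have "(\<Sum>u\<in>{i..<p}. V u v * c u) = (\<Sum>j\<in>{i..<p}. X j v * c j)"
      by (rule sum.cong) (auto simp: V_def)
    moreover have "(\<Sum>u\<in>U. V u v * c u) = (\<Sum>u\<in>{i..<p}. V u v * c u) + (\<Sum>u\<in>{p..p+i}. V u v * c u)"
      unfolding U_def by (rule sum.union_disjoint) auto
    ultimately show ?thesis using c(2)[OF that] unfolding x_def y_def
      by (simp add: sum_negf mult.commute)
  qed
  have wx: "wip p d x x = (\<Sum>j\<in>{i..<p}. (c j)\<^sup>2)"
    and bx: "bform p M x x = (\<Sum>j\<in>{i..<p}. th j * (c j)\<^sup>2)"
    unfolding x_def using eigensys_wip_sum[OF es, of "{i..<p}" c] by (simp_all add: subset_eq)
  have wy: "wip p d y y = (\<Sum>j\<in>{..i}. (c (p + j))\<^sup>2)"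
    and "by": "bform p N y y = (\<Sum>j\<in>{..i}. ph j * (c (p + j))\<^sup>2)"
    unfolding y_def using eigensys_wip_sum[OF es', of "{..i}" "\<lambda>j. - c (p + j)"] i by (simp_all add: subset_eq)
  have weq: "wip p d x x = wip p d y y" "bform p N x x = bform p N y y"
    using wip_cong bform_cong xy by blast+
  have ne: "wip p d x x \<noteq> 0"
  proof
    assume "wip p d x x = 0"
    then have "\<forall>j\<in>{i..<p}. c j = 0" "\<forall>j\<in>{..i}. c (p + j) = 0"
      using wx wy weq by (auto simp: sum_nonneg_eq_0_iff)
    moreover have "u \<in> U \<Longrightarrow> u \<in> {i..<p} \<or> (\<exists>j\<le>i. u = p + j)" for u
      by (auto simp: U_def le_iff_add)
    ultimately show False using c(1) by fastforce
  qed
  moreover have "wip p d x x \<ge> 0" unfolding wx by (intro sum_nonneg) auto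
  moreover have "th i * wip p d x x \<le> bform p M x x"
    unfolding wx bx sum_distrib_left
    by (intro sum_mono mult_right_mono) (use es in \<open>auto simp: eigensys_def\<close>)
  moreover have "bform p N x x \<le> ph i * wip p d x x"
    unfolding weq wy "by" sum_distrib_left
    by (intro sum_mono mult_right_mono) (use es' i in \<open>auto simp: eigensys_def\<close>)
  ultimately show ?thesis by (intro exI[of _ x]) auto
qed

lemma eigensys_top:
  assumes es: "eigensys p d M th X" and p: "0 < p"
  shows "bform p M x x \<le> th (p - 1) * wip p d x x" and "th 0 * wip p d x x \<le> bform p M x x"
proof -
  define a where "a i = wip p d x (X i)" for i
  let ?y = "\<lambda>v. \<Sum>i<p. a i * X i v"
  have e: "bform p M x x = bform p M ?y ?y" "wip p d x x = wip p d ?y ?y"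
    using eigensys_expand[OF es, of _ x] by (auto intro!: bform_cong wip_cong simp: a_def)
  have mono: "i < p \<Longrightarrow> th i \<le> th (p - 1)" "i < p \<Longrightarrow> th 0 \<le> th i" for i
    using es p by (auto simp: eigensys_def)
  show "bform p M x x \<le> th (p - 1) * wip p d x x" "th 0 * wip p d x x \<le> bform p M x x"
    unfolding e eigensys_wip_sum[OF es subset_refl] sum_distrib_left
    by (intro sum_mono mult_right_mono; (rule mono | simp); simp)+
qed

section \<open>Trees\<close>

lemma edge_rel_iff:
  "(u, v) \<in> edge_rel p E \<longleftrightarrow>
     (\<exists>j<p-1. (fst (E j) = u \<and> snd (E j) = v) \<or> (fst (E j) = v \<and> snd (E j) = u))"
  unfolding edge_rel_def by blast

lemma tree_propagate:
  assumes tree: "is_tree p E" and "P 0"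
    and step: "\<And>j. j < p - 1 \<Longrightarrow> P (fst (E j)) \<longleftrightarrow> P (snd (E j))" and v: "v < p"
  shows "P v"
proof -
  have "(0, v) \<in> (edge_rel p E)\<^sup>*" using tree v by (auto simp: is_tree_def)
  then show ?thesis
    by (induction rule: rtrancl_induct) (use \<open>P 0\<close> step in \<open>auto simp only: edge_rel_iff\<close>)
qed

lemma tree_const:
  assumes "is_tree p E" "\<And>j. j < p - 1 \<Longrightarrow> w (fst (E j)) = w (snd (E j))" "v < p"
  shows "w v = w 0"
  by (rule tree_propagate[OF assms(1), of "\<lambda>v. w v = w 0"]) (simp_all add: assms(2,3))

lemma tree_endpoints:
  assumes "is_tree p E" "j < p - 1"
  shows "fst (E j) < p" "snd (E j) < p" "fst (E j) \<noteq> snd (E j)"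
  using assms by (auto simp: is_tree_def)

lemma tree_zero:
  fixes w :: "nat \<Rightarrow> 'a::field"
  assumes "is_tree p E" "s \<noteq> 0" "\<And>j. j < p - 1 \<Longrightarrow> w (snd (E j)) = s * w (fst (E j))" "w 0 = 0" "v < p"
  shows "w v = 0"
  by (rule tree_propagate[OF assms(1), of "\<lambda>v. w v = 0"]) (simp_all add: assms(2-))

text \<open>Acyclicity in algebraic form. Among the \<open>p - 1\<close> edge relations that of
  \<open>j0\<close> is replaced by \<open>w 0 = 0\<close>. A nontrivial solution must break the
  relation at \<open>j0\<close>, since otherwise it would vanish everywhere by propagation from 0.
  For \<open>s = 1\<close> it is, up to a factor, the indicator of the component that deleting
  \<open>j0\<close> cuts off from 0.\<close>

lemma tree_delete_edge:
  fixes s :: "'a::field"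
  assumes tree: "is_tree p E" and s: "s \<noteq> 0" and j0: "j0 < p - 1"
  shows "\<exists>w. (\<forall>j<p-1. j \<noteq> j0 \<longrightarrow> w (snd (E j)) = s * w (fst (E j))) \<and>
    w (snd (E j0)) \<noteq> s * w (fst (E j0))"
proof -
  define M where "M i v = (if i = j0 then of_bool (v = 0)
      else of_bool (v = snd (E i)) - s * of_bool (v = fst (E i)))" for i v
  have "card {..<p - 1} < card {..<p}" using tree by (auto simp: is_tree_def)
  from homogeneous_system[OF _ _ this, of M] obtain w where
    w: "\<exists>v<p. w v \<noteq> 0" "\<And>i. i < p - 1 \<Longrightarrow> (\<Sum>v<p. M i v * w v) = 0" by auto
  have delta: "(\<Sum>v<p. of_bool (v = u) * w v) = w u" if "u < p" for u
    using that by (simp add: of_bool_def if_distrib[of "\<lambda>x. x * _"] sum.delta cong: if_cong)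
  have eq: "w (snd (E j)) = s * w (fst (E j))" if "j < p - 1" "j \<noteq> j0" for j
  proof -
    have "(\<Sum>v<p. M j v * w v) = w (snd (E j)) - s * w (fst (E j))"
      using tree_endpoints[OF tree that(1)] that(2)
      by (simp add: M_def left_diff_distrib sum_subtractf delta mult.assoc sum_distrib_left[symmetric])
    then show ?thesis using w(2)[OF that(1)] by simp
  qed
  have "w 0 = 0" using w(2)[OF j0] delta[of 0] j0 by (simp add: M_def)
  have "w (snd (E j0)) \<noteq> s * w (fst (E j0))"
  proof
    assume "w (snd (E j0)) = s * w (fst (E j0))"
    then have "\<And>j. j < p - 1 \<Longrightarrow> w (snd (E j)) = s * w (fst (E j))" using eq by metis
    then have "w v = 0" if "v < p" for v
      using tree_zero[OF tree s, of w v] \<open>w 0 = 0\<close> that by blast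
    then show False using w(1) by auto
  qed
  then show ?thesis using eq by blast
qed

text \<open>A second edge with the same ends would impose on \<open>w\<close> the very equality that
  fails at \<open>j\<close>. This reconciles the 0-1 entries of the adjacency matrix with sums over
  edges.\<close>

lemma tree_no_parallel:
  assumes tree: "is_tree p E" and j: "j < p - 1" "j' < p - 1"
    and par: "{fst (E j), snd (E j)} = {fst (E j'), snd (E j')}"
  shows "j = j'"
proof (rule ccontr)
  assume ne: "j \<noteq> j'"
  obtain w :: "nat \<Rightarrow> real" where "\<forall>i<p-1. i \<noteq> j \<longrightarrow> w (snd (E i)) = 1 * w (fst (E i))"
    "w (snd (E j)) \<noteq> 1 * w (fst (E j))"
    using tree_delete_edge[OF tree one_neq_zero j(1)] by blast
  then show False using j(2) ne par by (auto simp: doubleton_eq_iff)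
qed

lemma adjmat_eq_sum:
  assumes tree: "is_tree p E"
  shows "adjmat p E v u = (\<Sum>j<p-1. of_bool (fst (E j) = v \<and> snd (E j) = u)
     + of_bool (snd (E j) = v \<and> fst (E j) = u))"
proof (cases "(v, u) \<in> edge_rel p E")
  case True
  then obtain j where j: "j < p - 1" "(fst (E j) = v \<and> snd (E j) = u) \<or> (snd (E j) = v \<and> fst (E j) = u)"
    by (auto simp only: edge_rel_iff)
  have "(\<Sum>j'<p-1. of_bool (fst (E j') = v \<and> snd (E j') = u)
     + of_bool (snd (E j') = v \<and> fst (E j') = u)) = (\<Sum>j'<p-1. of_bool (j' = j) :: real)"
  proof (rule sum.cong)
    fix j' assume j': "j' \<in> {..<p-1}"
    show "of_bool (fst (E j') = v \<and> snd (E j') = u)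
     + of_bool (snd (E j') = v \<and> fst (E j') = u) = (of_bool (j' = j) :: real)"
    proof (cases "j' = j")
      case True
      then show ?thesis using j tree_endpoints[OF tree j(1)] by auto
    next
      case False
      then have "{fst (E j), snd (E j)} \<noteq> {fst (E j'), snd (E j')}"
        using tree_no_parallel[OF tree j(1), of j'] j' by auto
      then have "\<not> (fst (E j') = v \<and> snd (E j') = u)" "\<not> (snd (E j') = v \<and> fst (E j') = u)"
        using j(2) insert_commute by metis+
      then show ?thesis using False by (simp only: of_bool_eq add_0_left)
    qed
  qed simp
  then show ?thesis using True j(1) by (simp add: adjmat_def)
next
  case False
  then have no: "\<not> (fst (E j) = v \<and> snd (E j) = u)" "\<not> (snd (E j) = v \<and> fst (E j) = u)"
    if "j < p - 1" for j
    using that unfolding edge_rel_iff by blast+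
  have "(\<Sum>j<p-1. of_bool (fst (E j) = v \<and> snd (E j) = u)
     + of_bool (snd (E j) = v \<and> fst (E j) = u)) = (0::real)"
    by (intro sum.neutral ballI) (simp only: lessThan_iff no of_bool_eq add_0_left)
  then show ?thesis using False by (simp add: adjmat_def)
qed

lemma sum_of_bool_mult:
  fixes f :: "nat \<Rightarrow> 'a::semiring_1"
  assumes "i < n"
  shows "(\<Sum>u<n. of_bool (i = u) * f u) = f i" "(\<Sum>u<n. of_bool (u = i) * f u) = f i"
  using assms by (simp_all add: of_bool_def if_distrib[of "\<lambda>x. x * _"] sum.delta sum.delta' cong: if_cong)

lemma adjmat_mult_sum:
  fixes x :: "nat \<Rightarrow> 'a::real_algebra_1"
  assumes tree: "is_tree p E"
  shows "(\<Sum>u<p. of_real (adjmat p E v u) * x u)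
    = (\<Sum>j<p-1. of_bool (fst (E j) = v) * x (snd (E j)) + of_bool (snd (E j) = v) * x (fst (E j)))"
proof -
  have "(\<Sum>u<p. of_real (adjmat p E v u) * x u) = (\<Sum>u<p. \<Sum>j<p-1.
     of_bool (fst (E j) = v) * (of_bool (snd (E j) = u) * x u)
     + of_bool (snd (E j) = v) * (of_bool (fst (E j) = u) * x u))"
    unfolding adjmat_eq_sum[OF tree] of_real_sum sum_distrib_right
    by (intro sum.cong refl) (auto simp: of_bool_def algebra_simps)
  also have "\<dots> = (\<Sum>j<p-1. \<Sum>u<p.
     of_bool (fst (E j) = v) * (of_bool (snd (E j) = u) * x u)
     + of_bool (snd (E j) = v) * (of_bool (fst (E j) = u) * x u))" by (rule sum.swap)
  also have "\<dots> = (\<Sum>j<p-1. of_bool (fst (E j) = v) * x (snd (E j)) + of_bool (snd (E j) = v) * x (fst (E j)))"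
    unfolding sum.distrib sum_distrib_left[symmetric]
    by (intro arg_cong2[of _ _ _ _ "(+)"] sum.cong refl) (simp_all add: sum_of_bool_mult tree_endpoints[OF tree])
  finally show ?thesis .
qed

lemma deg_eq_sum:
  assumes tree: "is_tree p E"
  shows "of_nat (deg p E v) = (\<Sum>j<p-1. of_bool (fst (E j) = v) + of_bool (snd (E j) = v) :: 'a::semiring_1)"
proof -
  have eq: "{j. j < p - 1 \<and> (fst (E j) = v \<or> snd (E j) = v)}
      = {..<p-1} \<inter> {j. fst (E j) = v \<or> snd (E j) = v}" by auto
  have "of_nat (deg p E v) = (\<Sum>j<p-1. of_bool (fst (E j) = v \<or> snd (E j) = v) :: 'a)"
    unfolding deg_def eq by (rule sum_of_bool_eq[OF finite_lessThan finite_lessThan, symmetric])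
  also have "\<dots> = (\<Sum>j<p-1. of_bool (fst (E j) = v) + of_bool (snd (E j) = v))"
    by (intro sum.cong refl) (use tree_endpoints[OF tree] in auto)
  finally show ?thesis .
qed

text \<open>If no edge met \<open>v\<close>, being equal to \<open>v\<close> would be invariant
  along edges, contradicting connectedness with at least two vertices. Positivity makes the degrees
  an admissible weight.\<close>

lemma deg_pos:
  assumes tree: "is_tree p E" and v: "v < p"
  shows "0 < deg p E v"
proof (rule ccontr)
  assume "\<not> 0 < deg p E v"
  then have "{j. j < p - 1 \<and> (fst (E j) = v \<or> snd (E j) = v)} = {}" by (simp add: deg_def)
  then have no: "fst (E j) \<noteq> v" "snd (E j) \<noteq> v" if "j < p - 1" for j using that by blast+
  have const: "(u = v) = (0 = v)" if "u < p" for u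
    by (rule tree_propagate[OF tree _ _ that]) (simp_all only: no)
  have "1 < p" using tree by (simp add: is_tree_def)
  then show False using const[OF v] const[of 1] by simp
qed

text \<open>A tree carries no circulation: pairing the balance equations with a vertex function that
  breaks the edge relation at \<open>j0\<close> alone cancels every other edge. The sign
  \<open>s\<close> serves even and odd multiples of pi at once.\<close>

lemma tree_flux_zero:
  fixes phi :: "nat \<Rightarrow> 'a::field"
  assumes tree: "is_tree p E" and s: "s * s = 1"
    and flux: "\<And>v. v < p \<Longrightarrow> (\<Sum>j<p-1. of_bool (snd (E j) = v) * (s * phi j) - of_bool (fst (E j) = v) * phi j) = 0"
    and j0: "j0 < p - 1"
  shows "phi j0 = 0"
proof -
  have "s \<noteq> 0" using s by auto
  from tree_delete_edge[OF tree this j0] obtain w where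
    w: "\<And>j. j < p - 1 \<Longrightarrow> j \<noteq> j0 \<Longrightarrow> w (snd (E j)) = s * w (fst (E j))" "w (snd (E j0)) \<noteq> s * w (fst (E j0))"
    by auto
  have "0 = (\<Sum>v<p. w v * (\<Sum>j<p-1. of_bool (snd (E j) = v) * (s * phi j) - of_bool (fst (E j) = v) * phi j))"
    using flux by simp
  also have "\<dots> = (\<Sum>j<p-1. \<Sum>v<p. of_bool (snd (E j) = v) * (w v * (s * phi j)) - of_bool (fst (E j) = v) * (w v * phi j))"
    unfolding sum_distrib_left by (subst sum.swap) (intro sum.cong refl, simp add: algebra_simps)
  also have "\<dots> = (\<Sum>j<p-1. phi j * (s * w (snd (E j)) - w (fst (E j))))"
    unfolding sum_subtractf
    by (simp add: sum_of_bool_mult tree_endpoints[OF tree] sum_subtractf[symmetric]) (simp add: algebra_simps)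
  also have "\<dots> = (\<Sum>j<p-1. of_bool (j = j0) * (phi j0 * (s * w (snd (E j0)) - w (fst (E j0)))))"
  proof (rule sum.cong)
    fix j assume "j \<in> {..<p-1}"
    then show "phi j * (s * w (snd (E j)) - w (fst (E j)))
        = of_bool (j = j0) * (phi j0 * (s * w (snd (E j0)) - w (fst (E j0))))"
      using w(1)[of j] s by (cases "j = j0") (auto simp: mult.assoc[symmetric])
  qed simp
  also have "\<dots> = phi j0 * (s * w (snd (E j0)) - w (fst (E j0)))"
    using sum_of_bool_mult(2)[OF j0, of "\<lambda>_. phi j0 * (s * w (snd (E j0)) - w (fst (E j0)))"] by simp
  finally have "phi j0 * (s * w (snd (E j0)) - w (fst (E j0))) = 0" by simp
  moreover have "s * w (snd (E j0)) \<noteq> w (fst (E j0))"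
    using w(2) s by (metis mult.assoc mult_1)
  ultimately show ?thesis by simp
qed

text \<open>There are fewer edge relations than vertices, so a nontrivial solution exists; its
  absolute value is constant by connectedness, and \<open>sgn\<close> normalises it.\<close>

lemma tree_signing:
  fixes s :: real
  assumes tree: "is_tree p E" and s: "s = 1 \<or> s = -1"
  shows "\<exists>u :: nat \<Rightarrow> real. (\<forall>v<p. u v = 1 \<or> u v = -1) \<and> (\<forall>j<p-1. u (snd (E j)) = s * u (fst (E j)))"
proof -
  have "card {..<p - 1} < card {..<p}" using tree by (auto simp: is_tree_def)
  from homogeneous_system[OF _ _ this, of "\<lambda>i v. of_bool (v = snd (E i)) - s * of_bool (v = fst (E i))"]
  obtain w where w: "\<exists>v<p. w v \<noteq> 0"
    "\<And>i. i < p - 1 \<Longrightarrow> (\<Sum>v<p. (of_bool (v = snd (E i)) - s * of_bool (v = fst (E i))) * w v) = 0" by auto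
  have eq: "w (snd (E j)) = s * w (fst (E j))" if "j < p - 1" for j
    using w(2)[OF that] tree_endpoints[OF tree that]
    by (simp add: left_diff_distrib sum_subtractf sum_of_bool_mult mult.assoc sum_distrib_left[symmetric])
  have "\<bar>w v\<bar> = \<bar>w 0\<bar>" if "v < p" for v
    by (rule tree_const[OF tree _ that]) (use eq s in auto)
  then have "w v \<noteq> 0" if "v < p" for v using w(1) that by (metis abs_eq_0)
  then have "\<forall>v<p. sgn (w v) = 1 \<or> sgn (w v) = -1" by (auto simp: sgn_if)
  moreover have "\<forall>j<p-1. sgn (w (snd (E j))) = s * sgn (w (fst (E j)))"
    using eq s by (auto simp: sgn_minus)
  ultimately show ?thesis by (intro exI[of _ "\<lambda>v. sgn (w v)"]) auto
qed

section \<open>The vertex matrix and its quadratic form\<close>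

definition robin_matrix :: "nat \<Rightarrow> (nat \<Rightarrow> nat \<times> nat) \<Rightarrow> (nat \<Rightarrow> real) \<Rightarrow> real \<Rightarrow> real \<Rightarrow> nat \<Rightarrow> nat \<Rightarrow> real" where
  "robin_matrix p E b C S v u = adjmat p E v u - C * degmat p E v u - of_bool (v = u) * (S * b v)"

text \<open>The quadratic form of \<open>robin_matrix\<close>, summed over edges so that later
  estimates can be made one edge at a time.\<close>

definition robin_form :: "nat \<Rightarrow> (nat \<Rightarrow> nat \<times> nat) \<Rightarrow> (nat \<Rightarrow> real) \<Rightarrow> real \<Rightarrow> real \<Rightarrow> (nat \<Rightarrow> real) \<Rightarrow> real" where
  "robin_form p E b C S x =
     (\<Sum>j<p-1. 2 * x (fst (E j)) * x (snd (E j)) - C * ((x (fst (E j)))\<^sup>2 + (x (snd (E j)))\<^sup>2))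
     - S * (\<Sum>v<p. b v * (x v)\<^sup>2)"

abbreviation degr :: "nat \<Rightarrow> (nat \<Rightarrow> nat \<times> nat) \<Rightarrow> nat \<Rightarrow> real" where
  "degr p E v \<equiv> real (deg p E v)"

lemma robin_matrix_sym: "robin_matrix p E b C S u v = robin_matrix p E b C S v u"
  unfolding robin_matrix_def adjmat_def degmat_def edge_rel_iff by auto

lemma sum_vertex_ends:
  fixes h :: "nat \<Rightarrow> nat \<Rightarrow> 'a::comm_ring_1"
  assumes tree: "is_tree p E"
  shows "(\<Sum>v<p. \<Sum>j<p-1. of_bool (fst (E j) = v) * h v j) = (\<Sum>j<p-1. h (fst (E j)) j)"
    "(\<Sum>v<p. \<Sum>j<p-1. of_bool (snd (E j) = v) * h v j) = (\<Sum>j<p-1. h (snd (E j)) j)"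
  by (subst sum.swap, simp add: sum_of_bool_mult tree_endpoints[OF tree])+

lemma wip_degr:
  assumes tree: "is_tree p E"
  shows "wip p (degr p E) x x = (\<Sum>j<p-1. (x (fst (E j)))\<^sup>2 + (x (snd (E j)))\<^sup>2)"
proof -
  have "wip p (degr p E) x x = (\<Sum>v<p. \<Sum>j<p-1. of_bool (fst (E j) = v) * (x v)\<^sup>2)
     + (\<Sum>v<p. \<Sum>j<p-1. of_bool (snd (E j) = v) * (x v)\<^sup>2)"
    unfolding wip_def deg_eq_sum[OF tree]
    by (simp add: sum_distrib_right sum_distrib_left sum.distrib power2_eq_square algebra_simps
        del: sum_of_bool_eq sum_mult_of_bool_eq sum_of_bool_mult_eq)
  then show ?thesis by (simp only: sum_vertex_ends[OF tree] sum.distrib)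
qed

lemma bform_robin_matrix:
  assumes tree: "is_tree p E"
  shows "bform p (robin_matrix p E b C S) x x = robin_form p E b C S x"
proof -
  have "mulv p (robin_matrix p E b C S) x v * x v
     = (\<Sum>j<p-1. of_bool (fst (E j) = v) * (x (snd (E j)) * x v))
     + (\<Sum>j<p-1. of_bool (snd (E j) = v) * (x (fst (E j)) * x v))
     - C * (degr p E v * x v * x v) - S * (b v * (x v)\<^sup>2)" if v: "v < p" for v
  proof -
    have A: "(\<Sum>u<p. adjmat p E v u * x u) = (\<Sum>j<p-1. of_bool (fst (E j) = v) * x (snd (E j)))
        + (\<Sum>j<p-1. of_bool (snd (E j) = v) * x (fst (E j)))"
      using adjmat_mult_sum[OF tree, of v x] by (simp add: sum.distrib)
    have D: "(\<Sum>u<p. C * (degmat p E v u * x u)) = C * (degr p E v * x v)"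
      using sum_of_bool_mult(1)[OF v, of "\<lambda>u. C * (degr p E v * x u)"]
      by (simp add: degmat_def of_bool_def if_distrib[of "\<lambda>x. x * _"] if_distrib[of "\<lambda>x. C * x"] cong: if_cong)
    have B: "(\<Sum>u<p. of_bool (v = u) * (S * b v) * x u) = S * b v * x v"
      using sum_of_bool_mult(1)[OF v, of "\<lambda>u. S * b v * x u"] by (simp add: mult.assoc)
    have M: "mulv p (robin_matrix p E b C S) x v
       = (\<Sum>u<p. adjmat p E v u * x u) - (\<Sum>u<p. C * (degmat p E v u * x u))
         - (\<Sum>u<p. of_bool (v = u) * (S * b v) * x u)"
      unfolding mulv_def robin_matrix_def by (simp add: left_diff_distrib sum_subtractf mult.assoc)
    show ?thesis unfolding M A B D
      by (simp add: algebra_simps power2_eq_square sum_distrib_left sum_distrib_right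
          del: sum_of_bool_eq sum_mult_of_bool_eq sum_of_bool_mult_eq)
  qed
  then have "bform p (robin_matrix p E b C S) x x
     = (\<Sum>v<p. \<Sum>j<p-1. of_bool (fst (E j) = v) * (x (snd (E j)) * x v))
     + (\<Sum>v<p. \<Sum>j<p-1. of_bool (snd (E j) = v) * (x (fst (E j)) * x v))
     - C * wip p (degr p E) x x - S * (\<Sum>v<p. b v * (x v)\<^sup>2)"
    unfolding bform_def wip_def by (simp add: sum.distrib sum_subtractf sum_distrib_left)
  then show ?thesis
    unfolding robin_form_def sum_vertex_ends[OF tree] wip_degr[OF tree]
    by (simp add: sum_subtractf sum.distrib[symmetric] sum_distrib_left algebra_simps)
qed

section \<open>Reduction to the vertex values\<close>

text \<open>A basis indexed by \<open>K\<close> attains the \<open>GREATEST\<close>, and more than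
  \<open>card K\<close> solutions are dependent because their coordinate vectors are. Equalities are
  asked only on the edges and on \<open>{0..ell}\<close>, since solutions are arbitrary
  elsewhere.\<close>

lemma robin_mult_eqI:
  fixes K :: "nat set"
  assumes fin: "finite K"
    and sol: "\<And>i. i \<in> K \<Longrightarrow> robin_sol p E ell b mu (Ys i)"
    and indep: "\<And>c :: nat \<Rightarrow> complex. \<lbrakk>\<And>j t. j < p - 1 \<Longrightarrow> t \<in> {0..ell} \<Longrightarrow> (\<Sum>i\<in>K. c i * Ys i j t) = 0\<rbrakk>
        \<Longrightarrow> \<forall>i\<in>K. c i = 0"
    and span: "\<And>Y. robin_sol p E ell b mu Y \<Longrightarrow>
        \<exists>a. \<forall>j<p-1. \<forall>t\<in>{0..ell}. Y j t = (\<Sum>i\<in>K. a i * Ys i j t)"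
  shows "robin_mult p E ell b mu = card K"
proof -
  obtain e where e: "bij_betw e {..<card K} K"
    using fin by (metis bij_betw_from_nat_into_finite)
  show ?thesis
    unfolding robin_mult_def
  proof (rule Greatest_equality)
    show "\<exists>Ys. (\<forall>i<card K. robin_sol p E ell b mu (Ys i)) \<and>
      (\<forall>c. (\<forall>j<p - 1. \<forall>x\<in>{0..ell}. (\<Sum>i<card K. c i * Ys i j x) = 0) \<longrightarrow> (\<forall>i<card K. c i = (0::complex)))"
    proof (intro exI[of _ "\<lambda>i. Ys (e i)"] conjI allI impI)
      fix i assume "i < card K"
      then show "robin_sol p E ell b mu (Ys (e i))"
        using bij_betwE[OF e] by (intro sol) auto
    next
      fix c :: "nat \<Rightarrow> complex" and i
      assume 0: "\<forall>j<p - 1. \<forall>x\<in>{0..ell}. (\<Sum>i<card K. c i * Ys (e i) j x) = 0" and i: "i < card K"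
      define f where "f = the_inv_into {..<card K} e"
      have f: "f (e i) = i" if "i < card K" for i
        unfolding f_def using e that by (intro the_inv_into_f_f) (auto simp: bij_betw_def)
      have "\<forall>k\<in>K. c (f k) = 0"
      proof (rule indep)
        fix j t assume "j < p - 1" "t \<in> {0..ell}"
        then have "0 = (\<Sum>i<card K. c (f (e i)) * Ys (e i) j t)" using 0 f by simp
        also have "\<dots> = (\<Sum>k\<in>K. c (f k) * Ys k j t)"
          by (rule sum.reindex_bij_betw[OF e])
        finally show "(\<Sum>k\<in>K. c (f k) * Ys k j t) = 0" by simp
      qed
      then show "c i = 0" using f[OF i] bij_betwE[OF e] i by (metis lessThan_iff)
    qed
  next
    fix m :: nat
    assume "\<exists>Zs. (\<forall>i<m. robin_sol p E ell b mu (Zs i)) \<and>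
      (\<forall>c. (\<forall>j<p - 1. \<forall>x\<in>{0..ell}. (\<Sum>i<m. c i * Zs i j x) = 0) \<longrightarrow> (\<forall>i<m. c i = (0::complex)))"
    then obtain Zs where Zs: "\<And>i. i < m \<Longrightarrow> robin_sol p E ell b mu (Zs i)"
      "\<And>c i. (\<forall>j<p - 1. \<forall>x\<in>{0..ell}. (\<Sum>i<m. c i * Zs i j x) = 0) \<Longrightarrow> i < m \<Longrightarrow> c i = (0::complex)"
      by blast
    show "m \<le> card K"
    proof (rule ccontr)
      assume "\<not> m \<le> card K"
      then have less: "card K < card {..<m}" by simp
      have "\<forall>k\<in>{..<m}. \<exists>a. \<forall>j<p-1. \<forall>t\<in>{0..ell}. Zs k j t = (\<Sum>i\<in>K. a i * Ys i j t)"
        using Zs(1) span by auto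
      from bchoice[OF this] obtain a where
        a: "\<And>k j t. k < m \<Longrightarrow> j < p - 1 \<Longrightarrow> t \<in> {0..ell} \<Longrightarrow> Zs k j t = (\<Sum>i\<in>K. a k i * Ys i j t)" by auto
      from homogeneous_system[OF fin _ less, of "\<lambda>i k. a k i"] obtain c where
        c: "\<exists>k<m. c k \<noteq> 0" "\<And>i. i \<in> K \<Longrightarrow> (\<Sum>k<m. a k i * c k) = 0" by auto
      have "(\<Sum>k<m. c k * Zs k j t) = 0" if "j < p - 1" "t \<in> {0..ell}" for j t
      proof -
        have "(\<Sum>k<m. c k * Zs k j t) = (\<Sum>k<m. \<Sum>i\<in>K. a k i * c k * Ys i j t)"
          by (intro sum.cong refl) (use a that in \<open>simp add: sum_distrib_left mult_ac\<close>)
        also have "\<dots> = (\<Sum>i\<in>K. (\<Sum>k<m. a k i * c k) * Ys i j t)"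
          by (subst sum.swap) (simp only: sum_distrib_right)
        also have "\<dots> = 0" using c(2) by simp
        finally show ?thesis .
      qed
      then show False using c(1) Zs(2)[of c] by auto
    qed
  qed
qed

text \<open>The solutions of \<open>-y'' = mu * y\<close> with initial data (1, 0) and (0, 1). The
  last clause says that their Wronskian is 1, as \<open>s' = c\<close> and
  \<open>c' = - mu * s\<close>.\<close>

definition fundsys :: "real \<Rightarrow> (real \<Rightarrow> real) \<Rightarrow> (real \<Rightarrow> real) \<Rightarrow> bool" where
  "fundsys mu c s \<longleftrightarrow> (\<forall>x. (c has_real_derivative - mu * s x) (at x)) \<and> c 0 = 1 \<and>
     (\<forall>x. (s has_real_derivative c x) (at x)) \<and> s 0 = 0 \<and> (\<forall>x. c x * c x + mu * (s x * s x) = 1)"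

lemma fundsys_at_0: "fundsys mu c s \<Longrightarrow> c 0 = 1" "fundsys mu c s \<Longrightarrow> s 0 = 0"
  by (simp_all add: fundsys_def)

lemma fundsys_has_vector_derivative:
  assumes "fundsys mu c s"
  shows "((\<lambda>x. complex_of_real (c x)) has_vector_derivative of_real (- mu * s x)) (at x within A)"
    and "((\<lambda>x. complex_of_real (s x)) has_vector_derivative of_real (c x)) (at x within A)"
  by (rule has_vector_derivative_of_real, rule has_field_derivative_at_within, use assms in \<open>simp add: fundsys_def\<close>)+

text \<open>The functions \<open>c Y' + mu s Y\<close> and \<open>c Y - s Y'\<close> are constant, so the values and slopes at 0
  determine the solution without any uniqueness theorem for differential equations.\<close>
lemma ode_representation:
  fixes Y Y' Y'' :: "real \<Rightarrow> complex"
  assumes ell: "ell \<ge> 0" and fs: "fundsys mu c s"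
    and Y: "\<And>x. x \<in> {0..ell} \<Longrightarrow> (Y has_vector_derivative Y' x) (at x within {0..ell})"
    and Y': "\<And>x. x \<in> {0..ell} \<Longrightarrow> (Y' has_vector_derivative Y'' x) (at x within {0..ell})"
    and eq: "\<And>x. x \<in> {0..ell} \<Longrightarrow> - Y'' x = of_real mu * Y x"
    and x: "x \<in> {0..ell}"
  shows "Y x = of_real (c x) * Y 0 + of_real (s x) * Y' 0"
    and "Y' x = - of_real (mu * s x) * Y 0 + of_real (c x) * Y' 0"
proof -
  note dc = fundsys_has_vector_derivative(1)[OF fs] and ds = fundsys_has_vector_derivative(2)[OF fs]
  have const: "W x = W 0"
    if "\<And>x. x \<in> {0..ell} \<Longrightarrow> (W has_vector_derivative 0) (at x within {0..ell})" for W :: "real \<Rightarrow> complex"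
    using has_vector_derivative_zero_constant[of "{0..ell}" W] that x ell
    by (metis atLeastAtMost_iff convex_real_interval(5) order_refl)
  define W1 where "W1 x = of_real (c x) * Y' x + of_real mu * (of_real (s x) * Y x)" for x
  define W2 where "W2 x = of_real (c x) * Y x - of_real (s x) * Y' x" for x
  have "(W1 has_vector_derivative 0) (at x within {0..ell})" if "x \<in> {0..ell}" for x
  proof -
    have "(W1 has_vector_derivative (of_real (c x) * Y'' x + of_real (- mu * s x) * Y' x)
        + of_real mu * (of_real (s x) * Y' x + of_real (c x) * Y x)) (at x within {0..ell})"
      unfolding W1_def
      by (intro has_vector_derivative_add has_vector_derivative_mult has_vector_derivative_mult_right dc ds Y Y' that)
    moreover have "Y'' x = - of_real mu * Y x" using eq[OF that] by (metis minus_minus mult_minus_left)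
    ultimately show ?thesis by (simp add: algebra_simps)
  qed
  then have 1: "W1 x = W1 0" by (rule const)
  have "(W2 has_vector_derivative 0) (at x within {0..ell})" if "x \<in> {0..ell}" for x
  proof -
    have "(W2 has_vector_derivative (of_real (c x) * Y' x + of_real (- mu * s x) * Y x)
        - (of_real (s x) * Y'' x + of_real (c x) * Y' x)) (at x within {0..ell})"
      unfolding W2_def
      by (intro has_vector_derivative_diff has_vector_derivative_mult dc ds Y Y' that)
    moreover have "Y'' x = - of_real mu * Y x" using eq[OF that] by (metis minus_minus mult_minus_left)
    ultimately show ?thesis by (simp add: algebra_simps)
  qed
  then have 2: "W2 x = W2 0" by (rule const)
  have W: "W1 x = Y' 0" "W2 x = Y 0" using 1 2 fundsys_at_0[OF fs] by (auto simp: W1_def W2_def)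
  have cs': "of_real (c x) * of_real (c x) + of_real mu * (of_real (s x) * of_real (s x)) = (1::complex)"
    using fs unfolding fundsys_def by (metis of_real_1 of_real_add of_real_mult)
  have "of_real (c x) * W2 x + of_real (s x) * W1 x
      = (of_real (c x) * of_real (c x) + of_real mu * (of_real (s x) * of_real (s x))) * Y x"
    unfolding W1_def W2_def by (simp add: algebra_simps)
  then show "Y x = of_real (c x) * Y 0 + of_real (s x) * Y' 0" unfolding cs' W by simp
  have "- of_real (mu * s x) * W2 x + of_real (c x) * W1 x
      = (of_real (c x) * of_real (c x) + of_real mu * (of_real (s x) * of_real (s x))) * Y' x"
    unfolding W1_def W2_def by (simp add: algebra_simps)
  then show "Y' x = - of_real (mu * s x) * Y 0 + of_real (c x) * Y' 0" unfolding cs' W by simp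
qed

lemma sum_guard_of_bool:
  fixes f :: "nat \<Rightarrow> 'a::semiring_1"
  shows "(\<Sum>j\<in>{j. j < n \<and> P j}. f j) = (\<Sum>j<n. of_bool (P j) * f j)"
proof -
  have "{j. j < n \<and> P j} = {..<n} \<inter> {j. P j}" by auto
  then show ?thesis by (simp add: sum.inter_restrict of_bool_def if_distrib[of "\<lambda>x. x * _"] cong: if_cong)
qed

text \<open>This removes the differential equations: a solution amounts to vertex values
  \<open>x\<close> and initial slopes \<open>phi\<close> subject to linear equations. The slopes
  remain separate unknowns because they can be eliminated only if \<open>s ell\<close> is nonzero,
  and both cases rely on this equivalence.\<close>

lemma robin_sol_iff:
  assumes tree: "is_tree p E" and ell: "ell \<ge> 0" and fs: "fundsys mu c s"
  shows "robin_sol p E ell b (of_real mu) Y \<longleftrightarrow> (\<exists>x phi.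
     (\<forall>j<p-1. \<forall>t\<in>{0..ell}. Y j t = of_real (c t) * x (fst (E j)) + of_real (s t) * phi j) \<and>
     (\<forall>j<p-1. x (snd (E j)) = of_real (c ell) * x (fst (E j)) + of_real (s ell) * phi j) \<and>
     (\<forall>v<p. (\<Sum>j<p-1. of_bool (snd (E j) = v) * (of_real (c ell) * phi j - of_real (mu * s ell) * x (fst (E j)))
        - of_bool (fst (E j) = v) * phi j) + of_real (b v) * x v = 0))" (is "_ \<longleftrightarrow> ?R")
proof
  assume "robin_sol p E ell b (of_real mu) Y"
  then obtain Y' where
    d: "\<forall>j<p-1. \<exists>Y''. \<forall>x \<in> {0..ell}.
          (Y j has_vector_derivative Y' j x) (at x within {0..ell}) \<and>
          (Y' j has_vector_derivative Y'' x) (at x within {0..ell}) \<and>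
          - Y'' x = of_real mu * Y j x"
    and v: "\<forall>v\<in>{..<p}. \<exists>c. (\<forall>j < p - 1. (fst (E j) = v \<or> snd (E j) = v) \<longrightarrow> vval E ell Y j v = c) \<and>
          (\<Sum>j \<in> {j. j < p - 1 \<and> snd (E j) = v}. Y' j ell)
            - (\<Sum>j \<in> {j. j < p - 1 \<and> fst (E j) = v}. Y' j 0) + complex_of_real (b v) * c = 0"
    unfolding robin_sol_def by auto
  from bchoice[OF v] obtain x where
    x: "\<And>v j. v < p \<Longrightarrow> j < p - 1 \<Longrightarrow> fst (E j) = v \<or> snd (E j) = v \<Longrightarrow> vval E ell Y j v = x v"
      "\<And>v. v < p \<Longrightarrow> (\<Sum>j \<in> {j. j < p - 1 \<and> snd (E j) = v}. Y' j ell)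
            - (\<Sum>j \<in> {j. j < p - 1 \<and> fst (E j) = v}. Y' j 0) + complex_of_real (b v) * x v = 0" by auto
  have ends: "Y j 0 = x (fst (E j))" "Y j ell = x (snd (E j))" if "j < p - 1" for j
    using x(1)[of "fst (E j)" j] x(1)[of "snd (E j)" j] tree_endpoints[OF tree that] that
    by (auto simp: vval_def)
  have rep: "Y j t = of_real (c t) * x (fst (E j)) + of_real (s t) * Y' j 0"
    "Y' j t = - of_real (mu * s t) * x (fst (E j)) + of_real (c t) * Y' j 0"
    if j: "j < p - 1" and t: "t \<in> {0..ell}" for j t
  proof -
    obtain Y'' where Y'': "\<And>x. x \<in> {0..ell} \<Longrightarrow>
          (Y j has_vector_derivative Y' j x) (at x within {0..ell}) \<and>
          (Y' j has_vector_derivative Y'' x) (at x within {0..ell}) \<and>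
          - Y'' x = of_real mu * Y j x" using d j by blast
    show "Y j t = of_real (c t) * x (fst (E j)) + of_real (s t) * Y' j 0"
      "Y' j t = - of_real (mu * s t) * x (fst (E j)) + of_real (c t) * Y' j 0"
      using ode_representation[OF ell fs, of "Y j" "Y' j" Y'' t] Y'' t ends[OF j] by auto
  qed
  have vert: "(\<Sum>j<p-1. of_bool (snd (E j) = v) * (of_real (c ell) * Y' j 0 - of_real (mu * s ell) * x (fst (E j)))
        - of_bool (fst (E j) = v) * Y' j 0) + of_real (b v) * x v = 0" if "v < p" for v
  proof -
    have "(\<Sum>j<p-1. of_bool (snd (E j) = v) * (of_real (c ell) * Y' j 0 - of_real (mu * s ell) * x (fst (E j)))
        - of_bool (fst (E j) = v) * Y' j 0)
      = (\<Sum>j<p-1. of_bool (snd (E j) = v) * Y' j ell - of_bool (fst (E j) = v) * Y' j 0)"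
      by (intro sum.cong refl) (use rep(2)[of _ ell] ell in simp)
    then show ?thesis using x(2)[OF that] by (simp only: sum_guard_of_bool sum_subtractf)
  qed
  have ends': "x (snd (E j)) = of_real (c ell) * x (fst (E j)) + of_real (s ell) * Y' j 0" if "j < p - 1" for j
    using rep(1)[OF that, of ell] ends[OF that] ell by simp
  show ?R
    by (intro exI[of _ x] exI[of _ "\<lambda>j. Y' j 0"] conjI allI impI ballI)
      ((rule rep(1) ends' vert; assumption)+)
next
  assume ?R
  then obtain x phi where
    Y: "\<And>j t. j < p - 1 \<Longrightarrow> t \<in> {0..ell} \<Longrightarrow> Y j t = of_real (c t) * x (fst (E j)) + of_real (s t) * phi j"
    and ends: "\<And>j. j < p - 1 \<Longrightarrow> x (snd (E j)) = of_real (c ell) * x (fst (E j)) + of_real (s ell) * phi j"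
    and vert: "\<And>v. v < p \<Longrightarrow> (\<Sum>j<p-1. of_bool (snd (E j) = v) * (of_real (c ell) * phi j - of_real (mu * s ell) * x (fst (E j)))
        - of_bool (fst (E j) = v) * phi j) + of_real (b v) * x v = 0" by auto
  note dc = fundsys_has_vector_derivative(1)[OF fs] and ds = fundsys_has_vector_derivative(2)[OF fs]
  define Y' where "Y' j t = of_real (- mu * s t) * x (fst (E j)) + of_real (c t) * phi j" for j t
  have dY: "(Y j has_vector_derivative Y' j t) (at t within {0..ell})" if "j < p - 1" "t \<in> {0..ell}" for j t
  proof (rule has_vector_derivative_transform[OF that(2)])
    show "Y j u = of_real (c u) * x (fst (E j)) + of_real (s u) * phi j" if "u \<in> {0..ell}" for u
      using Y that \<open>j < p - 1\<close> by auto
    show "((\<lambda>u. of_real (c u) * x (fst (E j)) + of_real (s u) * phi j) has_vector_derivative Y' j t) (at t within {0..ell})"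
      unfolding Y'_def by (intro has_vector_derivative_add has_vector_derivative_mult_left dc ds)
  qed
  have dY': "(Y' j has_vector_derivative - of_real mu * Y j t) (at t within {0..ell})"
    if "j < p - 1" "t \<in> {0..ell}" for j t
  proof -
    have "((\<lambda>u. of_real (- mu * s u) :: complex) has_vector_derivative of_real (- mu * c t)) (at t within {0..ell})"
      by (rule has_vector_derivative_of_real, rule DERIV_cmult, rule has_field_derivative_at_within)
        (use fs in \<open>simp add: fundsys_def\<close>)
    then have "(Y' j has_vector_derivative of_real (- mu * c t) * x (fst (E j)) + of_real (- mu * s t) * phi j)
        (at t within {0..ell})"
      unfolding Y'_def by (intro has_vector_derivative_add has_vector_derivative_mult_left dc)
    then show ?thesis using Y[OF that] by (simp add: algebra_simps)
  qed
  have "\<exists>a. (\<forall>j < p - 1. (fst (E j) = v \<or> snd (E j) = v) \<longrightarrow> vval E ell Y j v = a) \<and>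
          (\<Sum>j \<in> {j. j < p - 1 \<and> snd (E j) = v}. Y' j ell)
            - (\<Sum>j \<in> {j. j < p - 1 \<and> fst (E j) = v}. Y' j 0) + complex_of_real (b v) * a = 0" if v: "v < p" for v
  proof (intro exI[of _ "x v"] conjI allI impI)
    fix j assume j: "j < p - 1" "fst (E j) = v \<or> snd (E j) = v"
    have "Y j 0 = x (fst (E j))" "Y j ell = x (snd (E j))"
      using Y[OF j(1), of 0] Y[OF j(1), of ell] ends[OF j(1)] fundsys_at_0[OF fs] ell by auto
    then show "vval E ell Y j v = x v" using j by (auto simp: vval_def)
  next
    have "(\<Sum>j<p-1. of_bool (snd (E j) = v) * (of_real (c ell) * phi j - of_real (mu * s ell) * x (fst (E j)))
        - of_bool (fst (E j) = v) * phi j)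
      = (\<Sum>j<p-1. of_bool (snd (E j) = v) * Y' j ell - of_bool (fst (E j) = v) * Y' j 0)"
      by (intro sum.cong refl) (use fundsys_at_0[OF fs] in \<open>simp add: Y'_def\<close>)
    then show "(\<Sum>j \<in> {j. j < p - 1 \<and> snd (E j) = v}. Y' j ell)
            - (\<Sum>j \<in> {j. j < p - 1 \<and> fst (E j) = v}. Y' j 0) + complex_of_real (b v) * x v = 0"
      using vert[OF v] by (simp only: sum_guard_of_bool sum_subtractf)
  qed
  moreover have "\<exists>Y''. \<forall>t \<in> {0..ell}. (Y j has_vector_derivative Y' j t) (at t within {0..ell}) \<and>
          (Y' j has_vector_derivative Y'' t) (at t within {0..ell}) \<and> - Y'' t = of_real mu * Y j t" if "j < p - 1" for j
    by (intro exI[of _ "\<lambda>t. - of_real mu * Y j t"]) (use dY dY' that in auto)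
  ultimately show "robin_sol p E ell b (of_real mu) Y"
    unfolding robin_sol_def by (intro exI[of _ Y'] conjI allI impI) simp_all
qed

text \<open>By symmetry a kernel vector is orthogonal to every eigenvector with nonzero eigenvalue,
  which drops those terms from its expansion.\<close>

lemma eigensys_kernel:
  assumes es: "eigensys p d M th X" and sym: "\<And>u v. u < p \<Longrightarrow> v < p \<Longrightarrow> M u v = M v u"
    and ker: "\<And>v. v < p \<Longrightarrow> mulv p M x v = 0" and v: "v < p"
  shows "x v = (\<Sum>i\<in>{i. i < p \<and> th i = 0}. wip p d x (X i) * X i v)"
proof -
  have "wip p d x (X i) = 0" if "i < p" "th i \<noteq> 0" for i
  proof -
    have "th i * wip p d (X i) x = bform p M (X i) x"
      by (rule bform_eigen[symmetric]) (use es that in \<open>auto simp: eigensys_def\<close>)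
    also have "\<dots> = bform p M x (X i)" by (rule bform_commute) (rule sym)
    also have "\<dots> = 0" unfolding bform_def by (simp add: ker)
    finally show ?thesis using that(2) by (simp add: wip_commute)
  qed
  then have "(\<Sum>i<p. wip p d x (X i) * X i v) = (\<Sum>i\<in>{i. i < p \<and> th i = 0}. wip p d x (X i) * X i v)"
    by (intro sum.mono_neutral_right) auto
  then show ?thesis using eigensys_expand[OF es v, of x] by simp
qed

lemma eigensys_independent:
  assumes es: "eigensys p d M th X" and K: "K \<subseteq> {..<p}" "k \<in> K"
    and zero: "\<And>v. v < p \<Longrightarrow> (\<Sum>i\<in>K. a i * X i v) = 0"
  shows "a k = 0"
proof -
  have fin: "finite K" using K finite_subset by blast
  have "(\<Sum>i\<in>K. (a i)\<^sup>2) = wip p d (\<lambda>v. \<Sum>i\<in>K. a i * X i v) (\<lambda>v. \<Sum>i\<in>K. a i * X i v)"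
    using eigensys_wip_sum(1)[OF es K(1)] by simp
  also have "\<dots> = 0" unfolding wip_def using zero by simp
  finally show ?thesis using K fin by (simp add: sum_nonneg_eq_0_iff)
qed

lemma robin_matrix_mult:
  fixes x :: "nat \<Rightarrow> complex"
  assumes tree: "is_tree p E" and v: "v < p"
  shows "(\<Sum>u<p. of_real (robin_matrix p E b C S v u) * x u)
    = (\<Sum>j<p-1. of_bool (fst (E j) = v) * (x (snd (E j)) - of_real C * x v)
         + of_bool (snd (E j) = v) * (x (fst (E j)) - of_real C * x v)) - of_real (S * b v) * x v"
proof -
  have D: "(\<Sum>u<p. of_real (C * degmat p E v u) * x u) = of_real C * of_nat (deg p E v) * x v"
  proof -
    have "(\<Sum>u<p. of_real (C * degmat p E v u) * x u)
        = (\<Sum>u<p. of_bool (v = u) * (of_real C * of_nat (deg p E v) * x u))"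
      by (intro sum.cong refl) (simp add: degmat_def)
    then show ?thesis unfolding sum_of_bool_mult(1)[OF v] .
  qed
  have B: "(\<Sum>u<p. of_real (of_bool (v = u) * (S * b v)) * x u) = of_real (S * b v) * x v"
  proof -
    have "(\<Sum>u<p. of_real (of_bool (v = u) * (S * b v)) * x u)
        = (\<Sum>u<p. of_bool (v = u) * (of_real (S * b v) * x u))"
      by (intro sum.cong refl) simp
    then show ?thesis unfolding sum_of_bool_mult(1)[OF v] .
  qed
  have "(\<Sum>u<p. of_real (robin_matrix p E b C S v u) * x u)
     = (\<Sum>u<p. of_real (adjmat p E v u) * x u) - (\<Sum>u<p. of_real (C * degmat p E v u) * x u)
       - (\<Sum>u<p. of_real (of_bool (v = u) * (S * b v)) * x u)"
    unfolding robin_matrix_def by (simp add: sum_subtractf left_diff_distrib)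
  then show ?thesis
    unfolding adjmat_mult_sum[OF tree] D B deg_eq_sum[OF tree]
    by (simp only: sum_distrib_left sum_distrib_right sum_subtractf[symmetric])
       (simp add: algebra_simps)
qed

text \<open>With \<open>s ell\<close> nonzero the slopes are functions of the end values, and the
  vertex conditions become a homogeneous system with the vertex matrix. That matrix is real, so real
  and imaginary parts separate, and its real null eigenvectors form a complex basis.\<close>

theorem robin_mult_generic:
  assumes tree: "is_tree p E" and ell: "ell > 0" and fs: "fundsys mu c s" and S0: "s ell \<noteq> 0"
    and es: "eigensys p (degr p E) (robin_matrix p E b (c ell) (s ell)) th X"
  shows "robin_mult p E ell b (of_real mu) = card {i. i < p \<and> th i = 0}"
proof -
  let ?M = "robin_matrix p E b (c ell) (s ell)"
  let ?C = "complex_of_real (c ell)" and ?S = "complex_of_real (s ell)"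
  define K where "K = {i. i < p \<and> th i = 0}"
  have K: "finite K" "K \<subseteq> {..<p}" by (auto simp: K_def)
  have S0': "?S \<noteq> 0" using S0 by simp
  have one: "?C * ?C + of_real mu * (?S * ?S) = 1"
    using fs unfolding fundsys_def by (metis of_real_1 of_real_add of_real_mult)
  let ?ph = "\<lambda>(x :: nat \<Rightarrow> complex) j. (x (snd (E j)) - ?C * x (fst (E j))) / ?S"
  let ?V = "\<lambda>(x :: nat \<Rightarrow> complex) phi v. \<Sum>j<p-1.
      of_bool (snd (E j) = v) * (?C * phi j - of_real (mu * s ell) * x (fst (E j))) - of_bool (fst (E j) = v) * phi j"
  define sol where "sol x j t = of_real (c t) * x (fst (E j)) + of_real (s t) * ?ph x j" for x j t
  \<comment> \<open>The identity \<open>one\<close> eliminates \<open>mu\<close>: \<open>?S\<close>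
    times the terminal slope is \<open>?C\<close> times the terminal value minus the initial value.
    This mirrors the expression at the initial end, so the orientation drops out.\<close>
  have vertex: "?S * (?V x phi v + of_real (b v) * x v)
      = - (\<Sum>u<p. of_real (?M v u) * x u)"
    if v: "v < p" and phi: "\<And>j. j < p - 1 \<Longrightarrow> x (snd (E j)) = ?C * x (fst (E j)) + ?S * phi j"
    for x phi v
  proof -
    have "?S * (of_bool (snd (E j) = v) * (?C * phi j - of_real (mu * s ell) * x (fst (E j)))
        - of_bool (fst (E j) = v) * phi j)
      = - (of_bool (fst (E j) = v) * (x (snd (E j)) - ?C * x v)
         + of_bool (snd (E j) = v) * (x (fst (E j)) - ?C * x v))" if j: "j < p - 1" for j
    proof -
      have e: "?S * phi j = x (snd (E j)) - ?C * x (fst (E j))" using phi[OF j] by simp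
      have "?S * (?C * phi j - of_real (mu * s ell) * x (fst (E j)))
          = ?C * (?S * phi j) - of_real mu * (?S * ?S) * x (fst (E j))" by (simp add: algebra_simps)
      also have "\<dots> = ?C * x (snd (E j)) - (?C * ?C + of_real mu * (?S * ?S)) * x (fst (E j))"
        unfolding e by (simp add: algebra_simps)
      finally have f: "?S * (?C * phi j - of_real (mu * s ell) * x (fst (E j))) = ?C * x (snd (E j)) - x (fst (E j))"
        unfolding one by simp
      have "?S * (of_bool (snd (E j) = v) * (?C * phi j - of_real (mu * s ell) * x (fst (E j)))
          - of_bool (fst (E j) = v) * phi j)
        = of_bool (snd (E j) = v) * (?S * (?C * phi j - of_real (mu * s ell) * x (fst (E j))))
          - of_bool (fst (E j) = v) * (?S * phi j)" by (simp add: algebra_simps)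
      also have "\<dots> = - (of_bool (fst (E j) = v) * (x (snd (E j)) - ?C * x v)
         + of_bool (snd (E j) = v) * (x (fst (E j)) - ?C * x v))"
        unfolding e f by (auto simp: of_bool_def)
      finally show ?thesis .
    qed
    then have "?S * ?V x phi v
      = - (\<Sum>j<p-1. of_bool (fst (E j) = v) * (x (snd (E j)) - ?C * x v)
         + of_bool (snd (E j) = v) * (x (fst (E j)) - ?C * x v))"
      unfolding sum_distrib_left sum_negf[symmetric] by (intro sum.cong refl) auto
    then show ?thesis unfolding robin_matrix_mult[OF tree v]
      by (simp only: distrib_left) simp
  qed
  have solvable: "robin_sol p E ell b (of_real mu) (sol x)"
    if "\<And>v. v < p \<Longrightarrow> (\<Sum>u<p. of_real (?M v u) * x u) = 0" for x
    unfolding robin_sol_iff[OF tree less_imp_le[OF ell] fs]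
  proof (rule exI[of _ x], rule exI[of _ "?ph x"],
      intro conjI allI impI ballI)
    fix v assume v: "v < p"
    have "?S * (?V x (?ph x) v + of_real (b v) * x v) = 0"
      using vertex[OF v, of x "?ph x"] that[OF v] S0' by simp
    then show "?V x (?ph x) v + of_real (b v) * x v = 0"
      using S0' by (simp only: mult_eq_0_iff) blast
  qed (use S0' in \<open>simp_all add: sol_def\<close>)
  have ev: "sol x j 0 = x (fst (E j))" "sol x j ell = x (snd (E j))" for x j
    using S0' fs by (simp_all add: sol_def fundsys_def)
  have cover: "\<exists>j<p-1. fst (E j) = v \<or> snd (E j) = v" if "v < p" for v
    using deg_pos[OF tree that] unfolding deg_def by (metis (mono_tags, lifting) card.empty empty_Collect_eq less_numeral_extra(3))
  have "robin_mult p E ell b (of_real mu) = card K"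
  proof (rule robin_mult_eqI[OF K(1), where Ys = "\<lambda>i. sol (\<lambda>v. of_real (X i v))"])
    fix i assume "i \<in> K"
    then have i: "i < p" "th i = 0" by (auto simp: K_def)
    show "robin_sol p E ell b (of_real mu) (sol (\<lambda>v. of_real (X i v)))"
    proof (rule solvable)
      fix v assume "v < p"
      then have "mulv p ?M (X i) v = 0" using es i by (simp add: eigensys_def)
      then show "(\<Sum>u<p. complex_of_real (?M v u) * of_real (X i u)) = 0"
        unfolding mulv_def of_real_mult[symmetric] of_real_sum[symmetric] by simp
    qed
  next
    fix a :: "nat \<Rightarrow> complex"
    assume 0: "\<And>j t. j < p - 1 \<Longrightarrow> t \<in> {0..ell} \<Longrightarrow> (\<Sum>i\<in>K. a i * sol (\<lambda>v. of_real (X i v)) j t) = 0"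
    have z: "(\<Sum>i\<in>K. a i * of_real (X i v)) = 0" if v: "v < p" for v
    proof -
      obtain j where j: "j < p - 1" "fst (E j) = v \<or> snd (E j) = v" using cover[OF v] by auto
      show ?thesis using 0[OF j(1), of 0] 0[OF j(1), of ell] j(2) ell unfolding ev by auto
    qed
    have "Re (a k) = 0" "Im (a k) = 0" if "k \<in> K" for k
    proof -
      have "(\<Sum>i\<in>K. Re (a i) * X i v) = 0" "(\<Sum>i\<in>K. Im (a i) * X i v) = 0" if "v < p" for v
        using arg_cong[OF z[OF that], of Re] arg_cong[OF z[OF that], of Im] by simp_all
      then show "Re (a k) = 0" "Im (a k) = 0"
        using eigensys_independent[OF es K(2) that, of "\<lambda>i. Re (a i)"]
          eigensys_independent[OF es K(2) that, of "\<lambda>i. Im (a i)"] by simp_all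
    qed
    then show "\<forall>i\<in>K. a i = 0" by (simp add: complex_eq_iff)
  next
    fix Y assume "robin_sol p E ell b (of_real mu) Y"
    then obtain x phi where
      Y: "\<And>j t. j < p - 1 \<Longrightarrow> t \<in> {0..ell} \<Longrightarrow> Y j t = of_real (c t) * x (fst (E j)) + of_real (s t) * phi j"
      and phi: "\<And>j. j < p - 1 \<Longrightarrow> x (snd (E j)) = ?C * x (fst (E j)) + ?S * phi j"
      and vert: "\<And>v. v < p \<Longrightarrow> ?V x phi v + of_real (b v) * x v = 0"
      unfolding robin_sol_iff[OF tree less_imp_le[OF ell] fs] by blast
    have ker: "(\<Sum>u<p. of_real (?M v u) * x u) = 0" if "v < p" for v
      using vertex[OF that, of x phi] phi vert[OF that] by simp
    have re: "mulv p ?M (\<lambda>u. Re (x u)) v = 0" and im: "mulv p ?M (\<lambda>u. Im (x u)) v = 0" if "v < p" for v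
      using arg_cong[OF ker[OF that], of Re] arg_cong[OF ker[OF that], of Im] by (simp_all add: mulv_def)
    define a where "a i = Complex (wip p (degr p E) (\<lambda>u. Re (x u)) (X i)) (wip p (degr p E) (\<lambda>u. Im (x u)) (X i))" for i
    have x: "x v = (\<Sum>i\<in>K. a i * of_real (X i v))" if "v < p" for v
      using eigensys_kernel[OF es robin_matrix_sym re that] eigensys_kernel[OF es robin_matrix_sym im that]
      by (simp add: complex_eq_iff a_def K_def)
    have "Y j t = (\<Sum>i\<in>K. a i * sol (\<lambda>v. of_real (X i v)) j t)" if j: "j < p - 1" and t: "t \<in> {0..ell}" for j t
    proof -
      have "phi j = (x (snd (E j)) - ?C * x (fst (E j))) / ?S" using phi[OF j] S0' by (simp add: field_simps)
      then have "Y j t = sol x j t" using Y[OF j t] by (simp add: sol_def)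
      also have "\<dots> = (\<Sum>i\<in>K. a i * sol (\<lambda>v. of_real (X i v)) j t)"
        unfolding sol_def x[OF tree_endpoints(1)[OF tree j]] x[OF tree_endpoints(2)[OF tree j]]
        by (simp add: sum_distrib_left sum.distrib sum_subtractf sum_divide_distrib diff_divide_distrib algebra_simps)
      finally show ?thesis .
    qed
    then show "\<exists>a. \<forall>j<p-1. \<forall>t\<in>{0..ell}. Y j t = (\<Sum>i\<in>K. a i * sol (\<lambda>v. of_real (X i v)) j t)" by blast
  qed
  then show ?thesis by (simp add: K_def)
qed

text \<open>At \<open>s ell = 0\<close> the vertex values no longer determine the slopes. They are a multiple of a signing of the
  tree, and testing the vertex conditions against this signing leaves the sum of the Robin coefficients
  as the only obstruction.\<close>
theorem robin_mult_resonant: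
  assumes tree: "is_tree p E" and ell: "ell > 0" and fs: "fundsys mu c s"
    and S0: "s ell = 0" and C: "c ell = 1 \<or> c ell = -1"
  shows "robin_mult p E ell b (of_real mu) = (if (\<Sum>v<p. b v) = 0 then 1 else 0)"
proof -
  let ?C = "c ell"
  let ?F = "\<lambda>(phi :: nat \<Rightarrow> complex) v. \<Sum>j<p-1. of_bool (snd (E j) = v) * (of_real ?C * phi j)
      - of_bool (fst (E j) = v) * phi j"
  have CC: "?C * ?C = 1" using C by auto
  have CC': "complex_of_real ?C * of_real ?C = 1" using CC by (metis of_real_1 of_real_mult)
  have p: "0 < p - 1" "0 < p" using tree by (auto simp: is_tree_def)
  obtain u :: "nat \<Rightarrow> real" where u: "\<And>v. v < p \<Longrightarrow> u v = 1 \<or> u v = -1"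
    "\<And>j. j < p - 1 \<Longrightarrow> u (snd (E j)) = ?C * u (fst (E j))"
    using tree_signing[OF tree C] by auto
  have uu: "u v * u v = 1" if "v < p" for v using u(1)[OF that] by auto
  have iff: "robin_sol p E ell b (of_real mu) Y \<longleftrightarrow> (\<exists>x phi.
     (\<forall>j<p-1. \<forall>t\<in>{0..ell}. Y j t = of_real (c t) * x (fst (E j)) + of_real (s t) * phi j) \<and>
     (\<forall>j<p-1. x (snd (E j)) = of_real ?C * x (fst (E j))) \<and>
     (\<forall>v<p. ?F phi v + of_real (b v) * x v = 0))" for Y
    unfolding robin_sol_iff[OF tree less_imp_le[OF ell] fs] by (simp add: S0)
  \<comment> \<open>The two ends of an edge cancel: \<open>u\<close> at the terminal end times
    \<open>?C\<close> equals \<open>u\<close> at the initial end.\<close>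
  have weighted: "(\<Sum>v<p. of_real (u v) * ?F phi v) = 0" for phi :: "nat \<Rightarrow> complex"
  proof -
    have "(\<Sum>v<p. of_real (u v) * ?F phi v)
      = (\<Sum>v<p. \<Sum>j<p-1. of_bool (snd (E j) = v) * (of_real (u v) * (of_real ?C * phi j)))
        - (\<Sum>v<p. \<Sum>j<p-1. of_bool (fst (E j) = v) * (of_real (u v) * phi j))"
      unfolding sum_distrib_left sum_subtractf[symmetric]
      by (intro sum.cong refl) (simp add: algebra_simps)
    also have "\<dots> = (\<Sum>j<p-1. of_real (u (snd (E j))) * (of_real ?C * phi j) - of_real (u (fst (E j))) * phi j)"
      unfolding sum_vertex_ends[OF tree] sum_subtractf ..
    also have "\<dots> = 0"
    proof (rule sum.neutral, intro ballI)
      fix j assume "j \<in> {..<p-1}"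
      then have "of_real (u (snd (E j))) * (of_real ?C * phi j)
          = of_real (u (fst (E j))) * (of_real ?C * of_real ?C) * phi j"
        using u(2)[of j] by (simp add: algebra_simps)
      then show "of_real (u (snd (E j))) * (of_real ?C * phi j) - of_real (u (fst (E j))) * phi j = 0"
        unfolding CC' by simp
    qed
    finally show ?thesis .
  qed
  have shape: "x v = x 0 * of_real (u 0) * of_real (u v)"
    if "\<And>j. j < p - 1 \<Longrightarrow> x (snd (E j)) = of_real ?C * x (fst (E j))" and v: "v < p" for x :: "nat \<Rightarrow> complex" and v
  proof -
    have "x v * of_real (u v) = x 0 * of_real (u 0)"
    proof (rule tree_const[OF tree _ v])
      fix j assume j: "j < p - 1"
      have "x (snd (E j)) * of_real (u (snd (E j)))
          = (of_real ?C * of_real ?C) * (x (fst (E j)) * of_real (u (fst (E j))))"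
        using that(1)[OF j] u(2)[OF j] by (simp add: algebra_simps)
      then show "x (fst (E j)) * of_real (u (fst (E j))) = x (snd (E j)) * of_real (u (snd (E j)))"
        unfolding CC' by simp
    qed
    then have "x v * (of_real (u v) * of_real (u v)) = x 0 * of_real (u 0) * of_real (u v)"
      by (simp add: mult.assoc[symmetric])
    then show ?thesis using uu[OF v] by (simp add: of_real_mult[symmetric] del: of_real_mult)
  qed
  show ?thesis
  proof (cases "(\<Sum>v<p. b v) = 0")
    case False
    have "robin_mult p E ell b (of_real mu) = card ({} :: nat set)"
    proof (rule robin_mult_eqI)
      fix Y assume "robin_sol p E ell b (of_real mu) Y"
      then obtain x phi where
        Y: "\<And>j t. j < p - 1 \<Longrightarrow> t \<in> {0..ell} \<Longrightarrow> Y j t = of_real (c t) * x (fst (E j)) + of_real (s t) * phi j"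
        and x: "\<And>j. j < p - 1 \<Longrightarrow> x (snd (E j)) = of_real ?C * x (fst (E j))"
        and vert: "\<And>v. v < p \<Longrightarrow> ?F phi v + of_real (b v) * x v = 0"
        unfolding iff by blast
      have "0 = (\<Sum>v<p. of_real (u v) * (?F phi v + of_real (b v) * x v))"
        using vert by simp
      also have "\<dots> = (\<Sum>v<p. of_real (u v) * (of_real (b v) * x v))"
        unfolding distrib_left sum.distrib weighted by simp
      also have "\<dots> = (\<Sum>v<p. of_real (b v) * (x 0 * of_real (u 0)))"
      proof (rule sum.cong)
        fix v assume v: "v \<in> {..<p}"
        have "of_real (u v) * (of_real (b v) * x v)
            = of_real (b v) * (x 0 * of_real (u 0)) * (of_real (u v) * of_real (u v))"
          using shape[OF x, of v] v by (simp add: mult_ac)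
        then show "of_real (u v) * (of_real (b v) * x v) = of_real (b v) * (x 0 * of_real (u 0))"
          using uu[of v] v by (simp add: of_real_mult[symmetric] del: of_real_mult)
      qed simp
      also have "\<dots> = of_real (\<Sum>v<p. b v) * (x 0 * of_real (u 0))"
        by (simp add: sum_distrib_right)
      finally have "of_real (\<Sum>v<p. b v) * (x 0 * of_real (u 0)) = 0" by (rule sym)
      moreover have "complex_of_real (\<Sum>v<p. b v) \<noteq> 0" using False by (simp only: of_real_eq_0_iff not_False_eq_True)
      ultimately have "x 0 * of_real (u 0) = 0" by (simp only: mult_eq_0_iff) blast
      then have x0: "x v = 0" if "v < p" for v using shape[OF x that] by simp
      have "phi j = 0" if "j < p - 1" for j
        by (rule tree_flux_zero[OF tree CC' _ that]) (use vert x0 in auto)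
      then show "\<exists>a. \<forall>j<p-1. \<forall>t\<in>{0..ell}. Y j t = (\<Sum>i\<in>{}. a i * undefined i j t)"
        using Y x0 tree_endpoints[OF tree] by auto
    qed auto
    then show ?thesis using False by simp
  next
    case True
    \<comment> \<open>The unknowns are the \<open>p - 1\<close> slopes and, in position
      \<open>p - 1\<close>, the amplitude of the signing; the equations are those of the vertices
      from 1 on. The missing equation at vertex 0 follows because the sum of all of them, weighted
      by the signing, vanishes.\<close>
    define M where "M v j = (if j < p - 1 then of_bool (snd (E j) = v) * ?C - of_bool (fst (E j) = v)
        else b v * u v)" for v j
    have "card {1..<p} < card {..<p}" using p by simp
    from homogeneous_system[OF finite_atLeastLessThan finite_lessThan this, of M] obtain w where
      w1: "\<exists>j\<in>{..<p}. w j \<noteq> 0" and w2: "\<forall>v\<in>{1..<p}. (\<Sum>j<p. M v j * w j) = 0" by blast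
    have w: "\<exists>j<p. w j \<noteq> 0" "\<And>v. 1 \<le> v \<Longrightarrow> v < p \<Longrightarrow> (\<Sum>j<p. M v j * w j) = 0"
      using w1 w2 by auto
    define k phi where "k = w (p - 1)" and "phi j = complex_of_real (w j)" for j
    have expand: "of_real (\<Sum>j<p. M v j * w j) = ?F phi v + of_real (b v) * of_real (k * u v)" for v
    proof -
      have "{..<p} = insert (p - 1) {..<p-1}" using p by auto
      then have "(\<Sum>j<p. M v j * w j) = M v (p - 1) * k + (\<Sum>j<p-1. M v j * w j)"
        by (simp add: k_def)
      moreover have "(\<Sum>j<p-1. M v j * w j)
          = (\<Sum>j<p-1. of_bool (snd (E j) = v) * (?C * w j) - of_bool (fst (E j) = v) * w j)"
        by (rule sum.cong) (auto simp: M_def algebra_simps)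
      moreover have "complex_of_real (of_bool P) = of_bool P" for P by (cases P) simp_all
      ultimately show ?thesis by (simp add: M_def phi_def mult_ac)
    qed
    have vert: "?F phi v + of_real (b v) * of_real (k * u v) = 0" if v: "v < p" for v
    proof (cases "v = 0")
      case False
      then show ?thesis using expand[of v] w(2)[of v] v by simp
    next
      case v0: True
      let ?g = "\<lambda>v. ?F phi v + of_real (b v) * of_real (k * u v)"
      have "(\<Sum>v<p. of_real (u v) * ?g v) = (\<Sum>v<p. of_real (u v) * (of_real (b v) * of_real (k * u v)))"
        unfolding distrib_left sum.distrib weighted by simp
      also have "\<dots> = (\<Sum>v<p. of_real (b v * k))"
      proof (rule sum.cong)
        fix v assume "v \<in> {..<p}"
        then have "u v * (b v * (k * u v)) = b v * k"
          using uu[of v] by (metis lessThan_iff mult.assoc mult.commute mult.right_neutral)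
        then show "of_real (u v) * (of_real (b v) * of_real (k * u v)) = complex_of_real (b v * k)"
          by (metis of_real_mult)
      qed simp
      also have "\<dots> = of_real ((\<Sum>v<p. b v) * k)"
        by (simp add: sum_distrib_right)
      finally have z: "(\<Sum>v<p. of_real (u v) * ?g v) = 0" using True by simp
      have r: "(\<Sum>v<p. of_real (u v) * ?g v) = of_real (u 0) * ?g 0"
      proof -
        have "(\<Sum>v<p. of_real (u v) * ?g v) = (\<Sum>v\<in>{0}. of_real (u v) * ?g v)"
        proof (rule sum.mono_neutral_right)
          show "\<forall>i\<in>{..<p} - {0}. of_real (u i) * ?g i = 0"
          proof
            fix i assume "i \<in> {..<p} - {0}"
            then have "?g i = 0" using expand[of i] w(2)[of i] by auto
            then show "of_real (u i) * ?g i = 0" by (simp only: mult_zero_right)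
          qed
        qed (use p in auto)
        then show ?thesis by simp
      qed
      have "complex_of_real (u 0) \<noteq> 0" using u(1)[of 0] p by auto
      moreover have "complex_of_real (u 0) = 0 \<or> ?g 0 = 0"
        by (rule mult_eq_0_iff[THEN iffD1]) (rule trans[OF r[symmetric] z])
      ultimately show ?thesis unfolding v0 by blast
    qed
    \<comment> \<open>With amplitude 0 the slopes alone would form a nontrivial circulation on the
      tree.\<close>
    have k: "k \<noteq> 0"
    proof
      assume k0: "k = 0"
      have "phi j = 0" if "j < p - 1" for j
        by (rule tree_flux_zero[OF tree CC' _ that]) (use vert k0 in auto)
      then have "w j = 0" if "j < p" for j
        using that k0 by (cases "j = p - 1") (auto simp: k_def phi_def)
      then show False using w(1) by auto
    qed
    define Y0 where "Y0 j t = of_real (c t) * of_real (k * u (fst (E j))) + of_real (s t) * phi j" for j and t :: real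
    have sol: "robin_sol p E ell b (of_real mu) Y0"
      unfolding iff
      by (rule exI[of _ "\<lambda>v. of_real (k * u v)"], rule exI[of _ phi])
        (use vert u(2) in \<open>auto simp: Y0_def\<close>)
    have "robin_mult p E ell b (of_real mu) = card {0::nat}"
    proof (rule robin_mult_eqI[where Ys = "\<lambda>i. Y0"])
      fix a :: "nat \<Rightarrow> complex"
      assume 0: "\<And>j t. j < p - 1 \<Longrightarrow> t \<in> {0..ell} \<Longrightarrow> (\<Sum>i\<in>{0}. a i * Y0 j t) = 0"
      have "Y0 0 0 = of_real (k * u (fst (E 0)))" using fs by (simp add: Y0_def fundsys_def)
      moreover have "u (fst (E 0)) \<noteq> 0" using u(1)[OF tree_endpoints(1)[OF tree p(1)]] by auto
      ultimately show "\<forall>i\<in>{0}. a i = 0" using 0[OF p(1), of 0] ell k by simp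
    next
      fix Y assume "robin_sol p E ell b (of_real mu) Y"
      then obtain x ph where
        Y: "\<And>j t. j < p - 1 \<Longrightarrow> t \<in> {0..ell} \<Longrightarrow> Y j t = of_real (c t) * x (fst (E j)) + of_real (s t) * ph j"
        and x: "\<And>j. j < p - 1 \<Longrightarrow> x (snd (E j)) = of_real ?C * x (fst (E j))"
        and vert': "\<And>v. v < p \<Longrightarrow> ?F ph v + of_real (b v) * x v = 0"
        unfolding iff by blast
      define r where "r = x 0 * of_real (u 0) / of_real k"
      have xr: "x v = r * of_real (k * u v)" if "v < p" for v
        using shape[OF x that] k by (simp add: r_def)
      have "ph j - r * phi j = 0" if "j < p - 1" for j
      proof (rule tree_flux_zero[OF tree CC' _ that])
        fix v assume v: "v < p"
        have "?F (\<lambda>j. ph j - r * phi j) v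
            = ?F ph v
              - r * ?F phi v"
          unfolding sum_distrib_left sum_subtractf[symmetric]
          by (intro sum.cong refl) (simp add: algebra_simps)
        also have "\<dots> = - (of_real (b v) * x v) - r * (- (of_real (b v) * of_real (k * u v)))"
          using vert'[OF v] vert[OF v] by (simp only: add_eq_0_iff2)
        also have "\<dots> = 0" unfolding xr[OF v] by simp
        finally show "?F (\<lambda>j. ph j - r * phi j) v = 0" .
      qed
      then have "Y j t = r * Y0 j t" if "j < p - 1" "t \<in> {0..ell}" for j t
        using Y[OF that] xr[OF tree_endpoints(1)[OF tree that(1)]] that(1)
        by (simp add: Y0_def algebra_simps)
      then show "\<exists>a. \<forall>j<p-1. \<forall>t\<in>{0..ell}. Y j t = (\<Sum>i\<in>{0::nat}. a i * Y0 j t)"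
        by (intro exI[of _ "\<lambda>_. r"]) simp
    qed (use sol in auto)
    then show ?thesis using True by simp
  qed
qed

text \<open>Along each edge \<open>Im mu * Im (cnj Y * Y')\<close> is monotone, and the vertex conditions make its
  increments over all edges sum to 0.\<close>
theorem robin_mult_nonreal:
  assumes tree: "is_tree p E" and ell: "ell > 0" and mu: "Im mu \<noteq> 0"
  shows "robin_mult p E ell b mu = 0"
proof -
  have "robin_mult p E ell b mu = card ({} :: nat set)"
  proof (rule robin_mult_eqI)
    fix Y assume "robin_sol p E ell b mu Y"
    then obtain Y' where
      d: "\<forall>j<p-1. \<exists>Y''. \<forall>x \<in> {0..ell}.
          (Y j has_vector_derivative Y' j x) (at x within {0..ell}) \<and>
          (Y' j has_vector_derivative Y'' x) (at x within {0..ell}) \<and>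
          - Y'' x = mu * Y j x"
      and v: "\<forall>v\<in>{..<p}. \<exists>c. (\<forall>j < p - 1. (fst (E j) = v \<or> snd (E j) = v) \<longrightarrow> vval E ell Y j v = c) \<and>
          (\<Sum>j \<in> {j. j < p - 1 \<and> snd (E j) = v}. Y' j ell)
            - (\<Sum>j \<in> {j. j < p - 1 \<and> fst (E j) = v}. Y' j 0) + complex_of_real (b v) * c = 0"
      unfolding robin_sol_def by auto
    from bchoice[OF v] obtain x where
      x: "\<And>v j. v < p \<Longrightarrow> j < p - 1 \<Longrightarrow> fst (E j) = v \<or> snd (E j) = v \<Longrightarrow> vval E ell Y j v = x v"
        "\<And>v. v < p \<Longrightarrow> (\<Sum>j \<in> {j. j < p - 1 \<and> snd (E j) = v}. Y' j ell)
            - (\<Sum>j \<in> {j. j < p - 1 \<and> fst (E j) = v}. Y' j 0) + complex_of_real (b v) * x v = 0" by auto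
    have ends: "Y j 0 = x (fst (E j))" "Y j ell = x (snd (E j))" if "j < p - 1" for j
      using x(1)[of "fst (E j)" j] x(1)[of "snd (E j)" j] tree_endpoints[OF tree that] that
      by (auto simp: vval_def)
    let ?F = "\<lambda>v. (\<Sum>j<p-1. of_bool (snd (E j) = v) * Y' j ell) - (\<Sum>j<p-1. of_bool (fst (E j) = v) * Y' j 0)"
    define g where "g j t = - Im mu * Im (cnj (Y j t) * Y' j t)" for j t
    have dg: "(g j has_real_derivative (Im mu * cmod (Y j t))\<^sup>2) (at t within {0..ell})"
      if j: "j < p - 1" and t: "t \<in> {0..ell}" for j t
    proof -
      from d j obtain Y'' where Y'': "\<And>x. x \<in> {0..ell} \<Longrightarrow>
          (Y j has_vector_derivative Y' j x) (at x within {0..ell}) \<and>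
          (Y' j has_vector_derivative Y'' x) (at x within {0..ell}) \<and>
          - Y'' x = mu * Y j x" by blast
      have "((\<lambda>t. cnj (Y j t) * Y' j t) has_vector_derivative cnj (Y j t) * Y'' t + cnj (Y' j t) * Y' j t)
          (at t within {0..ell})"
        using Y''[OF t] by (intro has_vector_derivative_mult bounded_linear.has_vector_derivative[OF bounded_linear_cnj]) auto
      from bounded_linear.has_vector_derivative[OF bounded_linear_Im this]
      have "((\<lambda>t. Im (cnj (Y j t) * Y' j t)) has_real_derivative Im (cnj (Y j t) * Y'' t + cnj (Y' j t) * Y' j t))
          (at t within {0..ell})"
        by (simp only: has_real_derivative_iff_has_vector_derivative)
      from DERIV_cmult[OF this, of "- Im mu"]
      have "(g j has_real_derivative - Im mu * Im (cnj (Y j t) * Y'' t + cnj (Y' j t) * Y' j t)) (at t within {0..ell})"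
        unfolding g_def .
      moreover have "- Im mu * Im (cnj (Y j t) * Y'' t + cnj (Y' j t) * Y' j t) = (Im mu * cmod (Y j t))\<^sup>2"
      proof -
        have Yt: "Y'' t = - (mu * Y j t)" using Y''[OF t] by (metis minus_minus)
        show ?thesis unfolding Yt by (simp add: cmod_def power_mult_distrib power2_eq_square algebra_simps)
      qed
      ultimately show ?thesis by simp
    qed
    have mvt: "g j t1 \<le> g j t2" if j: "j < p - 1" and t: "0 \<le> t1" "t1 \<le> t2" "t2 \<le> ell" for j t1 t2
    proof (cases "t1 = t2")
      case False
      have "(g j has_derivative (*) ((Im mu * cmod (Y j y))\<^sup>2)) (at y within {t1..t2})"
        if "t1 \<le> y" "y \<le> t2" for y
        using DERIV_subset[OF dg[OF j, of y], of "{t1..t2}"] that t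
        by (simp add: has_field_derivative_def)
      then obtain y where "g j t2 - g j t1 = (Im mu * cmod (Y j y))\<^sup>2 * (t2 - t1)"
        using mvt_simple[of t1 t2 "g j" "\<lambda>y. (*) ((Im mu * cmod (Y j y))\<^sup>2)"] False t by auto
      then show ?thesis using t(2) by (metis diff_ge_0_iff_ge zero_le_mult_iff zero_le_power2)
    qed simp
    \<comment> \<open>Regrouped by vertices, the boundary terms are \<open>b v\<close> times squared
      moduli; as the Robin coefficients are real, the imaginary part is 0.\<close>
    have "(\<Sum>j<p-1. g j ell - g j 0) = 0"
    proof -
      have "(\<Sum>j<p-1. g j ell - g j 0)
          = - Im mu * Im (\<Sum>j<p-1. cnj (x (snd (E j))) * Y' j ell - cnj (x (fst (E j))) * Y' j 0)"
        by (simp add: g_def ends sum_distrib_left right_diff_distrib)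
      also have "(\<Sum>j<p-1. cnj (x (snd (E j))) * Y' j ell - cnj (x (fst (E j))) * Y' j 0)
          = (\<Sum>v<p. cnj (x v) * ?F v)"
      proof -
        have "(\<Sum>v<p. cnj (x v) * ?F v)
          = (\<Sum>v<p. \<Sum>j<p-1. of_bool (snd (E j) = v) * (cnj (x v) * Y' j ell))
            - (\<Sum>v<p. \<Sum>j<p-1. of_bool (fst (E j) = v) * (cnj (x v) * Y' j 0))"
          unfolding right_diff_distrib sum_distrib_left sum_subtractf
          by (intro arg_cong2[of _ _ _ _ "(-)"] sum.cong refl) (simp_all only: mult_ac)
        then show ?thesis unfolding sum_vertex_ends[OF tree] sum_subtractf by simp
      qed
      also have "\<dots> = (\<Sum>v<p. - of_real (b v * (cmod (x v))\<^sup>2))"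
      proof (rule sum.cong)
        fix v assume "v \<in> {..<p}"
        then have "?F v
            = - (of_real (b v) * x v)"
          using x(2)[of v] unfolding sum_guard_of_bool by (simp only: lessThan_iff add_eq_0_iff2)
        moreover have "cnj (x v) * x v = of_real ((cmod (x v))\<^sup>2)"
          by (metis complex_norm_square mult.commute of_real_power)
        ultimately show "cnj (x v) * ?F v
            = - of_real (b v * (cmod (x v))\<^sup>2)"
          by (simp only:) (simp add: algebra_simps)
      qed simp
      finally show ?thesis by (simp add: sum_negf)
    qed
    moreover have "0 \<le> g j ell - g j 0" if "j < p - 1" for j using mvt[OF that, of 0 ell] ell by simp
    ultimately have flat: "g j ell = g j 0" if "j < p - 1" for j
      using that sum_nonneg_eq_0_iff[of "{..<p-1}" "\<lambda>j. g j ell - g j 0"] by auto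
    have "Y j t = 0" if j: "j < p - 1" and t: "t \<in> {0..ell}" for j t
    proof -
      have const: "g j u = g j 0" if "u \<in> {0..ell}" for u
        using mvt[OF j, of 0 u] mvt[OF j, of u ell] flat[OF j] that by auto
      have "(g j has_vector_derivative (Im mu * cmod (Y j t))\<^sup>2) (at t within cbox 0 ell)"
        using dg[OF j t] by (simp add: has_real_derivative_iff_has_vector_derivative)
      moreover have "(g j has_vector_derivative 0) (at t within cbox 0 ell)"
      proof (rule has_vector_derivative_transform)
        show "g j u = g j 0" if "u \<in> cbox 0 ell" for u using const that unfolding cbox_interval .
        show "((\<lambda>_. g j 0) has_vector_derivative 0) (at t within cbox 0 ell)" by (rule has_vector_derivative_const)
      qed (use t in simp)
      ultimately have "(Im mu * cmod (Y j t))\<^sup>2 = 0"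
        using t by (intro vector_derivative_unique_within_closed_interval[OF ell]) (simp_all only: cbox_interval)
      then show ?thesis using mu by simp
    qed
    then show "\<exists>a. \<forall>j<p-1. \<forall>t\<in>{0..ell}. Y j t = (\<Sum>i\<in>{}. a i * undefined i j t)" by simp
  qed auto
  then show ?thesis by simp
qed

section \<open>The cosine and sine parts of the fundamental system\<close>

text \<open>The spectral parameter is written as \<open>y * \<bar>y\<bar> / ell\<^sup>2\<close> with real \<open>y\<close>, negative \<open>y\<close> standing for negative
  eigenvalues. \<open>Cf y\<close> and \<open>ell * Sf y\<close> are the values at \<open>ell\<close> of the solutions with initial data
  (1, 0) and (0, 1).\<close>
definition Cf :: "real \<Rightarrow> real" where
  "Cf y = (if y < 0 then cosh y else cos y)"

definition Sf :: "real \<Rightarrow> real" where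
  "Sf y = (if y < 0 then sinh y / y else if y = 0 then 1 else sin y / y)"

text \<open>The components of the complement of the zeros of \<open>Sf\<close>. Cell 0 extends to
  minus infinity to hold the negative eigenvalues, and it contains 0 because
  \<open>Sf 0 = 1\<close>.\<close>

definition cell :: "nat \<Rightarrow> real set" where
  "cell m = (if m = 0 then {..<pi} else {real m * pi<..<real (Suc m) * pi})"

lemma fundsys_Cf_Sf:
  assumes ell: "ell > 0"
  shows "\<exists>c s. fundsys (y * \<bar>y\<bar> / ell\<^sup>2) c s \<and> c ell = Cf y \<and> s ell = ell * Sf y"
proof -
  define k where "k = y / ell"
  have y: "y = k * ell" using ell by (simp add: k_def)
  have mu: "y * \<bar>y\<bar> / ell\<^sup>2 = k * \<bar>k\<bar>" using ell by (simp add: k_def power2_eq_square abs_mult)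
  consider "k < 0" | "k = 0" | "k > 0" by linarith
  then show ?thesis
  proof cases
    case 1
    have "fundsys (k * \<bar>k\<bar>) (\<lambda>x. cosh (k * x)) (\<lambda>x. sinh (k * x) / k)"
      unfolding fundsys_def
    proof (intro conjI allI)
      fix x
      show "((\<lambda>x. cosh (k * x)) has_real_derivative - (k * \<bar>k\<bar>) * (sinh (k * x) / k)) (at x)"
        using 1 by (auto intro!: derivative_eq_intros)
      show "((\<lambda>x. sinh (k * x) / k) has_real_derivative cosh (k * x)) (at x)"
        using 1 by (auto intro!: derivative_eq_intros)
      show "cosh (k * x) * cosh (k * x) + k * \<bar>k\<bar> * (sinh (k * x) / k * (sinh (k * x) / k)) = 1"
        using 1 hyperbolic_pythagoras[of "k * x"] by (simp add: power2_eq_square)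
    qed (use 1 in simp_all)
    moreover have "k * ell < 0" using 1 ell by (simp add: mult_neg_pos)
    ultimately show ?thesis
      unfolding mu using 1 ell by (intro exI[of _ "\<lambda>x. cosh (k * x)"] exI[of _ "\<lambda>x. sinh (k * x) / k"])
        (simp add: y Cf_def Sf_def)
  next
    case 2
    have "fundsys (k * \<bar>k\<bar>) (\<lambda>x. 1) (\<lambda>x. x)"
      unfolding fundsys_def using 2 by (auto intro!: derivative_eq_intros)
    then show ?thesis
      unfolding mu using 2 by (intro exI[of _ "\<lambda>x. 1"] exI[of _ "\<lambda>x. x"]) (simp add: y Cf_def Sf_def)
  next
    case 3
    have "fundsys (k * \<bar>k\<bar>) (\<lambda>x. cos (k * x)) (\<lambda>x. sin (k * x) / k)"
      unfolding fundsys_def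
    proof (intro conjI allI)
      fix x
      show "((\<lambda>x. cos (k * x)) has_real_derivative - (k * \<bar>k\<bar>) * (sin (k * x) / k)) (at x)"
        using 3 by (auto intro!: derivative_eq_intros)
      show "((\<lambda>x. sin (k * x) / k) has_real_derivative cos (k * x)) (at x)"
        using 3 by (auto intro!: derivative_eq_intros)
      show "cos (k * x) * cos (k * x) + k * \<bar>k\<bar> * (sin (k * x) / k * (sin (k * x) / k)) = 1"
        using 3 sin_cos_squared_add2[of "k * x"] by (simp add: power2_eq_square)
    qed (use 3 in simp_all)
    moreover have "k * ell > 0" using 3 ell by simp
    ultimately show ?thesis
      unfolding mu using 3 ell by (rule_tac exI[of _ "\<lambda>x. cos (k * x)"], rule_tac exI[of _ "\<lambda>x. sin (k * x) / k"])
        (simp add: y Cf_def Sf_def mult_less_0_iff)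
  qed
qed

text \<open>A removable singularity: the quotient tends to the derivative of \<open>g\<close> at 0.
  Needed for sin and sinh, the two halves of \<open>Sf\<close>.\<close>

lemma isCont_div_id:
  fixes g :: "real \<Rightarrow> real"
  assumes g: "(g has_real_derivative 1) (at 0)" "g 0 = 0" "isCont g y"
  shows "isCont (\<lambda>y. if y = 0 then 1 else g y / y) y"
proof (cases "y = 0")
  case True
  have "((\<lambda>y. g y / y) \<longlongrightarrow> 1) (at 0)" using g by (simp add: DERIV_def)
  then have "((\<lambda>y. if y = 0 then 1 else g y / y) \<longlongrightarrow> 1) (at 0)"
    by (rule Lim_transform_eventually) (auto simp: eventually_at_filter)
  then show ?thesis by (simp add: isCont_def True)
next
  case False
  have "isCont (\<lambda>y. g y / y) y" using False g(3) by (intro continuous_intros)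
  moreover have "\<forall>\<^sub>F x in nhds y. (if x = 0 then 1 else g x / x) = g x / x"
    using t1_space_nhds[OF False] by (auto elim: eventually_mono)
  ultimately show ?thesis by (simp add: isCont_cong)
qed

lemma continuous_on_Cf: "continuous_on A Cf"
proof -
  have "continuous_on ({..0} \<union> {0..}) (\<lambda>y::real. if y \<le> 0 then cosh y else cos y)"
    by (rule continuous_on_cases) (auto intro!: continuous_intros)
  then have "continuous_on ({..0} \<union> {0..}) Cf"
    by (rule continuous_on_eq) (auto simp: Cf_def)
  then show ?thesis by (rule continuous_on_subset) auto
qed

lemma continuous_on_Sf: "continuous_on A Sf"
proof -
  define h1 h2 where "h1 y = (if y = 0 then 1 else sinh y / y)" and "h2 y = (if y = 0 then 1 else sin y / y)" for y :: real
  have "isCont h1 y" "isCont h2 y" for y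
    unfolding h1_def h2_def by (rule isCont_div_id; auto intro!: derivative_eq_intros continuous_intros)+
  then have 1: "continuous_on {..0} h1" and 2: "continuous_on {0..} h2"
    by (simp_all add: continuous_at_imp_continuous_on)
  have "continuous_on ({..0} \<union> {0..}) (\<lambda>y. if y \<le> 0 then h1 y else h2 y)"
    by (rule continuous_on_cases) (use 1 2 in \<open>auto simp: h1_def h2_def\<close>)
  then have "continuous_on ({..0} \<union> {0..}) Sf"
    by (rule continuous_on_eq) (auto simp: Sf_def h1_def h2_def)
  then show ?thesis by (rule continuous_on_subset) auto
qed

lemma isCont_Cf: "isCont Cf y" and isCont_Sf: "isCont Sf y"
  using continuous_on_Cf[of UNIV] continuous_on_Sf[of UNIV]
  by (simp_all add: continuous_on_eq_continuous_at)

lemma Cf_multiple_pi: "Cf (real m * pi) = (-1) ^ m"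
  by (simp add: Cf_def mult_less_0_iff)

lemma Sf_multiple_pi: "0 < m \<Longrightarrow> Sf (real m * pi) = 0"
  by (simp add: Sf_def mult_less_0_iff)

lemma sin_shift: "sin (y - real m * pi) = (-1) ^ m * sin y"
  by (simp add: sin_diff)

lemma Sf_pos_0:
  assumes "y < pi"
  shows "Sf y > 0"
proof -
  consider "y < 0" | "y = 0" | "y > 0" by linarith
  then show ?thesis
  proof cases
    case 1
    then have "sinh y < 0" by simp
    then show ?thesis using 1 by (simp add: Sf_def divide_neg_neg)
  next
    case 3
    then have "sin y > 0" using assms sin_gt_zero by blast
    then show ?thesis using 3 by (simp add: Sf_def)
  qed (simp add: Sf_def)
qed

lemma Sf_sign:
  assumes y: "y \<in> cell m"
  shows "(-1) ^ m * Sf y > 0"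
proof (cases "m = 0")
  case True
  then show ?thesis using y Sf_pos_0 by (simp add: cell_def)
next
  case False
  then have y: "real m * pi < y" "y < real (Suc m) * pi" using assms by (auto simp: cell_def)
  then have "sin (y - real m * pi) > 0" by (intro sin_gt_zero) (auto simp: algebra_simps)
  then have "(-1) ^ m * sin y > 0" by (simp add: sin_shift)
  moreover have "y > 0" using y(1) by (metis False mult_pos_pos of_nat_0_less_iff not_gr_zero order.strict_trans pi_gt_zero)
  ultimately show ?thesis by (simp add: Sf_def field_simps)
qed

lemma Sf_nonzero: "y \<in> cell m \<Longrightarrow> Sf y \<noteq> 0"
  using Sf_sign[of y m] by auto

lemma Cf_sq: "y > 0 \<Longrightarrow> 1 - (Cf y)\<^sup>2 = (y * Sf y)\<^sup>2"
  by (simp add: Cf_def Sf_def sin_squared_eq)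

lemma Cf_gt_minus_1: "y \<in> cell m \<Longrightarrow> Cf y > -1"
proof (cases "y > 0")
  case True
  assume y: "y \<in> cell m"
  then have "(y * Sf y)\<^sup>2 > 0" using Sf_nonzero[OF y] True by simp
  then have "cos y \<noteq> -1" using Cf_sq[OF True] True by (auto simp: Cf_def)
  then show ?thesis using cos_ge_minus_one[of y] True by (simp add: Cf_def order_less_le)
next
  case False
  have "cosh y \<ge> 1" by (rule cosh_real_ge_1)
  then show ?thesis using False by (auto simp: Cf_def not_less)
qed

lemma Cf_less_1: "y \<in> cell m \<Longrightarrow> 0 < m \<Longrightarrow> Cf y < 1"
proof -
  assume y: "y \<in> cell m" "0 < m"
  then have pos: "y > 0" by (simp add: cell_def) (metis mult_pos_pos of_nat_0_less_iff order.strict_trans pi_gt_zero)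
  then have "(y * Sf y)\<^sup>2 > 0" using Sf_nonzero[OF y(1)] by simp
  then have "cos y \<noteq> 1" using Cf_sq[OF pos] pos by (auto simp: Cf_def)
  then show ?thesis using cos_le_one[of y] pos by (simp add: Cf_def order_less_le)
qed

lemma x_gt_sin: "0 < x \<Longrightarrow> sin x < (x::real)"
proof -
  assume x: "0 < x"
  show ?thesis
  proof (cases "x > 1")
    case True
    then show ?thesis using sin_le_one[of x] by linarith
  next
    case False
    have "(\<lambda>x. x - sin x) 0 < (\<lambda>x. x - sin x) x"
    proof (rule DERIV_pos_imp_increasing_open[OF x])
      fix y :: real assume y: "0 < y" "y < x"
      then have "y < pi" using False pi_gt3 by linarith
      then have "cos y < 1" using y cos_monotone_0_pi[of 0 y] by simp
      then show "\<exists>D. ((\<lambda>x. x - sin x) has_real_derivative D) (at y) \<and> D > 0"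
        by (intro exI[of _ "1 - cos y"]) (auto intro!: derivative_eq_intros)
    qed (intro continuous_intros)
    then show ?thesis by simp
  qed
qed

lemma sinh_gt_x: "0 < x \<Longrightarrow> x < sinh (x::real)"
proof -
  assume x: "0 < x"
  have "(\<lambda>x. sinh x - x) 0 < (\<lambda>x. sinh x - x) x"
  proof (rule DERIV_pos_imp_increasing_open[OF x])
    fix y :: real assume y: "0 < y" "y < x"
    then have "cosh y > 1" using cosh_real_strict_mono[of 0 y] by simp
    then show "\<exists>D. ((\<lambda>x. sinh x - x) has_real_derivative D) (at y) \<and> D > 0"
      by (intro exI[of _ "cosh y - 1"]) (auto intro!: derivative_eq_intros)
  qed (intro continuous_intros)
  then show ?thesis by simp
qed

text \<open>For \<open>y > 0\<close> these functions are \<open>y * tan (y / 2)\<close> and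
  \<open>- y * cot (y / 2)\<close>, for \<open>y < 0\<close> their hyperbolic analogues: up to sign
  and scaling, the eigenvalues of the Dirichlet-to-Neumann map of one edge. The decisive
  inequalities are \<open>\<bar>sin y\<bar> < y\<close> for positive \<open>y\<close> and
  \<open>sinh y < y\<close> for negative \<open>y\<close>. The point 0, where the formulas change,
  is left to continuity.\<close>

lemma edge_coeff_deriv:
  assumes y: "y \<noteq> 0" "y \<in> cell m"
  shows "\<exists>D. ((\<lambda>y. (1 - Cf y) / Sf y) has_real_derivative D) (at y) \<and> D > 0"
    and "\<exists>D. ((\<lambda>y. - (1 + Cf y) / Sf y) has_real_derivative D) (at y) \<and> D > 0"
proof -
  have "(\<exists>D. ((\<lambda>y. (1 - Cf y) / Sf y) has_real_derivative D) (at y) \<and> D > 0) \<and>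
    (\<exists>D. ((\<lambda>y. - (1 + Cf y) / Sf y) has_real_derivative D) (at y) \<and> D > 0)"
  proof (cases "y > 0")
    case True
    have s0: "sin y \<noteq> 0" using Sf_nonzero[OF y(2)] True by (simp add: Sf_def)
    have "cos y \<noteq> 1" "cos y \<noteq> -1" using s0 sin_squared_eq[of y] by auto
    then have cc: "1 - cos y > 0" "1 + cos y > 0"
      using cos_le_one[of y] cos_ge_minus_one[of y] by linarith+
    have sc: "sin y * sin y = 1 - cos y * cos y" using sin_squared_eq[of y] by (simp add: power2_eq_square)
    have "((\<lambda>y. y * (1 - cos y) / sin y) has_real_derivative (1 - cos y) * (sin y + y) / (sin y)\<^sup>2) (at y)"
      using s0 by (auto intro!: derivative_eq_intros) (simp add: field_simps power2_eq_square sc)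
    moreover have "((\<lambda>y. - y * (1 + cos y) / sin y) has_real_derivative (1 + cos y) * (y - sin y) / (sin y)\<^sup>2) (at y)"
      using s0 by (auto intro!: derivative_eq_intros)
        (simp add: field_simps power2_eq_square sc, subst minus_divide_left, simp)
    ultimately have 1: "((\<lambda>y. (1 - Cf y) / Sf y) has_real_derivative (1 - cos y) * (sin y + y) / (sin y)\<^sup>2) (at y)"
      and 2: "((\<lambda>y. - (1 + Cf y) / Sf y) has_real_derivative (1 + cos y) * (y - sin y) / (sin y)\<^sup>2) (at y)"
      by (auto elim!: has_field_derivative_transform_within_open[of _ _ _ "{0<..}"] simp: True Cf_def Sf_def algebra_simps)
    have "sin y + y > 0"
    proof (cases "y < pi")
      case True
      then show ?thesis using \<open>y > 0\<close> sin_gt_zero[of y] by linarith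
    next
      case False
      then show ?thesis using pi_gt3 sin_ge_minus_one[of y] by linarith
    qed
    then show ?thesis using 1 2 cc s0 x_gt_sin[OF True]
      by (intro conjI exI[of _ "(1 - cos y) * (sin y + y) / (sin y)\<^sup>2"] exI[of _ "(1 + cos y) * (y - sin y) / (sin y)\<^sup>2"])
        (assumption | simp)+
  next
    case False
    then have neg: "y < 0" using y by simp
    have s0: "sinh y < 0" using neg by simp
    have cc: "cosh y - 1 > 0" using cosh_real_strict_mono[of 0 "- y"] neg by simp
    have sc: "sinh y * sinh y = cosh y * cosh y - 1" using hyperbolic_pythagoras[of y] by (simp add: power2_eq_square)
    have "((\<lambda>y. y * (1 - cosh y) / sinh y) has_real_derivative (cosh y - 1) * (- sinh y - y) / (sinh y)\<^sup>2) (at y)"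
      using s0 by (auto intro!: derivative_eq_intros) (simp add: field_simps power2_eq_square sc)
    moreover have "((\<lambda>y. - y * (1 + cosh y) / sinh y) has_real_derivative (1 + cosh y) * (y - sinh y) / (sinh y)\<^sup>2) (at y)"
      using s0 by (auto intro!: derivative_eq_intros) 
        (simp add: field_simps power2_eq_square sc, subst minus_divide_left, simp)
    ultimately have 1: "((\<lambda>y. (1 - Cf y) / Sf y) has_real_derivative (cosh y - 1) * (- sinh y - y) / (sinh y)\<^sup>2) (at y)"
      and 2: "((\<lambda>y. - (1 + Cf y) / Sf y) has_real_derivative (1 + cosh y) * (y - sinh y) / (sinh y)\<^sup>2) (at y)"
      by (auto elim!: has_field_derivative_transform_within_open[of _ _ _ "{..<0}"] simp: neg Cf_def Sf_def algebra_simps)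
    have "y - sinh y > 0" using sinh_gt_x[of "- y"] neg by simp
    moreover have "1 + cosh y > 0" "- sinh y - y > 0" using s0 cc neg by linarith+
    moreover have "(sinh y)\<^sup>2 > 0" using s0 by simp
    ultimately show ?thesis using 1 2 cc
      by (intro conjI exI[of _ "(cosh y - 1) * (- sinh y - y) / (sinh y)\<^sup>2"] exI[of _ "(1 + cosh y) * (y - sinh y) / (sinh y)\<^sup>2"])
        (assumption | simp)+
  qed
  then show "\<exists>D. ((\<lambda>y. (1 - Cf y) / Sf y) has_real_derivative D) (at y) \<and> D > 0"
    and "\<exists>D. ((\<lambda>y. - (1 + Cf y) / Sf y) has_real_derivative D) (at y) \<and> D > 0" by auto
qed

lemma cell_between: "x \<in> cell m \<Longrightarrow> y \<in> cell m \<Longrightarrow> x \<le> t \<Longrightarrow> t \<le> y \<Longrightarrow> t \<in> cell m"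
  by (auto simp: cell_def split: if_splits)

lemma edge_coeff_strict_mono:
  assumes x: "x \<in> cell m" and y: "y \<in> cell m" and xy: "x < y"
  shows "(1 - Cf x) / Sf x < (1 - Cf y) / Sf y" and "- (1 + Cf x) / Sf x < - (1 + Cf y) / Sf y"
proof -
  have *: "g x < g y" if g: "\<And>t. t \<in> cell m \<Longrightarrow> t \<noteq> 0 \<Longrightarrow> \<exists>D. (g has_real_derivative D) (at t) \<and> D > 0"
    and cont: "continuous_on {x..y} g" for g :: "real \<Rightarrow> real"
  proof -
    \<comment> \<open>An interval with 0 in its interior is excluded here and cut at 0
      afterwards.\<close>
    have step: "g a < g c" if a: "x \<le> a" "c \<le> y" "a < c" "\<not> (a < 0 \<and> 0 < c)" for a c
    proof (rule DERIV_pos_imp_increasing_open[OF a(3)])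
      show "continuous_on {a..c} g" by (rule continuous_on_subset[OF cont]) (use a in auto)
      fix t assume t: "a < t" "t < c"
      then have "t \<noteq> 0" using a(4) by auto
      moreover have "t \<in> cell m" using cell_between[OF x y, of t] t a by simp
      ultimately show "\<exists>D. (g has_real_derivative D) (at t) \<and> D > 0" using g by blast
    qed
    show ?thesis
    proof (cases "x < 0 \<and> 0 < y")
      case True
      then show ?thesis using step[of x 0] step[of 0 y] by auto
    next
      case False
      then show ?thesis using step[of x y] xy by auto
    qed
  qed
  have nz: "\<forall>t\<in>{x..y}. Sf t \<noteq> 0" using Sf_nonzero cell_between[OF x y] by (metis atLeastAtMost_iff)
  show "(1 - Cf x) / Sf x < (1 - Cf y) / Sf y"
    by (rule *) (use edge_coeff_deriv(1) nz in \<open>auto intro!: continuous_intros continuous_on_Cf continuous_on_Sf\<close>)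
  show "- (1 + Cf x) / Sf x < - (1 + Cf y) / Sf y"
    by (rule *) (use edge_coeff_deriv(2) nz in \<open>auto intro!: continuous_intros continuous_on_Cf continuous_on_Sf\<close>)
qed

section \<open>Eigenvalue curves\<close>

locale robin_tree =
  fixes p :: nat and E :: "nat \<Rightarrow> nat \<times> nat" and b :: "nat \<Rightarrow> real"
  assumes tree: "is_tree p E"
begin

abbreviation "w x \<equiv> wip p (degr p E) x x"
abbreviation "eigen C S \<equiv> eigensys p (degr p E) (robin_matrix p E b C S)"
abbreviation "Q C S x \<equiv> robin_form p E b C S x"

definition B :: real where "B = (\<Sum>v<p. b v)"

text \<open>Bounds the Robin potential relative to the weighted norm, all degrees being at least 1;
  it becomes the Lipschitz constant of the curves in \<open>S\<close>.\<close>

definition beta :: real where "beta = (\<Sum>v<p. \<bar>b v\<bar>)"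

text \<open>Every admissible choice has the same values below \<open>p\<close>, since two sorted
  systems of one matrix compare in both directions. Sorted numbering keeps min-max available through
  crossings.\<close>

definition ev :: "real \<Rightarrow> nat \<Rightarrow> real" where
  "ev y = (SOME th. \<exists>X. eigen (Cf y) (Sf y) th X)"

lemma p2: "2 \<le> p"
  using tree by (simp add: is_tree_def)

lemma degr_pos: "v < p \<Longrightarrow> 0 < degr p E v"
  using deg_pos[OF tree] by simp

lemma robin_eigensys_exists: "\<exists>th X. eigen C S th X"
  by (rule eigensys_exists) (use degr_pos robin_matrix_sym in auto)

lemma ev_eigensys: "\<exists>X. eigen (Cf y) (Sf y) (ev y) X"
  unfolding ev_def using someI_ex[OF robin_eigensys_exists] .

lemma beta_nonneg: "beta \<ge> 0"
  by (simp add: beta_def sum_nonneg)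

lemma robin_potential_bound: "\<bar>\<Sum>v<p. b v * (x v)\<^sup>2\<bar> \<le> beta * w x"
proof -
  have "(x v)\<^sup>2 \<le> w x" if v: "v < p" for v
  proof -
    have "1 \<le> degr p E v" using deg_pos[OF tree v] by linarith
    then have "(x v)\<^sup>2 \<le> degr p E v * (x v)\<^sup>2" using mult_right_mono[of 1 "degr p E v" "(x v)\<^sup>2"] by simp
    also have "\<dots> \<le> w x"
      unfolding wip_def by (rule order_trans[OF _ member_le_sum[of v]]) (use v in \<open>auto simp: mult.assoc power2_eq_square\<close>)
    finally show ?thesis .
  qed
  then have "(\<Sum>v<p. \<bar>b v * (x v)\<^sup>2\<bar>) \<le> (\<Sum>v<p. \<bar>b v\<bar> * w x)"
    by (intro sum_mono) (auto simp: abs_mult intro: mult_left_mono)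
  then show ?thesis
    unfolding beta_def sum_distrib_right by (rule order_trans[OF sum_abs])
qed

lemma robin_form_shift:
  "Q C S x = Q C' S' x - (C - C') * w x - (S - S') * (\<Sum>v<p. b v * (x v)\<^sup>2)"
  unfolding robin_form_def wip_degr[OF tree]
  by (simp add: sum_subtractf sum.distrib sum_distrib_left algebra_simps)

lemma robin_minmax:
  assumes "eigen C S th X"
    "eigen C' S' th' X'" "i < p"
  shows "\<exists>x. w x > 0 \<and> th i * w x \<le> Q C S x \<and> Q C' S' x \<le> th' i * w x"
  using eigensys_minmax[OF assms] by (simp add: bform_robin_matrix[OF tree])

lemma robin_eigensys_compare:
  assumes "eigen C S th X"
    "eigen C' S' th' X'" "i < p"
  shows "th i \<le> th' i - (C - C') + beta * \<bar>S - S'\<bar>"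
proof -
  obtain x where x: "w x > 0" "th i * w x \<le> Q C S x" "Q C' S' x \<le> th' i * w x"
    using robin_minmax[OF assms] by auto
  have "- ((S - S') * (\<Sum>v<p. b v * (x v)\<^sup>2)) \<le> \<bar>S - S'\<bar> * (beta * w x)"
    using mult_left_mono[OF robin_potential_bound[of x], of "\<bar>S - S'\<bar>"] by (simp add: abs_mult[symmetric])
  then have "th i * w x \<le> (th' i - (C - C') + beta * \<bar>S - S'\<bar>) * w x"
    using x robin_form_shift[of C S x C' S'] by (simp add: algebra_simps)
  then show ?thesis using x(1) by simp
qed

text \<open>\<open>C\<close> multiplies the weight itself and shifts the eigenvalues exactly; only
  the change of \<open>S\<close> needs an estimate. Continuity, the values at multiples of pi and
  the asymptotics all come from this.\<close>

lemma ev_compare: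
  assumes "eigen C S th X" "i < p"
  shows "\<bar>ev y i - (th i + C - Cf y)\<bar> \<le> beta * \<bar>Sf y - S\<bar>"
proof -
  obtain Z where Z: "eigen (Cf y) (Sf y) (ev y) Z"
    using ev_eigensys by blast
  show ?thesis
    using robin_eigensys_compare[OF assms(1) Z assms(2)] robin_eigensys_compare[OF Z assms(1,2)]
    by (simp add: abs_minus_commute abs_le_iff)
qed

lemma isCont_ev:
  assumes i: "i < p"
  shows "isCont (\<lambda>y. ev y i) y"
proof -
  obtain Z where Z: "eigen (Cf y) (Sf y) (ev y) Z"
    using ev_eigensys by blast
  have bound: "\<bar>ev t i - ev y i\<bar> \<le> \<bar>Cf t - Cf y\<bar> + beta * \<bar>Sf t - Sf y\<bar>" for t
    using ev_compare[OF Z i, of t] by linarith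
  have "((\<lambda>t. \<bar>Cf t - Cf y\<bar> + beta * \<bar>Sf t - Sf y\<bar>) \<longlongrightarrow> \<bar>Cf y - Cf y\<bar> + beta * \<bar>Sf y - Sf y\<bar>) (at y)"
    by (intro tendsto_intros isCont_Cf[unfolded isCont_def] isCont_Sf[unfolded isCont_def])
  then have lim: "((\<lambda>t. \<bar>Cf t - Cf y\<bar> + beta * \<bar>Sf t - Sf y\<bar>) \<longlongrightarrow> 0) (at y)" by simp
  have "((\<lambda>t. ev t i - ev y i) \<longlongrightarrow> 0) (at y)"
    by (rule Lim_null_comparison[OF _ lim]) (simp only: real_norm_def bound eventually_True)
  then show ?thesis unfolding isCont_def by (rule LIM_zero_cancel)
qed

lemma continuous_on_ev: "i < p \<Longrightarrow> continuous_on A (\<lambda>y. ev y i)"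
  using isCont_ev by (simp add: continuous_at_imp_continuous_on)

text \<open>On each cell the edge coefficients of the quotient are strictly increasing in \<open>y\<close>; this makes every
  eigenvalue curve cross 0 at most once per cell.\<close>
lemma robin_form_quotient:
  assumes "S \<noteq> 0"
  shows "Q C S x / S = (\<Sum>j<p-1. (1 - C) / S * ((x (fst (E j)) + x (snd (E j)))\<^sup>2 / 2)
      + (- (1 + C) / S) * ((x (fst (E j)) - x (snd (E j)))\<^sup>2 / 2)) - (\<Sum>v<p. b v * (x v)\<^sup>2)"
proof -
  have "(\<Sum>j<p-1. (1 - C) / S * ((x (fst (E j)) + x (snd (E j)))\<^sup>2 / 2)
      + (- (1 + C) / S) * ((x (fst (E j)) - x (snd (E j)))\<^sup>2 / 2))
    = (\<Sum>j<p-1. 2 * x (fst (E j)) * x (snd (E j)) - C * ((x (fst (E j)))\<^sup>2 + (x (snd (E j)))\<^sup>2)) / S"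
    unfolding sum_divide_distrib
    by (intro sum.cong refl) (use assms in \<open>simp add: field_simps power2_eq_square\<close>)
  then show ?thesis using assms by (simp add: robin_form_def diff_divide_distrib)
qed

text \<open>Every edge contributes two increasing coefficients times squares, and at some edge the
  squares do not both vanish; the Robin part of the quotient does not depend on
  \<open>y\<close>.\<close>

lemma robin_form_quotient_strict_mono:
  assumes y: "y \<in> cell m" and y': "y' \<in> cell m" and "y < y'" and x: "w x > 0"
  shows "Q (Cf y) (Sf y) x / Sf y < Q (Cf y') (Sf y') x / Sf y'"
proof -
  note less = edge_coeff_strict_mono[OF y y' \<open>y < y'\<close>]
  let ?g = "\<lambda>y j. (1 - Cf y) / Sf y * ((x (fst (E j)) + x (snd (E j)))\<^sup>2 / 2)
      + (- (1 + Cf y) / Sf y) * ((x (fst (E j)) - x (snd (E j)))\<^sup>2 / 2)"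
  have "\<exists>j<p-1. (x (fst (E j)))\<^sup>2 + (x (snd (E j)))\<^sup>2 \<noteq> 0"
    using x unfolding wip_degr[OF tree] by (metis (no_types, lifting) lessThan_iff order_less_irrefl sum.neutral)
  then obtain j where j: "j < p - 1" "x (fst (E j)) + x (snd (E j)) \<noteq> 0 \<or> x (fst (E j)) - x (snd (E j)) \<noteq> 0"
    by fastforce
  have le: "?g y k \<le> ?g y' k" for k
    by (intro add_mono mult_right_mono) (use less in simp_all)
  have "?g y j < ?g y' j"
  proof (cases "x (fst (E j)) + x (snd (E j)) = 0")
    case True
    then have "?g y j = (- (1 + Cf y) / Sf y) * ((x (fst (E j)) - x (snd (E j)))\<^sup>2 / 2)"
      "?g y' j = (- (1 + Cf y') / Sf y') * ((x (fst (E j)) - x (snd (E j)))\<^sup>2 / 2)" by simp_all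
    moreover have "(x (fst (E j)) - x (snd (E j)))\<^sup>2 / 2 > 0" using True j(2) by simp
    ultimately show ?thesis using mult_strict_right_mono[OF less(2)] by presburger
  next
    case False
    then have "(x (fst (E j)) + x (snd (E j)))\<^sup>2 / 2 > 0" by simp
    then show ?thesis
      by (intro add_less_le_mono mult_strict_right_mono mult_right_mono) (use less in simp_all)
  qed
  then have "sum (?g y) {..<p-1} < sum (?g y') {..<p-1}"
    by (intro sum_strict_mono_ex1) (use le j(1) in auto)
  then show ?thesis
    unfolding robin_form_quotient[OF Sf_nonzero[OF y]] robin_form_quotient[OF Sf_nonzero[OF y']] by simp
qed

lemma ev_quotient_strict_mono:
  assumes y: "y \<in> cell m" and y': "y' \<in> cell m" and less: "y < y'" and i: "i < p"
  shows "ev y i / Sf y < ev y' i / Sf y'"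
proof -
  obtain Z where Z: "eigen (Cf y) (Sf y) (ev y) Z"
    using ev_eigensys by blast
  obtain Z' where Z': "eigen (Cf y') (Sf y') (ev y') Z'"
    using ev_eigensys by blast
  have "\<exists>x. w x > 0 \<and> ev y i / Sf y * w x \<le> Q (Cf y) (Sf y) x / Sf y \<and>
     Q (Cf y') (Sf y') x / Sf y' \<le> ev y' i / Sf y' * w x"
  proof (cases "even m")
    case True
    then have "Sf y > 0" "Sf y' > 0" using Sf_sign[OF y] Sf_sign[OF y'] by auto
    then show ?thesis using robin_minmax[OF Z Z' i] by (auto simp: divide_right_mono)
  next
    \<comment> \<open>For odd \<open>m\<close> division by \<open>Sf\<close> reverses inequalities,
      so the test vector comes from the comparison with the two parameters exchanged.\<close>
    case False
    then have neg: "Sf y < 0" "Sf y' < 0" using Sf_sign[OF y] Sf_sign[OF y'] by auto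
    obtain x where "w x > 0" "ev y' i * w x \<le> Q (Cf y') (Sf y') x" "Q (Cf y) (Sf y) x \<le> ev y i * w x"
      using robin_minmax[OF Z' Z i] by auto
    then show ?thesis using neg by (auto simp: divide_right_mono_neg)
  qed
  then obtain x where x: "w x > 0" "ev y i / Sf y * w x \<le> Q (Cf y) (Sf y) x / Sf y"
     "Q (Cf y') (Sf y') x / Sf y' \<le> ev y' i / Sf y' * w x" by auto
  then have "ev y i / Sf y * w x < ev y' i / Sf y' * w x"
    using robin_form_quotient_strict_mono[OF y y' less x(1)] by linarith
  then show ?thesis by (simp only: mult_less_cancel_right_pos[OF x(1)])
qed

lemma ev_zero_unique:
  assumes "y \<in> cell m" "y' \<in> cell m" "i < p" "ev y i = 0" "ev y' i = 0"
  shows "y = y'"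
  using ev_quotient_strict_mono[of y m y' i] ev_quotient_strict_mono[of y' m y i] assms
  by (cases y y' rule: linorder_cases) auto

text \<open>Far to the left \<open>- cosh y\<close> dominates the form. The point replaces the
  missing left end of cell 0 when zeros are bracketed.\<close>

lemma ev_negative_far:
  assumes i: "i < p"
  shows "ev (- (2 * beta + 2)) i < 0"
proof -
  \<comment> \<open>The factor 2 makes \<open>beta / (- y)\<close> at most \<open>1 / 2\<close>, and
    the summand 2 forces \<open>cosh y > 2\<close>; hence
    \<open>1 - cosh y + cosh y / 2 < 0\<close>.\<close>
  define y where "y = - (2 * beta + 2)"
  have y: "y \<le> -2" using beta_nonneg by (simp add: y_def)
  obtain Z where Z: "eigen (Cf y) (Sf y) (ev y) Z"
    using ev_eigensys by blast
  obtain x where x: "w x > 0" "ev y i * w x \<le> Q (Cf y) (Sf y) x"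
    using robin_minmax[OF Z Z i] by auto
  have "Q 1 0 x \<le> 0"
    unfolding robin_form_def by (simp, intro sum_nonpos) (simp add: sum_squares_bound)
  then have "Q (Cf y) (Sf y) x \<le> (1 - Cf y + beta * \<bar>Sf y\<bar>) * w x"
  proof -
    have "- (Sf y * (\<Sum>v<p. b v * (x v)\<^sup>2)) \<le> \<bar>Sf y\<bar> * (beta * w x)"
      using mult_left_mono[OF robin_potential_bound[of x], of "\<bar>Sf y\<bar>"] by (simp add: abs_mult[symmetric])
    then show ?thesis using \<open>Q 1 0 x \<le> 0\<close> robin_form_shift[of "Cf y" "Sf y" x 1 0] by (simp add: algebra_simps)
  qed
  moreover have "1 - Cf y + beta * \<bar>Sf y\<bar> < 0"
  proof -
    have sc: "sinh (- y) \<le> cosh (- y)" using sinh_le_cosh_real by blast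
    have "sinh (- y) \<ge> - y" using sinh_gt_x[of "- y"] y by simp
    then have c2: "cosh y > 2 - 0" using sinh_gt_x[of "- y"] sc y by simp
    have "beta * \<bar>Sf y\<bar> = beta * (sinh (- y) / (- y))"
      using y by (simp add: Sf_def abs_if divide_less_0_iff)
    also have "\<dots> \<le> beta * (cosh y / (- y))"
      using sc y beta_nonneg by (intro mult_left_mono divide_right_mono) auto
    also have "\<dots> = (beta / (- y)) * cosh y" by simp
    also have "\<dots> \<le> 1 / 2 * cosh y"
      using y beta_nonneg by (intro mult_right_mono) (auto simp: y_def field_simps)
    finally show ?thesis using c2 y by (simp add: Cf_def)
  qed
  ultimately have "ev y i * w x < 0" using x by (smt (verit) mult_neg_pos)
  then show ?thesis using x(1) by (simp add: y_def mult_less_0_iff)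
qed

lemma ev_IVT:
  assumes i: "i < p" and ac: "a < c" and sgn: "ev a i * ev c i < 0"
  shows "\<exists>y. a < y \<and> y < c \<and> ev y i = 0"
proof -
  have "\<exists>y\<ge>a. y \<le> c \<and> ev y i = 0"
  proof (cases "ev a i < 0")
    case True
    then show ?thesis using IVT'[of "\<lambda>y. ev y i" a 0 c] sgn ac continuous_on_ev[OF i]
      by (auto simp: mult_less_0_iff)
  next
    case False
    then show ?thesis using IVT2'[of "\<lambda>y. ev y i" c 0 a] sgn ac continuous_on_ev[OF i]
      by (auto simp: mult_less_0_iff)
  qed
  then show ?thesis using sgn by (metis mult_eq_0_iff order.order_iff_strict order_less_irrefl)
qed

end

section \<open>The curves at and near the multiples of pi\<close>

context robin_tree
begin

text \<open>The eigenvalues of \<open>A\<close> relative to \<open>D\<close>, numbered from 0; they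
  are shown below to be the zeros of psi.\<close>

definition theta :: "nat \<Rightarrow> real" where
  "theta = (SOME th. \<exists>X. eigen 0 0 th X)"

text \<open>The index of the eigenvalue curve that vanishes at \<open>m * pi\<close> irrespective of the Robin coefficients.\<close>
definition idx :: "nat \<Rightarrow> nat" where
  "idx m = (if even m then p - 1 else 0)"

lemma theta_eigensys: "\<exists>X. eigen 0 0 theta X"
  unfolding theta_def using someI_ex[OF robin_eigensys_exists] .

lemma ev_theta: "i < p \<Longrightarrow> \<bar>ev y i - (theta i - Cf y)\<bar> \<le> beta * \<bar>Sf y\<bar>"
  using theta_eigensys ev_compare[of 0 0 theta _ i y] by auto

lemma ev_multiple_pi: "i < p \<Longrightarrow> 0 < m \<Longrightarrow> ev (real m * pi) i = theta i - (-1) ^ m"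
  using ev_theta[of i "real m * pi"] by (simp add: Sf_multiple_pi Cf_multiple_pi)

lemma idx_less: "idx m < p"
  using p2 by (simp add: idx_def)

lemma idx_Suc_neq: "idx (Suc m) \<noteq> idx m"
  using p2 by (simp add: idx_def)

lemma idx_interior: "0 < i \<Longrightarrow> i < p - 1 \<Longrightarrow> i \<noteq> idx m"
  by (auto simp: idx_def)

lemma neg1_pow_cases: "(-1 :: real) ^ m = 1 \<or> (-1 :: real) ^ m = -1"
  by (cases "even m") auto

text \<open>On an edge with end values \<open>a\<close> and \<open>c\<close>,
  \<open>2 * s * a * c = a\<^sup>2 + c\<^sup>2 - (c - s * a)\<^sup>2\<close>. The subtracted squares
  form a Dirichlet energy twisted by \<open>s\<close>, which vanishes exactly on the multiples of
  the signing.\<close>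

lemma robin_form_signed:
  assumes s: "s = 1 \<or> s = (-1::real)"
  shows "s * Q C S x = (1 - s * C) * w x - (\<Sum>j<p-1. (x (snd (E j)) - s * x (fst (E j)))\<^sup>2)
     - s * S * (\<Sum>v<p. b v * (x v)\<^sup>2)"
proof -
  have "s * (\<Sum>j<p-1. 2 * x (fst (E j)) * x (snd (E j)) - C * ((x (fst (E j)))\<^sup>2 + (x (snd (E j)))\<^sup>2))
     = (1 - s * C) * w x - (\<Sum>j<p-1. (x (snd (E j)) - s * x (fst (E j)))\<^sup>2)"
    unfolding wip_degr[OF tree] sum_distrib_left sum_subtractf[symmetric]
    by (intro sum.cong refl) (use s in \<open>auto simp: power2_eq_square algebra_simps\<close>)
  then show ?thesis unfolding robin_form_def by (simp add: right_diff_distrib mult.assoc)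
qed

text \<open>A constant vector for even \<open>m\<close>, a proper 2-colouring of the tree for odd \<open>m\<close>.\<close>
definition signing :: "nat \<Rightarrow> (nat \<Rightarrow> real) \<Rightarrow> bool" where
  "signing m u \<longleftrightarrow> (\<forall>v<p. u v = 1 \<or> u v = -1) \<and> (\<forall>j<p-1. u (snd (E j)) = (-1) ^ m * u (fst (E j)))"

lemma signing_exists: "\<exists>u. signing m u"
  unfolding signing_def by (rule tree_signing[OF tree neg1_pow_cases])

lemma signing_form:
  assumes sg: "signing m u"
  shows "w u = 2 * real (p - 1)" and "(\<Sum>v<p. b v * (u v)\<^sup>2) = B"
    and "(-1) ^ m * Q C S u = (1 - (-1) ^ m * C) * (2 * real (p - 1)) - (-1) ^ m * S * B"
proof -
  have u: "\<And>v. v < p \<Longrightarrow> u v = 1 \<or> u v = -1" "\<And>j. j < p - 1 \<Longrightarrow> u (snd (E j)) = (-1) ^ m * u (fst (E j))"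
    using sg by (auto simp: signing_def)
  have sq: "(u v)\<^sup>2 = 1" if "v < p" for v using u(1)[OF that] by auto
  show wu: "w u = 2 * real (p - 1)"
    unfolding wip_degr[OF tree] using sq tree_endpoints[OF tree] by simp
  show bu: "(\<Sum>v<p. b v * (u v)\<^sup>2) = B" using sq by (simp add: B_def)
  show "(-1) ^ m * Q C S u = (1 - (-1) ^ m * C) * (2 * real (p - 1)) - (-1) ^ m * S * B"
    unfolding robin_form_signed[OF neg1_pow_cases[of m]] wu bu using u(2) by simp
qed

text \<open>\<open>idx m\<close> is the top index for even \<open>m\<close> and the bottom one for
  odd \<open>m\<close>; the factor \<open>(-1) ^ m\<close> turns both Rayleigh bounds into a single
  upper bound.\<close>

lemma extremal_bound:
  assumes "eigen C S th X"
  shows "(-1) ^ m * Q C S x \<le> (-1) ^ m * th (idx m) * w x"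
  using eigensys_top[OF assms, of x] p2 by (simp add: bform_robin_matrix[OF tree] idx_def)

text \<open>The signing as test vector bounds the extremal eigenvalue away from 0. This excludes
  zeros on the side of a multiple of pi where the Robin term has the favourable sign.\<close>

lemma ev_extremal_sign:
  assumes "(-1) ^ m * Sf y * B \<le> 0" "(-1) ^ m * Cf y < 1"
  shows "(-1) ^ m * ev y (idx m) > 0"
proof -
  obtain u where u: "signing m u" using signing_exists by blast
  obtain Z where Z: "eigen (Cf y) (Sf y) (ev y) Z"
    using ev_eigensys by blast
  have pos: "2 * real (p - 1) > 0" using p2 by simp
  then have "0 < (1 - (-1) ^ m * Cf y) * (2 * real (p - 1))" using assms(2) by (intro mult_pos_pos) simp_all
  then have "0 < (-1) ^ m * Q (Cf y) (Sf y) u" unfolding signing_form(3)[OF u] using assms(1) by linarith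
  also have "\<dots> \<le> (-1) ^ m * ev y (idx m) * w u" by (rule extremal_bound[OF Z])
  finally show ?thesis unfolding signing_form(1)[OF u] using pos by (simp only: zero_less_mult_pos2)
qed

lemma theta_signed:
  assumes X: "eigen 0 0 theta X" and i: "i < p"
  shows "(-1) ^ m * theta i = 1 - (\<Sum>j<p-1. (X i (snd (E j)) - (-1) ^ m * X i (fst (E j)))\<^sup>2)"
proof -
  have wX: "w (X i) = 1" using X i by (simp add: eigensys_def)
  have "Q 0 0 (X i) = theta i * w (X i)"
    unfolding bform_robin_matrix[OF tree, symmetric]
    by (rule bform_eigen) (use X i in \<open>simp add: eigensys_def\<close>)
  then show ?thesis using robin_form_signed[OF neg1_pow_cases[of m], of 0 0 "X i"] wX by simp
qed

lemma theta_idx: "theta (idx m) = (-1) ^ m"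
proof -
  obtain X where X: "eigen 0 0 theta X" using theta_eigensys by blast
  obtain u where u: "signing m u" using signing_exists by blast
  have pos: "2 * real (p - 1) > 0" using p2 by simp
  have "1 * (2 * real (p - 1)) \<le> (-1) ^ m * theta (idx m) * (2 * real (p - 1))"
    using extremal_bound[OF X, of m u] unfolding signing_form[OF u] by simp
  then have "1 \<le> (-1) ^ m * theta (idx m)" using pos by (simp only: mult_le_cancel_right_pos)
  moreover have "(-1) ^ m * theta (idx m) \<le> 1"
    unfolding theta_signed[OF X idx_less] by (simp add: sum_nonneg)
  ultimately have "(-1) ^ m * theta (idx m) = 1" by linarith
  then show ?thesis using neg1_pow_cases[of m] by auto
qed

lemma signed_const:
  fixes x :: "nat \<Rightarrow> real"
  assumes sg: "signing m u"
    and x: "\<forall>j<p-1. x (snd (E j)) = (-1) ^ m * x (fst (E j))" and v: "v < p"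
  shows "x v = x 0 * u 0 * u v"
proof -
  have u: "\<And>v. v < p \<Longrightarrow> u v = 1 \<or> u v = -1" "\<And>j. j < p - 1 \<Longrightarrow> u (snd (E j)) = (-1) ^ m * u (fst (E j))"
    using sg by (auto simp: signing_def)
  have "x v * u v = x 0 * u 0"
  proof (rule tree_const[OF tree _ v])
    fix j assume "j < p - 1"
    then show "x (fst (E j)) * u (fst (E j)) = x (snd (E j)) * u (snd (E j))"
      using x u(2)[of j] neg1_pow_cases[of m] by auto
  qed
  then have "x v * (u v * u v) = x 0 * u 0 * u v" by (simp add: mult.assoc[symmetric])
  moreover have "u v * u v = 1" using u(1)[OF v] by auto
  ultimately show ?thesis by simp
qed

text \<open>Simplicity of 1 and -1: eigenvectors with zero twisted energy are multiples of the
  signing, and two orthonormal vectors cannot both be such multiples.\<close>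

lemma theta_strict:
  assumes i: "i < p" "i \<noteq> idx m"
  shows "(-1) ^ m * theta i < 1"
proof -
  obtain X where X: "eigen 0 0 theta X" using theta_eigensys by blast
  obtain u where u: "signing m u" using signing_exists by blast
  have edge: "\<forall>j<p-1. X k (snd (E j)) = (-1) ^ m * X k (fst (E j))"
    if k: "k < p" "(-1) ^ m * theta k = 1" for k
  proof -
    have "(\<Sum>j<p-1. (X k (snd (E j)) - (-1) ^ m * X k (fst (E j)))\<^sup>2) = 0"
      using theta_signed[OF X k(1), of m] k(2) by simp
    then have "\<forall>j\<in>{..<p-1}. (X k (snd (E j)) - (-1) ^ m * X k (fst (E j)))\<^sup>2 = 0"
      by (subst (asm) sum_nonneg_eq_0_iff) simp_all
    then show ?thesis by simp
  qed
  have "(-1) ^ m * theta i \<le> 1" unfolding theta_signed[OF X i(1)] by (simp add: sum_nonneg)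
  moreover have "(-1) ^ m * theta i \<noteq> 1"
  proof
    assume one: "(-1) ^ m * theta i = 1"
    have one': "(-1) ^ m * theta (idx m) = 1" using theta_idx[of m] neg1_pow_cases[of m] by auto
    define k l where "k = X i 0 * u 0" and "l = X (idx m) 0 * u 0"
    have k: "X i v = k * u v" and l: "X (idx m) v = l * u v" if "v < p" for v
      using signed_const[OF u edge[OF i(1) one] that] signed_const[OF u edge[OF idx_less one'] that]
      by (simp_all add: k_def l_def)
    have pull: "wip p (degr p E) (\<lambda>v. a * u v) (\<lambda>v. c * u v) = a * c * w u" for a c
      unfolding wip_def by (simp add: sum_distrib_left mult_ac)
    have "wip p (degr p E) (X i) (X (idx m)) = wip p (degr p E) (\<lambda>v. k * u v) (\<lambda>v. l * u v)"
      "w (X i) = wip p (degr p E) (\<lambda>v. k * u v) (\<lambda>v. k * u v)"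
      "w (X (idx m)) = wip p (degr p E) (\<lambda>v. l * u v) (\<lambda>v. l * u v)"
      using k l by (auto intro!: wip_cong)
    then have "wip p (degr p E) (X i) (X (idx m)) = k * l * w u" "w (X i) = k * k * w u" "w (X (idx m)) = l * l * w u"
      by (simp_all only: pull)
    moreover have "wip p (degr p E) (X i) (X (idx m)) = 0" "w (X i) = 1" "w (X (idx m)) = 1"
      using X i idx_less by (simp_all add: eigensys_def)
    ultimately show False by auto
  qed
  ultimately show ?thesis by simp
qed

text \<open>A limit of normalised eigenvectors violating the claim would be a multiple of the signing, on which the
  first-order term in \<open>Sf y\<close> is governed by \<open>B\<close>.\<close>
lemma near_resonance:
  assumes m: "0 < m" and B0: "B \<noteq> 0"
  shows "\<exists>d>0. \<forall>y. \<bar>y - real m * pi\<bar> < d \<and> (-1) ^ m * Sf y * B > 0 \<longrightarrow> (-1) ^ m * ev y (idx m) < 0"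
proof (rule ccontr)
  let ?s = "(-1 :: real) ^ m"
  have ss: "?s * ?s = 1" using neg1_pow_cases[of m] by auto
  assume contra: "\<not> ?thesis"
  have "\<exists>y. \<bar>y - real m * pi\<bar> < 1 / real (Suc n) \<and> ?s * Sf y * B > 0 \<and> ?s * ev y (idx m) \<ge> 0" for n
  proof -
    have "1 / real (Suc n) > 0" by simp
    then show ?thesis using contra by (meson not_less)
  qed
  then obtain y where y: "\<And>n. \<bar>y n - real m * pi\<bar> < 1 / real (Suc n)" "\<And>n. ?s * Sf (y n) * B > 0"
    "\<And>n. ?s * ev (y n) (idx m) \<ge> 0" by metis
  have ylim: "y \<longlonglongrightarrow> real m * pi"
  proof (rule LIM_zero_cancel, rule Lim_null_comparison)
    show "\<forall>\<^sub>F n in sequentially. norm (y n - real m * pi) \<le> 1 / real (Suc n)"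
      using y(1) by (simp add: less_imp_le)
    show "(\<lambda>n. 1 / real (Suc n)) \<longlonglongrightarrow> 0" using LIMSEQ_inverse_real_of_nat by (simp add: inverse_eq_divide)
  qed
  have Clim: "(\<lambda>n. Cf (y n)) \<longlonglongrightarrow> ?s"
    using isCont_tendsto_compose[OF isCont_Cf ylim] by (simp add: Cf_multiple_pi)
  have Slim: "(\<lambda>n. Sf (y n)) \<longlonglongrightarrow> 0"
    using isCont_tendsto_compose[OF isCont_Sf ylim] m by (simp add: Sf_multiple_pi)
  have "\<exists>x. (\<forall>v\<ge>p. x v = 0) \<and> w x = 1 \<and> ?s * Q (Cf (y n)) (Sf (y n)) x \<ge> 0" for n
  proof -
    obtain Z where Z: "eigen (Cf (y n)) (Sf (y n)) (ev (y n)) Z"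
      using ev_eigensys by blast
    define x where "x v = (if v < p then Z (idx m) v else 0)" for v
    have wx: "w x = 1"
    proof -
      have "w x = w (Z (idx m))" by (rule wip_cong) (auto simp: x_def)
      then show ?thesis using Z idx_less by (simp add: eigensys_def)
    qed
    have "Q (Cf (y n)) (Sf (y n)) x = bform p (robin_matrix p E b (Cf (y n)) (Sf (y n))) (Z (idx m)) (Z (idx m))"
      unfolding bform_robin_matrix[OF tree, symmetric] by (rule bform_cong) (auto simp: x_def)
    also have "\<dots> = ev (y n) (idx m) * w (Z (idx m))"
      by (rule bform_eigen) (use Z idx_less in \<open>simp add: eigensys_def\<close>)
    also have "\<dots> = ev (y n) (idx m)" using Z idx_less by (simp add: eigensys_def)
    finally have "?s * Q (Cf (y n)) (Sf (y n)) x \<ge> 0" using y(3)[of n] by simp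
    moreover have "\<forall>v\<ge>p. x v = 0" by (simp add: x_def)
    ultimately show ?thesis using wx by blast
  qed
  then obtain x where x: "\<And>n v. v \<ge> p \<Longrightarrow> x n v = 0" "\<And>n. w (x n) = 1"
    "\<And>n. ?s * Q (Cf (y n)) (Sf (y n)) (x n) \<ge> 0" by metis
  define K where "K = {x. (\<forall>v\<ge>p. x v = 0) \<and> w x = 1}"
  have "seq_compact K"
    unfolding K_def by (intro compact_imp_seq_compact compact_wsphere degr_pos)
  moreover have "\<forall>n. x n \<in> K" using x by (simp add: K_def)
  ultimately obtain l r where l: "l \<in> K" and r: "strict_mono r" and lim: "(x \<circ> r) \<longlonglongrightarrow> l"
    unfolding seq_compact_def by blast
  have coord: "(\<lambda>n. x (r n) v) \<longlonglongrightarrow> l v" for v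
    using continuous_on_tendsto_compose[OF continuous_on_coord[of UNIV v] lim] by (simp add: o_def)
  have yr: "(\<lambda>n. y (r n)) \<longlonglongrightarrow> real m * pi" and Cr: "(\<lambda>n. Cf (y (r n))) \<longlonglongrightarrow> ?s" and Sr: "(\<lambda>n. Sf (y (r n))) \<longlonglongrightarrow> 0"
    using LIMSEQ_subseq_LIMSEQ[OF _ r] ylim Clim Slim by (auto simp: o_def)
  have blim: "(\<lambda>n. \<Sum>v<p. b v * (x (r n) v)\<^sup>2) \<longlonglongrightarrow> (\<Sum>v<p. b v * (l v)\<^sup>2)"
    by (intro tendsto_intros coord)
  have ineq: "0 \<le> (1 - ?s * Cf (y n)) - (\<Sum>j<p-1. (x n (snd (E j)) - ?s * x n (fst (E j)))\<^sup>2)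
     - ?s * Sf (y n) * (\<Sum>v<p. b v * (x n v)\<^sup>2)" for n
    using x(3)[of n] unfolding robin_form_signed[OF neg1_pow_cases[of m]] x(2) by simp
  have "(\<lambda>n. (1 - ?s * Cf (y (r n))) - (\<Sum>j<p-1. (x (r n) (snd (E j)) - ?s * x (r n) (fst (E j)))\<^sup>2)
     - ?s * Sf (y (r n)) * (\<Sum>v<p. b v * (x (r n) v)\<^sup>2))
     \<longlonglongrightarrow> (1 - ?s * ?s) - (\<Sum>j<p-1. (l (snd (E j)) - ?s * l (fst (E j)))\<^sup>2)
     - ?s * 0 * (\<Sum>v<p. b v * (l v)\<^sup>2)"
    by (intro tendsto_intros coord Cr Sr blim)
  then have "0 \<le> (1 - ?s * ?s) - (\<Sum>j<p-1. (l (snd (E j)) - ?s * l (fst (E j)))\<^sup>2)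
     - ?s * 0 * (\<Sum>v<p. b v * (l v)\<^sup>2)"
    by (rule LIMSEQ_le_const) (use ineq in blast)
  then have "(\<Sum>j<p-1. (l (snd (E j)) - ?s * l (fst (E j)))\<^sup>2) \<le> 0" using ss by simp
  then have "\<forall>j\<in>{..<p-1}. (l (snd (E j)) - ?s * l (fst (E j)))\<^sup>2 = 0"
    by (subst sum_nonneg_eq_0_iff[symmetric]) (simp_all add: sum_nonneg order_antisym)
  then have edge: "\<forall>j<p-1. l (snd (E j)) = ?s * l (fst (E j))" by simp
  obtain u where u: "signing m u" using signing_exists by blast
  define k where "k = l 0 * u 0"
  have lk: "l v = k * u v" if "v < p" for v using signed_const[OF u edge that] by (simp add: k_def)
  have "w l = k\<^sup>2 * w u"
    unfolding wip_scale2[symmetric] by (rule wip_cong) (use lk in auto)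
  moreover have "w l = 1" using l by (simp add: K_def)
  ultimately have k0: "k \<noteq> 0" by auto
  have lB: "(\<Sum>v<p. b v * (l v)\<^sup>2) = k\<^sup>2 * B"
    unfolding signing_form(2)[OF u, symmetric] sum_distrib_left
    by (intro sum.cong refl) (use lk in \<open>simp add: power_mult_distrib\<close>)
  \<comment> \<open>The decisive comparison of orders: \<open>1 - ?C\<close> is at most
    \<open>y\<^sup>2 * ?S\<^sup>2\<close>, quadratic in \<open>?S\<close>, whereas the Robin term is
    linear. After division by \<open>?S\<close>, whose sign is that of \<open>B\<close>, only the
    Robin term survives the limit, which gives \<open>k\<^sup>2 * B\<^sup>2 \<le> 0\<close>.\<close>
  have ev: "\<forall>\<^sub>F n in sequentially. 0 \<le> B * ((y (r n))\<^sup>2 * (?s * Sf (y (r n))) - (\<Sum>v<p. b v * (x (r n) v)\<^sup>2))"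
  proof -
    have "(\<lambda>n. ?s * Cf (y (r n))) \<longlonglongrightarrow> ?s * ?s" by (intro tendsto_intros Cr)
    then have "(\<lambda>n. ?s * Cf (y (r n))) \<longlonglongrightarrow> 1" unfolding ss .
    then have "\<forall>\<^sub>F n in sequentially. 0 < ?s * Cf (y (r n))"
      by (rule order_tendstoD(1)) simp
    moreover have "\<forall>\<^sub>F n in sequentially. 0 < y (r n)"
      using order_tendstoD(1)[OF yr, of 0] m by simp
    ultimately show ?thesis
    proof eventually_elim
      case (elim n)
      let ?S = "?s * Sf (y (r n))" and ?C = "?s * Cf (y (r n))"
      have "?C * ?C = Cf (y (r n)) * Cf (y (r n))" "?S * ?S = Sf (y (r n)) * Sf (y (r n))"
        using neg1_pow_cases[of m] by auto
      then have sq: "(1 - ?C) * (1 + ?C) = (y (r n))\<^sup>2 * (?S * ?S)"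
        using Cf_sq[of "y (r n)"] elim(2) by (simp add: power2_eq_square algebra_simps)
      have "?C \<le> 1"
        using elim(2) neg1_pow_cases[of m] cos_le_one[of "y (r n)"] cos_ge_minus_one[of "y (r n)"]
        by (auto simp: Cf_def)
      then have "(1 - ?C) * 1 \<le> (1 - ?C) * (1 + ?C)" using elim(1) by (intro mult_left_mono) simp_all
      then have "1 - ?C \<le> (y (r n))\<^sup>2 * (?S * ?S)" using sq by simp
      moreover have "(\<Sum>j<p-1. (x (r n) (snd (E j)) - ?s * x (r n) (fst (E j)))\<^sup>2) \<ge> 0" by (simp add: sum_nonneg)
      ultimately have "0 \<le> ?S * ((y (r n))\<^sup>2 * ?S - (\<Sum>v<p. b v * (x (r n) v)\<^sup>2))"
        using ineq[of "r n"] by (simp add: algebra_simps)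
      moreover have "0 < ?S * B" using y(2)[of "r n"] by simp
      ultimately show ?case
        by (smt (verit) mult_less_0_iff mult_pos_pos zero_le_mult_iff zero_less_mult_iff)
    qed
  qed
  have "(\<lambda>n. B * ((y (r n))\<^sup>2 * (?s * Sf (y (r n))) - (\<Sum>v<p. b v * (x (r n) v)\<^sup>2)))
     \<longlonglongrightarrow> B * ((real m * pi)\<^sup>2 * (?s * 0) - k\<^sup>2 * B)"
    using blim unfolding lB by (intro tendsto_intros yr Sr)
  then have "0 \<le> B * ((real m * pi)\<^sup>2 * (?s * 0) - k\<^sup>2 * B)"
    by (rule tendsto_lowerbound[OF _ ev]) simp
  then have "(k * B) * (k * B) \<le> 0" by (simp add: power2_eq_square algebra_simps)
  then show False using k0 B0 by (metis mult_eq_0_iff not_square_less_zero order_le_less)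
qed

end

section \<open>Counting zeros\<close>

lemma cell_disjoint: "y \<in> cell m \<Longrightarrow> y \<in> cell n \<Longrightarrow> m = n"
proof -
  have *: False if "y \<in> cell m" "y \<in> cell n" "m < n" for m n
  proof -
    have "y < real (Suc m) * pi" using that(1) by (auto simp: cell_def split: if_splits)
    moreover have "real (Suc m) * pi \<le> real n * pi" using that(3) by (intro mult_right_mono) auto
    moreover have "real n * pi < y" using that(2,3) by (auto simp: cell_def)
    ultimately show False by linarith
  qed
  then show "y \<in> cell m \<Longrightarrow> y \<in> cell n \<Longrightarrow> m = n" by (metis linorder_neqE_nat)
qed

lemma multiple_pi_notin_cell:
  assumes "0 < k" shows "real k * pi \<notin> cell m"
proof
  assume y: "real k * pi \<in> cell m"
  show False
  proof (cases "m = 0")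
    case True
    then have "real k * pi < 1 * pi" using y by (simp add: cell_def)
    then have "real k < 1" by (simp only: mult_less_cancel_right_pos[OF pi_gt_zero])
    then show False using assms by simp
  next
    case False
    then have "real m * pi < real k * pi" "real k * pi < real (Suc m) * pi" using y by (auto simp: cell_def)
    then have "real m < real k" "real k < real (Suc m)"
      by (simp_all only: mult_less_cancel_right_pos[OF pi_gt_zero])
    then show False by simp
  qed
qed

lemma cell_cases: "(\<exists>m. y \<in> cell m) \<or> (\<exists>k>0. y = real k * pi)"
proof (cases "y < pi")
  case True
  then show ?thesis by (intro disjI1 exI[of _ 0]) (simp add: cell_def)
next
  case False
  define k where "k = nat \<lfloor>y / pi\<rfloor>"
  have "y / pi \<ge> 1" using False by simp
  then have fl: "\<lfloor>y / pi\<rfloor> \<ge> 1" by (simp add: le_floor_iff)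
  have k: "k > 0" "real k = of_int \<lfloor>y / pi\<rfloor>"
    unfolding k_def using fl by linarith (rule of_nat_nat, use fl in linarith)
  have "real k \<le> y / pi" "y / pi < real k + 1" unfolding k(2) by linarith+
  then have "real k * pi \<le> y" "y < real (Suc k) * pi"
    by (simp_all add: pos_le_divide_eq pos_divide_less_eq add.commute)
  then show ?thesis using k(1) by (cases "y = real k * pi") (auto simp: cell_def intro!: exI[of _ k])
qed

context robin_tree
begin

lemma zero_between:
  assumes i: "i < p" and ac: "a < c" and sgn: "ev a i * ev c i < 0"
    and sub: "\<And>y. a < y \<Longrightarrow> y < c \<Longrightarrow> y \<in> cell m"
  shows "\<exists>y\<in>cell m. ev y i = 0"
  using ev_IVT[OF i ac sgn] sub by blast

lemma ev_pi: "i < p \<Longrightarrow> ev pi i = theta i + 1"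
  using ev_multiple_pi[of i 1] by simp

lemma far_less_pi: "- (2 * beta + 2) < pi"
  using beta_nonneg pi_gt_zero by linarith

text \<open>The curve is negative far to the left and equals \<open>theta i + 1\<close> at pi. Index
  0 is excluded because there this value is 0; the top index is included and supplies member 0 of
  the sequence with label 1.\<close>

lemma zero_cell_0:
  assumes i: "i < p" "i \<noteq> 0"
  shows "\<exists>y\<in>cell 0. ev y i = 0"
proof (rule zero_between[OF i(1) far_less_pi])
  have "- theta i < 1" using theta_strict[of i 1] i by (simp add: idx_def)
  then show "ev (- (2 * beta + 2)) i * ev pi i < 0"
    using ev_negative_far[OF i(1)] unfolding ev_pi[OF i(1)] by (intro mult_neg_pos) auto
qed (simp add: cell_def)

text \<open>Since \<open>theta i\<close> lies strictly between -1 and 1,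
  \<open>theta i - (-1) ^ m\<close> changes sign from one multiple of pi to the next.\<close>

lemma zero_interior:
  assumes i: "0 < i" "i < p - 1"
  shows "\<exists>y\<in>cell m. ev y i = 0"
proof (cases "m = 0")
  case True
  then show ?thesis using zero_cell_0[of i] i by simp
next
  case False
  have ip: "i < p" using i by simp
  show ?thesis
  proof (rule zero_between[OF ip, of "real m * pi" "real (Suc m) * pi"])
    have 1: "theta i < 1" "- theta i < 1"
      using theta_strict[of i 0] theta_strict[of i 1] ip i by (simp_all add: idx_def)
    show "ev (real m * pi) i * ev (real (Suc m) * pi) i < 0"
      using 1 False unfolding ev_multiple_pi[OF ip zero_less_Suc]
      by (cases "even m") (auto simp: ev_multiple_pi[OF ip] mult_less_0_iff)
  qed (use False in \<open>auto simp: cell_def\<close>)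
qed

text \<open>The curve is 0 at the left end of the cell, so that end gives no sign. A nearby point
  \<open>y0\<close> does: there the curve has left 0 in the direction opposite to its value
  \<open>2 * (-1) ^ k\<close> at the right end.\<close>

lemma zero_right:
  assumes k: "0 < k" and B: "B > 0"
  shows "\<exists>y\<in>cell k. ev y (idx k) = 0"
proof -
  obtain d where d: "d > 0" "\<And>y. \<bar>y - real k * pi\<bar> < d \<Longrightarrow> (-1) ^ k * Sf y * B > 0 \<Longrightarrow> (-1) ^ k * ev y (idx k) < 0"
    using near_resonance[OF k] B by auto
  define y0 where "y0 = real k * pi + min (d / 2) (pi / 2)"
  have y0: "real k * pi < y0" "y0 < real (Suc k) * pi" "\<bar>y0 - real k * pi\<bar> < d"
    using d(1) by (auto simp: y0_def min_def algebra_simps)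
  then have c: "y0 \<in> cell k" using k by (simp add: cell_def)
  have "(-1) ^ k * ev y0 (idx k) < 0"
    using d(2)[OF y0(3)] Sf_sign[OF c] B by simp
  moreover have "ev (real (Suc k) * pi) (idx k) = 2 * (-1) ^ k"
    unfolding ev_multiple_pi[OF idx_less zero_less_Suc] theta_idx by simp
  ultimately have "ev y0 (idx k) * ev (real (Suc k) * pi) (idx k) < 0"
    by (simp add: mult.commute mult.left_commute)
  then show ?thesis
    by (rule zero_between[OF idx_less y0(2)]) (use y0 k in \<open>auto simp: cell_def\<close>)
qed

lemma zero_left:
  assumes B: "B < 0"
  shows "\<exists>y\<in>cell k. ev y (idx (Suc k)) = 0"
proof -
  let ?i = "idx (Suc k)"
  obtain d where d: "d > 0" "\<And>y. \<bar>y - real (Suc k) * pi\<bar> < d \<Longrightarrow> (-1) ^ Suc k * Sf y * B > 0 \<Longrightarrow> (-1) ^ Suc k * ev y ?i < 0"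
    using near_resonance[of "Suc k"] B by auto
  define y0 where "y0 = real (Suc k) * pi - min (d / 2) (pi / 2)"
  have y0: "real k * pi < y0" "y0 < real (Suc k) * pi" "\<bar>y0 - real (Suc k) * pi\<bar> < d"
    using d(1) by (auto simp: y0_def min_def algebra_simps)
  then have c: "y0 \<in> cell k" by (cases "k = 0") (auto simp: cell_def)
  have "(-1) ^ Suc k * Sf y0 * B > 0"
    using Sf_sign[OF c] B by (simp add: mult_pos_neg)
  then have neg: "(-1) ^ Suc k * ev y0 ?i < 0" using d(2)[OF y0(3)] by simp
  \<comment> \<open>The left end of the bracket is the previous multiple of pi, or the far negative
    point if \<open>k = 0\<close>.\<close>
  obtain a where a: "a < y0" "(-1) ^ Suc k * ev a ?i > 0" "\<And>y. a < y \<Longrightarrow> y < y0 \<Longrightarrow> y \<in> cell k"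
  proof (cases "k = 0")
    case True
    show thesis
    proof (rule that[of "- (2 * beta + 2)"])
      show "- (2 * beta + 2) < y0" using beta_nonneg y0(1) True by simp
      show "(-1) ^ Suc k * ev (- (2 * beta + 2)) ?i > 0" using ev_negative_far[OF idx_less] True by simp
    qed (use y0 True in \<open>auto simp: cell_def\<close>)
  next
    case False
    show thesis
    proof (rule that[of "real k * pi"])
      have "ev (real k * pi) ?i = 2 * (-1) ^ Suc k"
        using False by (subst ev_multiple_pi[OF idx_less]) (simp_all add: theta_idx)
      then show "(-1) ^ Suc k * ev (real k * pi) ?i > 0" using neg1_pow_cases[of k] by auto
    qed (use y0 False in \<open>auto simp: cell_def\<close>)
  qed
  have "((-1) ^ Suc k * ev a ?i) * ((-1) ^ Suc k * ev y0 ?i) < 0"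
    using a(2) neg by (rule mult_pos_neg)
  then have "ev a ?i * ev y0 ?i < 0" using neg1_pow_cases[of k] by auto
  then show ?thesis by (rule zero_between[OF idx_less a(1)]) (rule a(3))
qed

lemma no_zero_right:
  assumes k: "0 < k" and B: "B \<le> 0" and y: "y \<in> cell k"
  shows "ev y (idx k) \<noteq> 0"
proof -
  have "(-1) ^ k * Sf y * B \<le> 0" using Sf_sign[OF y] B by (intro mult_nonneg_nonpos) auto
  moreover have "(-1) ^ k * Cf y < 1"
    using Cf_less_1[OF y k] Cf_gt_minus_1[OF y] by (cases "even k") auto
  ultimately show ?thesis using ev_extremal_sign by force
qed

lemma no_zero_left:
  assumes B: "B \<ge> 0" and y: "y \<in> cell k"
  shows "ev y (idx (Suc k)) \<noteq> 0"
proof -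
  have "(-1) ^ Suc k * Sf y \<le> 0" using Sf_sign[OF y] by simp
  then have "(-1) ^ Suc k * Sf y * B \<le> 0" using B by (rule mult_nonpos_nonneg)
  moreover have "(-1) ^ Suc k * Cf y < 1"
    using Cf_less_1[OF y] Cf_gt_minus_1[OF y] by (cases "even k") (auto elim: oddE)
  ultimately show ?thesis using ev_extremal_sign[of "Suc k" y] by force
qed

text \<open>The complete list of cells and curves with a zero. The two extremal curves are those
  resonant at the left end and at the right end of cell \<open>m\<close>. For \<open>m = 0\<close>
  there is no condition on \<open>B\<close> in the first case, as cell 0 has no resonance on its
  left.\<close>

definition has_zero :: "nat \<Rightarrow> nat \<Rightarrow> bool" where
  "has_zero m i \<longleftrightarrow> (0 < i \<and> i < p - 1) \<or> (i = idx m \<and> (m = 0 \<or> B > 0)) \<or> (i = idx (Suc m) \<and> B < 0)"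

lemma has_zero_less: "has_zero m i \<Longrightarrow> i < p"
  using idx_less by (auto simp: has_zero_def)

lemma has_zero_iff:
  assumes i: "i < p"
  shows "(\<exists>y\<in>cell m. ev y i = 0) \<longleftrightarrow> has_zero m i"
proof
  assume "has_zero m i"
  then consider "0 < i" "i < p - 1" | "i = idx m" "m = 0" | "i = idx m" "0 < m" "B > 0" | "i = idx (Suc m)" "B < 0"
    unfolding has_zero_def by blast
  then show "\<exists>y\<in>cell m. ev y i = 0"
  proof cases
    case 2
    then show ?thesis using zero_cell_0[OF idx_less[of 0]] p2 by (simp add: idx_def)
  qed (use zero_interior zero_right zero_left in blast)+
next
  assume "\<exists>y\<in>cell m. ev y i = 0"
  then obtain y where y: "y \<in> cell m" "ev y i = 0" by auto
  have "0 < i \<and> i < p - 1 \<or> i = idx m \<or> i = idx (Suc m)" using i by (auto simp: idx_def)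
  then show "has_zero m i"
    unfolding has_zero_def using y no_zero_right[of m y] no_zero_left[of y m] by force
qed

section \<open>Matching zeros of the curves with labels of the sequences\<close>

definition rho :: "nat \<Rightarrow> nat \<Rightarrow> real" where
  "rho m i = (THE y. y \<in> cell m \<and> ev y i = 0)"

lemma rho:
  assumes "has_zero m i"
  shows "rho m i \<in> cell m" "ev (rho m i) i = 0"
proof -
  obtain y where "y \<in> cell m \<and> ev y i = 0" using has_zero_iff[OF has_zero_less[OF assms]] assms by blast
  then have "rho m i \<in> cell m \<and> ev (rho m i) i = 0"
    unfolding rho_def
    by (rule theI[where P = "\<lambda>y. y \<in> cell m \<and> ev y i = 0"]) (use ev_zero_unique has_zero_less[OF assms] \<open>y \<in> cell m \<and> ev y i = 0\<close> in blast)
  then show "rho m i \<in> cell m" "ev (rho m i) i = 0" by auto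
qed

lemma ev_zero_iff_rho:
  assumes y: "y \<in> cell m" and i: "i < p"
  shows "ev y i = 0 \<longleftrightarrow> has_zero m i \<and> y = rho m i"
  using rho[of m i] has_zero_iff[OF i, of m] ev_zero_unique[OF y _ i] y by blast

text \<open>To each multiple \<open>k * pi\<close> belongs exactly one further eigenvalue: the sign of \<open>B\<close> decides whether
  it lies to the right, to the left, or at the multiple itself.\<close>
definition kappa :: "nat \<Rightarrow> real" where
  "kappa k = (if B = 0 then real k * pi else if B > 0 then rho k (idx k) else rho (k - 1) (idx k))"

text \<open>\<open>slot\<close> sends the label of a sequence member to its cell and its eigenvalue curve, and \<open>label\<close>
  is the inverse map. Labels that are \<open>resonant\<close> have no slot: \<open>slot\<close> returns a junk value for them.\<close>
definition slot :: "int \<times> nat \<Rightarrow> nat \<times> nat" where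
  "slot = (\<lambda>(l, k). if l = 1 then (if k = 0 then (0, p - 1) else if B > 0 then (k, idx k) else (k - 1, idx k))
     else if l > 0 then (2 * k, nat l - 1) else (2 * k - 1, nat (- l) - 1))"

definition label :: "nat \<times> nat \<Rightarrow> int \<times> nat" where
  "label = (\<lambda>(m, i). if 0 < i \<and> i < p - 1
     then (if even m then (int (Suc i), m div 2) else (- int (Suc i), Suc m div 2))
     else if i = idx m then (1, m) else (1, Suc m))"

text \<open>The number \<open>2 pi k + arccos z\<close> lies in cell \<open>2 * k\<close> and
  \<open>2 pi k - arccos z\<close> in cell \<open>2 * k - 1\<close>, which is why label
  \<open>-l\<close> starts at \<open>k = 1\<close>. Curve indices start at 0, so label
  \<open>l\<close> uses curve \<open>l - 1\<close>.\<close>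

definition val :: "int \<times> nat \<Rightarrow> real" where
  "val = (\<lambda>(l, k). if l = 1 then (if k = 0 then rho 0 (p - 1) else kappa k)
     else if l > 0 then rho (2 * k) (nat l - 1) else rho (2 * k - 1) (nat (- l) - 1))"

definition resonant :: "int \<times> nat \<Rightarrow> bool" where
  "resonant q \<longleftrightarrow> fst q = 1 \<and> 0 < snd q \<and> B = 0"

lemma slot_props:
  assumes q: "q \<in> seq_index p" "\<not> resonant q"
  shows "has_zero (fst (slot q)) (snd (slot q))" "label (slot q) = q" "val q = rho (fst (slot q)) (snd (slot q))"
proof -
  obtain l k where lk: "q = (l, k)" by force
  consider (one0) "l = 1" "k = 0" | (pos) "l = 1" "k > 0" "B > 0" | (neg) "l = 1" "k > 0" "B < 0"
    | (up) n where "l = int n" "2 \<le> n" "n \<le> p - 1" | (down) n where "l = - int n" "2 \<le> n" "n \<le> p - 1" "1 \<le> k"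
    using q by (auto simp: lk seq_index_def resonant_def) force
  then have "has_zero (fst (slot q)) (snd (slot q)) \<and> label (slot q) = q \<and> val q = rho (fst (slot q)) (snd (slot q))"
  proof cases
    case one0
    then show ?thesis using p2 by (simp add: lk slot_def label_def val_def has_zero_def idx_def)
  next
    case pos
    then show ?thesis using p2 by (auto simp: lk slot_def label_def val_def has_zero_def idx_def kappa_def)
  next
    case neg
    then obtain k' where "k = Suc k'" by (cases k) auto
    then show ?thesis using neg p2 by (auto simp: lk slot_def label_def val_def has_zero_def idx_def kappa_def)
  next
    case up
    then show ?thesis using p2 by (auto simp: lk slot_def label_def val_def has_zero_def)
  next
    case down
    then obtain k' where "k = Suc k'" by (cases k) auto
    then show ?thesis using down p2 by (auto simp: lk slot_def label_def val_def has_zero_def)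
  qed
  then show "has_zero (fst (slot q)) (snd (slot q))" "label (slot q) = q" "val q = rho (fst (slot q)) (snd (slot q))"
    by auto
qed

lemma label_props:
  assumes h: "has_zero m i"
  shows "label (m, i) \<in> seq_index p" "\<not> resonant (label (m, i))" "slot (label (m, i)) = (m, i)"
proof -
  consider (mid) "0 < i" "i < p - 1" | (here) "i = idx m" "m = 0 \<or> B > 0" | (up) "i = idx (Suc m)" "B < 0"
    using h by (auto simp: has_zero_def)
  then have "label (m, i) \<in> seq_index p \<and> \<not> resonant (label (m, i)) \<and> slot (label (m, i)) = (m, i)"
  proof cases
    case mid
    show ?thesis
    proof (cases "even m")
      case True
      then obtain n where n: "m = 2 * n" by (elim evenE)
      have "(int (Suc i), n) \<in> seq_index p" unfolding seq_index_def
        by (rule UnI1, rule UnI2) (use mid in \<open>auto intro!: exI[of _ "Suc i"]\<close>)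
      then show ?thesis using mid by (simp add: n label_def slot_def resonant_def)
    next
      case False
      then obtain n where n: "m = 2 * n + 1" by (elim oddE)
      have "(- int (Suc i), Suc n) \<in> seq_index p" unfolding seq_index_def by (rule UnI2) (use mid in \<open>auto intro!: exI[of _ "Suc i"]\<close>)
      then show ?thesis using mid by (simp add: n label_def slot_def resonant_def)
    qed
  next
    case here
    have "label (m, i) = (1, m)" using idx_interior[of i m] here by (auto simp: label_def)
    then show ?thesis using here by (auto simp: seq_index_def slot_def resonant_def idx_def)
  next
    case up
    have "label (m, i) = (1, Suc m)" using idx_interior[of i "Suc m"] idx_Suc_neq[of m] up by (auto simp: label_def)
    then show ?thesis using up by (auto simp: seq_index_def slot_def resonant_def)
  qed
  then show "label (m, i) \<in> seq_index p" "\<not> resonant (label (m, i))" "slot (label (m, i)) = (m, i)" by auto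
qed

lemma val_resonant: "resonant q \<Longrightarrow> val q = real (snd q) * pi"
  by (auto simp: resonant_def val_def kappa_def split: prod.splits)

text \<open>Several curves may vanish at the same \<open>y\<close>. Within one cell
  \<open>slot\<close> and \<open>label\<close> match these curves with the labels of value
  \<open>y\<close>, so multiplicities agree at crossings as well.\<close>

lemma val_count_cell:
  assumes y: "y \<in> cell m"
  shows "finite {q \<in> seq_index p. val q = y}"
    and "card {q \<in> seq_index p. val q = y} = card {i. i < p \<and> ev y i = 0}"
proof -
  let ?L = "{q \<in> seq_index p. val q = y}" and ?I = "{i. i < p \<and> ev y i = 0}"
  have nonres: "\<not> resonant q" if "q \<in> ?L" for q
  proof
    assume r: "resonant q"
    then have "y = real (snd q) * pi" using val_resonant that by auto
    then show False using multiple_pi_notin_cell[of "snd q" m] y r by (simp add: resonant_def)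
  qed
  have slot: "slot q = (m, snd (slot q))" if "q \<in> ?L" for q
  proof -
    have "y \<in> cell (fst (slot q))"
      using slot_props[OF _ nonres[OF that]] rho(1)[of "fst (slot q)" "snd (slot q)"] that by auto
    then have "fst (slot q) = m" using y cell_disjoint by blast
    then show ?thesis by (metis prod.collapse)
  qed
  have "bij_betw (\<lambda>q. snd (slot q)) ?L ?I"
  proof (rule bij_betw_byWitness[where f' = "\<lambda>i. label (m, i)"])
    show "\<forall>q\<in>?L. label (m, snd (slot q)) = q"
      using slot slot_props(2) nonres by (metis (no_types, lifting) mem_Collect_eq)
    show "\<forall>i\<in>?I. snd (slot (label (m, i))) = i"
      using ev_zero_iff_rho[OF y] label_props(3) by auto
    show "(\<lambda>q. snd (slot q)) ` ?L \<subseteq> ?I"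
    proof (rule image_subsetI)
      fix q assume q: "q \<in> ?L"
      then have qs: "q \<in> seq_index p" by simp
      note sp = slot_props[OF qs nonres[OF q]]
      have "ev (val q) (snd (slot q)) = 0" using rho(2)[OF sp(1)] sp(3) by simp
      then show "snd (slot q) \<in> ?I" using has_zero_less[OF sp(1)] q by simp
    qed
    show "(\<lambda>i. label (m, i)) ` ?I \<subseteq> ?L"
    proof (rule image_subsetI)
      fix i assume "i \<in> ?I"
      then have h: "has_zero m i" "y = rho m i" using ev_zero_iff_rho[OF y] by auto
      note lp = label_props[OF h(1)]
      show "label (m, i) \<in> ?L"
        using lp slot_props(3)[OF lp(1,2)] h(2) by simp
    qed
  qed
  moreover have "finite ?I" by simp
  ultimately show "finite ?L" "card ?L = card ?I"
    using bij_betw_finite bij_betw_same_card by blast+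
qed

text \<open>Members with a slot lie in open cells, which avoid the multiples of pi. What is left
  agrees with the multiplicity 1 or 0 computed at resonance.\<close>

lemma val_count_resonant:
  assumes k: "0 < k"
  shows "{q \<in> seq_index p. val q = real k * pi} = (if B = 0 then {(1, k)} else {})"
proof -
  have "resonant q" if "q \<in> seq_index p" "val q = real k * pi" for q
  proof (rule ccontr)
    assume "\<not> resonant q"
    then have "real k * pi \<in> cell (fst (slot q))"
      using slot_props[OF that(1)] rho(1)[of "fst (slot q)" "snd (slot q)"] that by auto
    then show False using multiple_pi_notin_cell[OF k] by blast
  qed
  then have only: "q = (1, k) \<and> B = 0" if "q \<in> seq_index p" "val q = real k * pi" for q
  proof -
    have r: "resonant q" using \<open>\<And>q. q \<in> seq_index p \<Longrightarrow> val q = real k * pi \<Longrightarrow> resonant q\<close> that by blast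
    then have "real (snd q) * pi = real k * pi" using val_resonant that(2) by simp
    then have "snd q = k" by simp
    then show ?thesis using r by (cases q) (auto simp: resonant_def)
  qed
  have mem: "(1, k) \<in> seq_index p" by (simp add: seq_index_def)
  have val1: "val (1, k) = real k * pi" if "B = 0" using that k by (simp add: val_def kappa_def)
  show ?thesis
  proof (cases "B = 0")
    case True
    have "{q \<in> seq_index p. val q = real k * pi} = {(1, k)}"
      using only mem val1[OF True] by blast
    then show ?thesis using True by simp
  next
    case False
    have "{q \<in> seq_index p. val q = real k * pi} = {}" using only False by blast
    then show ?thesis using False by simp
  qed
qed

end

section \<open>The polynomial psi\<close>

lemma det_diagonal_mat:
  fixes f :: "nat \<Rightarrow> 'a::comm_ring_1"
  shows "Determinant.det (Matrix.mat n n (\<lambda>(i, k). if i = k then f i else 0)) = (\<Prod>i<n. f i)"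
proof -
  let ?M = "Matrix.mat n n (\<lambda>(i, k). if i = k then f i else 0)"
  have "Determinant.det ?M = prod_list (diag_mat ?M)"
    by (rule det_upper_triangular[of _ n]) auto
  also have "diag_mat ?M = map f [0..<n]"
    unfolding diag_mat_def by (rule map_cong) auto
  also have "prod_list (map f [0..<n]) = (\<Prod>i<n. f i)"
    using prod.distinct_set_conv_list[of "[0..<n]" f] by (simp add: atLeast0LessThan)
  finally show ?thesis .
qed

text \<open>Passage from the Leibniz sum to a determinant over the polynomial ring, in order to use
  multiplicativity.\<close>

lemma psi_poly_det:
  "psi_poly p E = Determinant.det (Matrix.mat p p (\<lambda>(i, k). [:adjmat p E i k, - degmat p E i k:]))"
proof -
  let ?M = "Matrix.mat p p (\<lambda>(i, k). [:adjmat p E i k, - degmat p E i k:])"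
  have "Determinant.det ?M = (\<Sum>\<sigma> | \<sigma> permutes {0..<p}. of_int (sign \<sigma>) * (\<Prod>i = 0..<p. ?M $$ (i, \<sigma> i)))"
    by (rule det_def') simp
  also have "\<dots> = psi_poly p E"
    unfolding psi_poly_def atLeast0LessThan
  proof (intro sum.cong refl arg_cong2[of _ _ _ _ "(*)"] prod.cong)
    fix \<sigma> i assume "\<sigma> \<in> {\<sigma>. \<sigma> permutes {..<p}}" "i \<in> {..<p}"
    then have "i < p" "\<sigma> i < p" using permutes_in_image[of \<sigma> "{..<p}" i] by auto
    then show "?M $$ (i, \<sigma> i) = [:adjmat p E i (\<sigma> i), - degmat p E i (\<sigma> i):]" by simp
  qed
  finally show ?thesis by simp
qed

lemma const_poly_sum: "(\<Sum>i\<in>I. [:f i:]) = [:\<Sum>i\<in>I. f i:]"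
  by (induction I rule: infinite_finite_induct) simp_all

lemma index_mult_mat_sum:
  assumes "A \<in> carrier_mat n n" "B \<in> carrier_mat n n" "i < n" "k < n"
  shows "(A * B) $$ (i, k) = (\<Sum>v\<in>{0..<n}. A $$ (i, v) * B $$ (v, k))"
  using assms by (simp add: scalar_prod_def)

text \<open>With the eigenvectors as rows of X, X (A - z D) = diag(th i - z) X D over the
  polynomials. As X D times the transpose of X is the identity, det X is nonzero and
  cancels.\<close>

lemma psi_poly_factor:
  assumes es: "eigensys p (degr p E) (robin_matrix p E b 0 0) th X"
  shows "psi_poly p E = (\<Prod>i<p. [:th i, -1:]) * (\<Prod>i<p. [:degr p E i:])"
proof -
  define P where "P = Matrix.mat p p (\<lambda>(i, k). [:adjmat p E i k, - degmat p E i k:])"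
  define Xm where "Xm = Matrix.mat p p (\<lambda>(i, v). [:X i v:])"
  define D where "D = Matrix.mat p p (\<lambda>(i, k). if i = k then [:degr p E i:] else 0)"
  define Th where "Th = Matrix.mat p p (\<lambda>(i, k). if i = k then [:th i, -1:] else 0)"
  have carrier: "P \<in> carrier_mat p p" "Xm \<in> carrier_mat p p" "D \<in> carrier_mat p p" "Th \<in> carrier_mat p p"
    by (simp_all add: P_def Xm_def D_def Th_def)
  have XD: "(Xm * D) $$ (i, u) = [:X i u * degr p E u:]" if "i < p" "u < p" for i u
  proof -
    have "(Xm * D) $$ (i, u) = (\<Sum>v\<in>{0..<p}. [:X i v:] * (if v = u then [:degr p E v:] else 0))"
      using that by (simp add: Xm_def D_def scalar_prod_def)
    also have "\<dots> = [:X i u * degr p E u:]"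
      using that by (simp add: if_distrib[of "\<lambda>x. _ * x"] sum.delta cong: if_cong)
    finally show ?thesis .
  qed
  have "Xm * P = Th * (Xm * D)"
  proof (rule eq_matI)
    fix i u assume "i < dim_row (Th * (Xm * D))" "u < dim_col (Th * (Xm * D))"
    then have iu: "i < p" "u < p" by (simp_all add: Th_def D_def)
    have prod: "(Xm * P) $$ (i, u) = (\<Sum>v\<in>{0..<p}. [:X i v:] * [:adjmat p E v u, - degmat p E v u:])"
      using iu by (simp add: Xm_def P_def scalar_prod_def)
    have split: "(\<Sum>v\<in>{0..<p}. [:X i v:] * [:adjmat p E v u, - degmat p E v u:])
        = (\<Sum>v<p. [:X i v * adjmat p E v u:]) + [:0, -1:] * (\<Sum>v<p. [:X i v * degmat p E v u:])"
      unfolding sum_distrib_left sum.distrib[symmetric] atLeast0LessThan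
      by (intro sum.cong refl) simp
    have A: "(\<Sum>v<p. X i v * adjmat p E v u) = th i * degr p E u * X i u"
    proof -
      have "(\<Sum>v<p. X i v * adjmat p E v u) = mulv p (robin_matrix p E b 0 0) (X i) u"
        unfolding mulv_def
        by (intro sum.cong refl) (auto simp: robin_matrix_def adjmat_def edge_rel_iff)
      then show ?thesis using es iu by (simp add: eigensys_def)
    qed
    have G: "(\<Sum>v<p. X i v * degmat p E v u) = X i u * degr p E u"
      using iu by (simp add: degmat_def if_distrib[of "\<lambda>x. _ * x"] sum.delta cong: if_cong)
    have 1: "(Xm * P) $$ (i, u) = [:th i * degr p E u * X i u:] + [:0, -1:] * [:X i u * degr p E u:]"
      unfolding prod split const_poly_sum A G ..
    have "(Th * (Xm * D)) $$ (i, u) = (\<Sum>v\<in>{0..<p}. (if i = v then [:th i, -1:] else 0) * ((Xm * D) $$ (v, u)))"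
      unfolding index_mult_mat_sum[OF carrier(4) mult_carrier_mat[OF carrier(2,3)] iu]
      by (intro sum.cong refl) (use iu in \<open>simp add: Th_def\<close>)
    also have "\<dots> = [:th i, -1:] * ((Xm * D) $$ (i, u))"
      using iu by (simp add: if_distrib[of "\<lambda>x. x * _"] sum.delta' cong: if_cong del: index_mult_mat(1))
    also have "\<dots> = [:th i, -1:] * [:X i u * degr p E u:]" by (simp only: XD[OF iu])
    finally show "(Xm * P) $$ (i, u) = (Th * (Xm * D)) $$ (i, u)"
      unfolding 1 by (simp add: algebra_simps)
  qed (simp_all add: Xm_def P_def Th_def D_def)
  then have "Determinant.det (Xm * P) = Determinant.det (Th * (Xm * D))" by simp
  then have eq: "Determinant.det Xm * Determinant.det P = Determinant.det Th * (Determinant.det Xm * Determinant.det D)"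
    using det_mult[OF carrier(2,1)] det_mult[OF carrier(4) mult_carrier_mat[OF carrier(2,3)]] det_mult[OF carrier(2,3)]
    by simp
  have "(Xm * D) * transpose_mat Xm = 1\<^sub>m p"
  proof (rule eq_matI)
    fix i k assume "i < dim_row (1\<^sub>m p :: real poly mat)" "k < dim_col (1\<^sub>m p :: real poly mat)"
    then have ik: "i < p" "k < p" by simp_all
    have "((Xm * D) * transpose_mat Xm) $$ (i, k) = (\<Sum>v\<in>{0..<p}. (Xm * D) $$ (i, v) * [:X k v:])"
      unfolding index_mult_mat_sum[OF mult_carrier_mat[OF carrier(2,3)] carrier(2)[THEN transpose_carrier_mat[THEN iffD2]] ik]
      by (intro sum.cong refl) (use ik in \<open>simp add: Xm_def\<close>)
    also have "\<dots> = (\<Sum>v<p. [:degr p E v * X i v * X k v:])"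
      unfolding atLeast0LessThan by (intro sum.cong refl) (use XD[OF ik(1)] in \<open>simp del: index_mult_mat(1) add: mult_ac\<close>)
    also have "\<dots> = [:wip p (degr p E) (X i) (X k):]"
      unfolding const_poly_sum wip_def ..
    also have "\<dots> = (1\<^sub>m p) $$ (i, k)"
      using es ik by (simp add: eigensys_def one_pCons)
    finally show "((Xm * D) * transpose_mat Xm) $$ (i, k) = (1\<^sub>m p) $$ (i, k)" .
  qed (simp_all add: Xm_def D_def)
  then have "Determinant.det ((Xm * D) * transpose_mat Xm) = 1" by simp
  then have "Determinant.det (Xm * D) * Determinant.det (transpose_mat Xm) = 1"
    using det_mult[OF mult_carrier_mat[OF carrier(2,3)], of "transpose_mat Xm"] carrier(2) by simp
  then have "Determinant.det Xm \<noteq> 0" using det_mult[OF carrier(2,3)] by auto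
  then have "Determinant.det P = Determinant.det Th * Determinant.det D"
    using eq by (simp add: mult.left_commute)
  then show ?thesis
    unfolding psi_poly_det P_def[symmetric] Th_def D_def by (simp only: det_diagonal_mat)
qed

lemma order_prod:
  fixes f :: "'i \<Rightarrow> 'a::idom poly"
  assumes "finite I" "\<And>i. i \<in> I \<Longrightarrow> f i \<noteq> 0"
  shows "order a (\<Prod>i\<in>I. f i) = (\<Sum>i\<in>I. order a (f i))"
  using assms by (induction rule: finite_induct) (simp_all add: order_mult prod_zero_iff)

lemma order_psi_poly:
  assumes tree: "is_tree p E" and es: "eigensys p (degr p E) (robin_matrix p E b 0 0) th X"
  shows "order a (psi_poly p E) = card {i. i < p \<and> th i = a}"
proof -
  have lin: "order a [:t, -1:] = of_bool (t = a)" for t :: real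
  proof -
    have "[:t, -1:] = Polynomial.smult (-1) [:-t, 1:]" by simp
    then have "order a [:t, -1:] = order a [:-t, 1:]" by (simp only: order_smult neg_equal_0_iff_equal one_neq_zero not_False_eq_True)
    also have "\<dots> = of_bool (t = a)"
      using order_power_n_n[of a 1] by (cases "t = a") (auto intro!: order_0I)
    finally show ?thesis .
  qed
  have d: "[:degr p E i:] \<noteq> 0" if "i < p" for i using deg_pos[OF tree that] by simp
  have "order a (\<Prod>i<p. [:degr p E i:]) = (\<Sum>i<p. order a [:degr p E i:])"
    by (rule order_prod) (simp, rule d, simp)
  also have "\<dots> = 0" using deg_pos[OF tree] by (intro sum.neutral ballI order_0I) force
  finally have D: "order a (\<Prod>i<p. [:degr p E i:]) = 0" .
  have "(\<Prod>i<p. [:th i, -1:]) * (\<Prod>i<p. [:degr p E i:]) \<noteq> 0"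
  proof -
    have "deg p E i \<noteq> 0" if "i < p" for i using deg_pos[OF tree that] by simp
    then show ?thesis by auto
  qed
  then have "order a (psi_poly p E) = order a (\<Prod>i<p. [:th i, -1:])"
    unfolding psi_poly_factor[OF es] by (simp add: order_mult D)
  also have "\<dots> = (\<Sum>i<p. of_bool (th i = a))"
    by (subst order_prod) (simp_all add: lin del: sum_of_bool_eq)
  also have "\<dots> = card {i. i < p \<and> th i = a}"
  proof -
    have "{i. i < p \<and> th i = a} = {..<p} \<inter> {i. th i = a}" by auto
    then show ?thesis by simp
  qed
  finally show ?thesis .
qed

text \<open>Equal fibre sizes mean equal multisets of values, and a multiset has only one sorted
  enumeration.\<close>

lemma sorted_eq_of_card_eq:
  fixes f g :: "nat \<Rightarrow> real"
  assumes f: "\<And>i j. i \<le> j \<Longrightarrow> j < n \<Longrightarrow> f i \<le> f j" and g: "\<And>i j. i \<le> j \<Longrightarrow> j < n \<Longrightarrow> g i \<le> g j"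
    and eq: "\<And>a. card {i. i < n \<and> f i = a} = card {i. i < n \<and> g i = a}" and i: "i < n"
  shows "f i = g i"
proof -
  have count: "count (mset (map h [0..<n])) a = card {i. i < n \<and> h i = a}" for h :: "nat \<Rightarrow> real" and a
  proof -
    have "count (mset (map h [0..<n])) a = length (filter ((=) a) (map h [0..<n]))"
      by (simp only: count_mset count_list_eq_length_filter)
    also have "\<dots> = card {i. i < n \<and> a = map h [0..<n] ! i}"
      unfolding length_filter_conv_card by simp
    also have "{i. i < n \<and> a = map h [0..<n] ! i} = {i. i < n \<and> h i = a}" by auto
    finally show ?thesis .
  qed
  have "mset (map f [0..<n]) = mset (map g [0..<n])"
    by (rule multiset_eqI) (simp only: count eq)
  moreover have "sorted (map f [0..<n])" "sorted (map g [0..<n])"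
    using f g by (auto simp: sorted_iff_nth_mono)
  ultimately have "map f [0..<n] = map g [0..<n]" by (metis properties_for_sort)
  then show ?thesis using i by simp
qed

section \<open>Asymptotics\<close>

context robin_tree
begin

lemma Sf_le_inverse: "0 < y \<Longrightarrow> \<bar>Sf y\<bar> \<le> 1 / y"
  by (simp add: Sf_def divide_right_mono)

text \<open>At a zero, \<open>theta\<close> differs from the cosine by at most
  \<open>beta * \<bar>Sf y\<bar>\<close>, hence by at most \<open>beta / y\<close>. The curve index
  may vary with \<open>k\<close> because the top and the bottom curve alternate at the multiples of
  pi.\<close>

lemma theta_asymptotics:
  assumes y: "filterlim y at_top sequentially"
    and i: "\<And>k. i k < p" and zero: "\<And>k. 0 < k \<Longrightarrow> ev (y k) (i k) = 0"
  shows "(\<lambda>k. theta (i k) - cos (y k)) \<longlonglongrightarrow> 0"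
proof (rule Lim_null_comparison)
  have "\<forall>\<^sub>F k in sequentially. 0 < y k" using y by (simp add: filterlim_at_top_dense)
  then show "\<forall>\<^sub>F k in sequentially. norm (theta (i k) - cos (y k)) \<le> beta * (1 / y k)"
    using eventually_gt_at_top[of 0]
  proof eventually_elim
    case (elim k)
    have "\<bar>theta (i k) - cos (y k)\<bar> \<le> beta * \<bar>Sf (y k)\<bar>"
      using ev_theta[OF i[of k], of "y k"] zero[OF elim(2)] elim(1) by (simp add: Cf_def abs_minus_commute)
    also have "\<dots> \<le> beta * (1 / y k)" by (intro mult_left_mono Sf_le_inverse beta_nonneg elim)
    finally show ?case by simp
  qed
  have "((\<lambda>k. inverse (y k)) \<longlongrightarrow> 0) sequentially"
    using filterlim_compose[OF tendsto_inverse_0_at_top[OF filterlim_ident] y] by simp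
  then show "(\<lambda>k. beta * (1 / y k)) \<longlonglongrightarrow> 0"
    using tendsto_mult_right_zero[of "\<lambda>k. inverse (y k)" sequentially beta] by (simp add: inverse_eq_divide)
qed

text \<open>On the interval from 0 to pi the cosine has the continuous inverse arccos; the range
  condition is only eventual because first members may be irregular.\<close>

lemma arccos_limit:
  assumes ev_t: "\<forall>\<^sub>F k in sequentially. 0 \<le> t k \<and> t k \<le> pi" and "(\<lambda>k. c - cos (t k)) \<longlonglongrightarrow> 0"
    and c: "-1 \<le> c" "c \<le> 1"
  shows "t \<longlonglongrightarrow> arccos c"
proof -
  have "(\<lambda>k. c - (c - cos (t k))) \<longlonglongrightarrow> c - 0" by (intro tendsto_intros assms(2))
  then have "(\<lambda>k. cos (t k)) \<longlonglongrightarrow> c" by simp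
  then have "(\<lambda>k. arccos (cos (t k))) \<longlonglongrightarrow> arccos c"
    by (intro continuous_on_tendsto_compose[OF continuous_on_arccos'[of ]]) (use c in \<open>auto intro!: always_eventually\<close>)
  then show ?thesis
  proof (rule Lim_transform_eventually)
    show "\<forall>\<^sub>F k in sequentially. arccos (cos (t k)) = t k"
      using ev_t by eventually_elim (use arccos_cos in auto)
  qed
qed

lemma multiple_pi_at_top: "filterlim (\<lambda>k. real k * pi) at_top sequentially"
  using filterlim_tendsto_pos_mult_at_top[OF tendsto_const pi_gt_zero filterlim_real_sequentially]
  by (simp add: mult.commute)

lemma at_top_of_multiple_pi:
  assumes "\<And>k. 0 < k \<Longrightarrow> real (m k) * pi < y k" "\<And>k. 0 < k \<Longrightarrow> k \<le> m k"
  shows "filterlim y at_top sequentially"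
proof (rule filterlim_at_top_mono[OF multiple_pi_at_top])
  show "\<forall>\<^sub>F k in sequentially. real k * pi \<le> y k"
    using eventually_gt_at_top[of 0]
  proof eventually_elim
    case (elim k)
    have "real k * pi \<le> real (m k) * pi" using assms(2)[OF elim] by (intro mult_right_mono) auto
    then show ?case using assms(1)[OF elim] by linarith
  qed
qed

lemma rho_bounds: "has_zero m i \<Longrightarrow> 0 < m \<Longrightarrow> real m * pi < rho m i \<and> rho m i < real (Suc m) * pi"
  using rho(1)[of m i] by (simp add: cell_def)

lemma interior_bounds: "2 \<le> l \<Longrightarrow> l \<le> p - 1 \<Longrightarrow> has_zero m (l - 1)"
  by (auto simp: has_zero_def)

lemma theta_interior: "2 \<le> l \<Longrightarrow> l \<le> p - 1 \<Longrightarrow> -1 \<le> theta (l - 1) \<and> theta (l - 1) \<le> 1"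
proof -
  assume "2 \<le> l" "l \<le> p - 1"
  then have "l - 1 < p" "l - 1 \<noteq> p - 1" "l - 1 \<noteq> 0" using p2 by linarith+
  then show ?thesis using theta_strict[of "l - 1" 0] theta_strict[of "l - 1" 1] by (simp add: idx_def)
qed

lemma val_up_limit:
  assumes l: "2 \<le> l" "l \<le> p - 1"
  shows "(\<lambda>k. val (int l, k) - 2 * pi * real k) \<longlonglongrightarrow> arccos (theta (l - 1))"
proof (rule arccos_limit)
  have period: "2 * pi * real k = 2 * real k * pi" for k by simp
  define y where "y k = val (int l, k)" for k
  have y: "y k = rho (2 * k) (l - 1)" for k using l by (simp add: y_def val_def)
  have z: "ev (y k) (l - 1) = 0" for k unfolding y using rho(2)[OF interior_bounds[OF l]] .
  have b: "real (2 * k) * pi < y k" "y k < real (Suc (2 * k)) * pi" if "0 < k" for k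
    using rho_bounds[OF interior_bounds[OF l], of "2 * k"] that by (simp_all add: y)
  have top: "filterlim y at_top sequentially"
    by (rule at_top_of_multiple_pi[of "\<lambda>k. 2 * k"]) (use b(1) in auto)
  show "\<forall>\<^sub>F k in sequentially. 0 \<le> val (int l, k) - 2 * pi * real k \<and> val (int l, k) - 2 * pi * real k \<le> pi"
    using eventually_gt_at_top[of 0]
  proof eventually_elim
    case (elim k)
    then show ?case using b[of k] by (simp add: y_def[symmetric] algebra_simps)
  qed
  have "cos (val (int l, k) - 2 * pi * real k) = cos (y k)" for k
    unfolding y_def period cos_diff cos_2npi sin_2npi by simp
  then show "(\<lambda>k. theta (l - 1) - cos (val (int l, k) - 2 * pi * real k)) \<longlonglongrightarrow> 0"
    using theta_asymptotics[OF top, of "\<lambda>_. l - 1"] z l by simp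
qed (use theta_interior[OF l] in auto)

lemma val_down_limit:
  assumes l: "2 \<le> l" "l \<le> p - 1"
  shows "(\<lambda>k. 2 * pi * real k - val (- int l, k)) \<longlonglongrightarrow> arccos (theta (l - 1))"
proof (rule arccos_limit)
  have period: "2 * pi * real k = 2 * real k * pi" for k by simp
  define y where "y k = val (- int l, k)" for k
  have y: "y k = rho (2 * k - 1) (l - 1)" for k using l by (simp add: y_def val_def)
  have z: "ev (y k) (l - 1) = 0" for k unfolding y using rho(2)[OF interior_bounds[OF l]] .
  have b: "real (2 * k - 1) * pi < y k" "y k < real (2 * k) * pi" if "0 < k" for k
    using rho_bounds[OF interior_bounds[OF l], of "2 * k - 1"] that by (simp_all add: y Suc_diff_Suc numeral_2_eq_2)
  have top: "filterlim y at_top sequentially"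
    by (rule at_top_of_multiple_pi[of "\<lambda>k. 2 * k - 1"]) (use b(1) in auto)
  show "\<forall>\<^sub>F k in sequentially. 0 \<le> 2 * pi * real k - val (- int l, k) \<and> 2 * pi * real k - val (- int l, k) \<le> pi"
    using eventually_gt_at_top[of 0]
  proof eventually_elim
    case (elim k)
    then show ?case using b[of k] by (simp add: y_def[symmetric] algebra_simps of_nat_diff)
  qed
  have "cos (2 * pi * real k - val (- int l, k)) = cos (y k)" for k
    unfolding y_def period cos_diff cos_2npi sin_2npi by simp
  then show "(\<lambda>k. theta (l - 1) - cos (2 * pi * real k - val (- int l, k))) \<longlonglongrightarrow> 0"
    using theta_asymptotics[OF top, of "\<lambda>_. l - 1"] z l by simp
qed (use theta_interior[OF l] in auto)

text \<open>The distance bound starts at \<open>k = 2\<close>: for \<open>B < 0\<close> and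
  \<open>k = 1\<close> the zero lies in cell 0, which is unbounded to the left.\<close>

lemma kappa_zero:
  assumes B: "B \<noteq> 0" and k: "0 < k"
  shows "ev (kappa k) (idx k) = 0" and "1 < k \<Longrightarrow> \<bar>kappa k - real k * pi\<bar> \<le> pi"
proof -
  have "ev (kappa k) (idx k) = 0 \<and> (1 < k \<longrightarrow> \<bar>kappa k - real k * pi\<bar> \<le> pi)"
  proof (cases "B > 0")
    case True
    have h: "has_zero k (idx k)" using True by (simp add: has_zero_def)
    then show ?thesis
      using rho(2)[OF h] rho_bounds[OF h k] True by (auto simp: kappa_def abs_if algebra_simps)
  next
    case False
    obtain n where n: "k = Suc n" using k by (cases k) auto
    have h: "has_zero n (idx k)" using False B by (simp add: has_zero_def n)
    then show ?thesis
      using rho(2)[OF h] rho_bounds[OF h] False B by (auto simp: kappa_def n abs_if algebra_simps)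
  qed
  then show "ev (kappa k) (idx k) = 0" "1 < k \<Longrightarrow> \<bar>kappa k - real k * pi\<bar> \<le> pi" by auto
qed

text \<open>The side on which \<open>kappa k\<close> lies does not matter:
  \<open>\<bar>theta (idx k) - cos (kappa k)\<bar>\<close> is 1 minus the cosine of the distance to
  \<open>real k * pi\<close>, so the distance tends to \<open>arccos 1 = 0\<close>.\<close>

lemma kappa_limit: "(\<lambda>k. kappa k - real k * pi) \<longlonglongrightarrow> 0"
proof (cases "B = 0")
  case True
  then show ?thesis by (simp add: kappa_def)
next
  case False
  have near: "\<forall>\<^sub>F k in sequentially. \<bar>kappa k - real k * pi\<bar> \<le> pi"
    using eventually_gt_at_top[of 1] by eventually_elim (rule kappa_zero(2)[OF False], simp_all)
  have "filterlim (\<lambda>k. - pi + real k * pi) at_top sequentially"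
    by (rule filterlim_tendsto_add_at_top[OF tendsto_const multiple_pi_at_top])
  then have top: "filterlim kappa at_top sequentially"
    by (rule filterlim_at_top_mono) (use near in \<open>auto elim!: eventually_mono\<close>)
  have "(\<lambda>k. theta (idx k) - cos (kappa k)) \<longlonglongrightarrow> 0"
    by (rule theta_asymptotics[OF top idx_less]) (rule kappa_zero(1)[OF False])
  then have "(\<lambda>k. \<bar>theta (idx k) - cos (kappa k)\<bar>) \<longlonglongrightarrow> 0" by (rule tendsto_rabs_zero)
  moreover have "\<bar>theta (idx k) - cos (kappa k)\<bar> = 1 - cos \<bar>kappa k - real k * pi\<bar>" for k
  proof -
    have shift: "cos \<bar>kappa k - real k * pi\<bar> = (-1) ^ k * cos (kappa k)"
      by (simp add: cos_diff)
    have range: "cos (kappa k) \<le> 1" "-1 \<le> cos (kappa k)" by simp_all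
    from neg1_pow_cases[of k] show ?thesis
    proof
      assume s: "(-1 :: real) ^ k = 1"
      show ?thesis unfolding theta_idx shift s using range by linarith
    next
      assume s: "(-1 :: real) ^ k = -1"
      show ?thesis unfolding theta_idx shift s using range by linarith
    qed
  qed
  ultimately have "(\<lambda>k. 1 - cos \<bar>kappa k - real k * pi\<bar>) \<longlonglongrightarrow> 0" by simp
  then have "(\<lambda>k. \<bar>kappa k - real k * pi\<bar>) \<longlonglongrightarrow> arccos 1"
    by (intro arccos_limit) (use near in auto)
  then have "(\<lambda>k. \<bar>kappa k - real k * pi\<bar>) \<longlonglongrightarrow> 0" by simp
  then show ?thesis by (rule tendsto_rabs_zero_cancel)
qed

end

section \<open>From the scaled parameter back to eigenvalues\<close>

lemma sqrt_asymptotics: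
  fixes v :: "nat \<Rightarrow> real"
  assumes ell: "ell > 0" and d: "d > 0" and lim: "(\<lambda>k. v k - d * real k) \<longlonglongrightarrow> c"
  shows "(\<lambda>k. sqrt (v k * \<bar>v k\<bar> / ell\<^sup>2) - (c + d * real k) / ell) \<longlonglongrightarrow> 0"
proof -
  have "filterlim (\<lambda>k. d * real k) at_top sequentially"
    by (rule filterlim_tendsto_pos_mult_at_top[OF tendsto_const d filterlim_real_sequentially])
  from filterlim_tendsto_add_at_top[OF lim this]
  have "filterlim v at_top sequentially" by simp
  then have pos: "\<forall>\<^sub>F k in sequentially. 0 < v k" by (simp add: filterlim_at_top_dense)
  have "(\<lambda>k. ((v k - d * real k) - c) / ell) \<longlonglongrightarrow> (c - c) / ell"
    by (intro tendsto_intros lim) (use ell in simp)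
  then have "(\<lambda>k. ((v k - d * real k) - c) / ell) \<longlonglongrightarrow> 0" by simp
  then show ?thesis
  proof (rule Lim_transform_eventually)
    show "\<forall>\<^sub>F k in sequentially. ((v k - d * real k) - c) / ell
        = sqrt (v k * \<bar>v k\<bar> / ell\<^sup>2) - (c + d * real k) / ell"
      using pos
    proof eventually_elim
      case (elim k)
      have "v k * \<bar>v k\<bar> / ell\<^sup>2 = (v k / ell)\<^sup>2" using elim by (simp add: power_divide power2_eq_square)
      then have "sqrt (v k * \<bar>v k\<bar> / ell\<^sup>2) = v k / ell" using elim ell by simp
      then show ?case by (simp add: diff_divide_distrib add_divide_distrib)
    qed
  qed
qed

text \<open>\<open>t * \<bar>t\<bar>\<close> is a strictly increasing bijection of the reals, so
  members with a given real eigenvalue are exactly those with one given value of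
  \<open>y\<close>.\<close>

lemma spectral_parameter:
  assumes ell: "ell > (0::real)"
  shows "\<exists>y. \<forall>t. t * \<bar>t\<bar> / ell\<^sup>2 = r \<longleftrightarrow> t = y"
proof (intro exI allI iffI)
  have less: "t * \<bar>t\<bar> < y * \<bar>y\<bar>" if "t < y" for t y :: real
  proof -
    consider "0 \<le> t" | "t < 0" "0 \<le> y" | "y < 0" by linarith
    then show ?thesis
    proof cases
      case 1
      then show ?thesis using that by (simp add: mult_strict_mono)
    next
      case 2
      then have "t * \<bar>t\<bar> < 0" by (intro mult_neg_pos) auto
      moreover have "0 \<le> y * \<bar>y\<bar>" using 2 by simp
      ultimately show ?thesis by linarith
    next
      case 3
      then have "(- y) * (- y) < (- t) * (- t)" using that by (intro mult_strict_mono) auto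
      then show ?thesis using 3 that by simp
    qed
  qed
  have inj: "t = y" if "t * \<bar>t\<bar> = y * \<bar>y\<bar>" for t y :: real
    using less[of t y] less[of y t] that by linarith
  have eq: "(sgn r * sqrt \<bar>r\<bar> * ell) * \<bar>sgn r * sqrt \<bar>r\<bar> * ell\<bar> = r * ell\<^sup>2"
    using ell by (cases "r > 0"; cases "r = 0") (auto simp: abs_mult sgn_if power2_eq_square algebra_simps)
  fix t
  show "t = sgn r * sqrt \<bar>r\<bar> * ell" if "t * \<bar>t\<bar> / ell\<^sup>2 = r"
    by (rule inj) (use that ell eq in \<open>simp add: field_simps\<close>)
  show "t * \<bar>t\<bar> / ell\<^sup>2 = r" if "t = sgn r * sqrt \<bar>r\<bar> * ell"
    using that ell eq by (simp add: field_simps)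
qed

lemma robin_matrix_rescale: "robin_matrix p E b C (ell * S) = robin_matrix p E (\<lambda>v. ell * b v) C S"
  by (simp add: robin_matrix_def fun_eq_iff mult_ac)

text \<open>Both sorted lists take each value as often as its order as a zero of psi. The numbering
  of \<open>z\<close> starts at 1, that of \<open>theta\<close> at 0.\<close>

lemma theta_eq_zeros:
  assumes rt: "robin_tree p E"
    and z_sorted: "\<forall>i j. 1 \<le> i \<and> i \<le> j \<and> j \<le> p \<longrightarrow> z i \<le> z j"
    and z_zeros: "\<forall>w. order w (psi_poly p E) = card {i \<in> {1..p}. z i = w}"
    and i: "i < p"
  shows "robin_tree.theta p E b i = z (Suc i)"
proof (rule sorted_eq_of_card_eq[OF _ _ _ i])
  interpret robin_tree p E b by (rule rt)
  obtain X where X: "eigensys p (degr p E) (robin_matrix p E b 0 0) theta X" using theta_eigensys by blast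
  show "theta i \<le> theta j" if "i \<le> j" "j < p" for i j using X that by (simp add: eigensys_def)
  show "z (Suc i) \<le> z (Suc j)" if "i \<le> j" "j < p" for i j using z_sorted that by simp
  show "card {i. i < p \<and> theta i = a} = card {i. i < p \<and> z (Suc i) = a}" for a
  proof -
    have "bij_betw Suc {i. i < p \<and> z (Suc i) = a} {i \<in> {1..p}. z i = a}"
      by (rule bij_betw_byWitness[where f' = "\<lambda>i. i - 1"]) auto
    then have "card {i. i < p \<and> z (Suc i) = a} = card {i \<in> {1..p}. z i = a}" by (rule bij_betw_same_card)
    then show ?thesis using z_zeros order_psi_poly[OF tree X, of a] by simp
  qed
qed

theorem theorem3p1:
  fixes p :: nat and E :: "nat \<Rightarrow> nat \<times> nat" and ell :: real
    and b :: "nat \<Rightarrow> real" and z :: "nat \<Rightarrow> real"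
  assumes tree: "is_tree p E"
    and ell_pos: "ell > 0"
    and z_sorted: "\<forall>i j. 1 \<le> i \<and> i \<le> j \<and> j \<le> p \<longrightarrow> z i \<le> z j"
    and z_zeros: "\<forall>w. order w (psi_poly p E) = card {i \<in> {1..p}. z i = w}"
  shows "\<exists>lam :: int \<Rightarrow> nat \<Rightarrow> real.
     (\<forall>mu :: complex.
        finite {(l, k) \<in> seq_index p. complex_of_real (lam l k) = mu} \<and>
        card {(l, k) \<in> seq_index p. complex_of_real (lam l k) = mu} = robin_mult p E ell b mu) \<and>
     (\<lambda>k. sqrt (lam 1 k) - pi * real k / ell) \<longlonglongrightarrow> 0 \<and>
     (\<forall>l. 2 \<le> l \<and> l \<le> p - 1 \<longrightarrow>
        (\<lambda>k. sqrt (lam (int l) k) - (arccos (z l) + 2 * pi * real k) / ell) \<longlonglongrightarrow> 0 \<and>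
        (\<lambda>k. sqrt (lam (- int l) k) - (- arccos (z l) + 2 * pi * real k) / ell) \<longlonglongrightarrow> 0)"
proof -
  \<comment> \<open>Absorbing \<open>ell\<close> into the Robin coefficients makes the vertex matrix depend on \<open>Cf y\<close> and \<open>Sf y\<close> only.\<close>
  define b' where "b' = (\<lambda>v. ell * b v)"
  interpret robin_tree p E b' by unfold_locales (rule tree)
  define lam where "lam l k = val (l, k) * \<bar>val (l, k)\<bar> / ell\<^sup>2" for l k
  have theta: "theta (l - 1) = z l" if "2 \<le> l" "l \<le> p - 1" for l
    using theta_eq_zeros[OF robin_tree_axioms z_sorted z_zeros, of "l - 1"] that by simp
  have count: "finite {(l, k) \<in> seq_index p. complex_of_real (lam l k) = mu} \<and>
      card {(l, k) \<in> seq_index p. complex_of_real (lam l k) = mu} = robin_mult p E ell b mu" for mu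
  proof (cases "Im mu = 0")
    case False
    then have none: "{(l, k) \<in> seq_index p. complex_of_real (lam l k) = mu} = {}" by auto
    show ?thesis unfolding none using robin_mult_nonreal[OF tree ell_pos False] by simp
  next
    case True
    then have mu: "mu = of_real (Re mu)" by (simp add: complex_eq_iff)
    obtain y where y: "\<And>t. t * \<bar>t\<bar> / ell\<^sup>2 = Re mu \<longleftrightarrow> t = y"
      using spectral_parameter[OF ell_pos] by blast
    have "complex_of_real (lam l k) = mu \<longleftrightarrow> val (l, k) = y" for l k
      unfolding y[symmetric] lam_def by (subst mu) (rule of_real_eq_iff)
    then have set: "{(l, k) \<in> seq_index p. complex_of_real (lam l k) = mu} = {q \<in> seq_index p. val q = y}"
      by auto
    have mu_y: "mu = of_real (y * \<bar>y\<bar> / ell\<^sup>2)" using y[of y] mu by simp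
    obtain c s where fs: "fundsys (y * \<bar>y\<bar> / ell\<^sup>2) c s" "c ell = Cf y" "s ell = ell * Sf y"
      using fundsys_Cf_Sf[OF ell_pos] by blast
    from cell_cases[of y] show ?thesis
    proof
      assume "\<exists>m. y \<in> cell m"
      then obtain m where m: "y \<in> cell m" by blast
      obtain Z where Z: "eigensys p (degr p E) (robin_matrix p E b (c ell) (s ell)) (ev y) Z"
        using ev_eigensys[of y] unfolding fs robin_matrix_rescale b'_def by blast
      have "s ell \<noteq> 0" using Sf_nonzero[OF m] ell_pos fs by simp
      from robin_mult_generic[OF tree ell_pos fs(1) this Z]
      have mult: "robin_mult p E ell b mu = card {i. i < p \<and> ev y i = 0}" unfolding mu_y .
      show ?thesis unfolding set mult using val_count_cell[OF m] by simp
    next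
      assume "\<exists>k>0. y = real k * pi"
      then obtain k where k: "0 < k" "y = real k * pi" by blast
      have "s ell = 0" "c ell = 1 \<or> c ell = -1"
        using fs neg1_pow_cases[of k] by (simp_all add: k Sf_multiple_pi Cf_multiple_pi)
      from robin_mult_resonant[OF tree ell_pos fs(1) this]
      have mult: "robin_mult p E ell b mu = (if (\<Sum>v<p. b v) = 0 then 1 else 0)" unfolding mu_y .
      \<comment> \<open>\<open>B\<close> is built from the rescaled coefficients \<open>b'\<close>,
        yet vanishes together with the original sum.\<close>
      have "B = ell * (\<Sum>v<p. b v)" unfolding B_def by (simp add: b'_def sum_distrib_left)
      then have "B = 0 \<longleftrightarrow> (\<Sum>v<p. b v) = 0" using ell_pos by simp
      then show ?thesis unfolding set mult k(2) val_count_resonant[OF k(1)] by simp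
    qed
  qed
  \<comment> \<open>Member 0 is the zero of the top curve in cell 0 rather than
    \<open>kappa 0\<close>, so the sequences agree only for positive \<open>k\<close>.\<close>
  have "(\<lambda>k. val (1, k) - pi * real k) \<longlonglongrightarrow> 0"
    using kappa_limit
  proof (rule Lim_transform_eventually)
    show "\<forall>\<^sub>F k in sequentially. kappa k - real k * pi = val (1, k) - pi * real k"
      using eventually_gt_at_top[of 0] by eventually_elim (simp add: val_def)
  qed
  from sqrt_asymptotics[OF ell_pos pi_gt_zero this]
  have one: "(\<lambda>k. sqrt (lam 1 k) - pi * real k / ell) \<longlonglongrightarrow> 0" by (simp add: lam_def)
  have up: "(\<lambda>k. sqrt (lam (int l) k) - (arccos (z l) + 2 * pi * real k) / ell) \<longlonglongrightarrow> 0"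
    and down: "(\<lambda>k. sqrt (lam (- int l) k) - (- arccos (z l) + 2 * pi * real k) / ell) \<longlonglongrightarrow> 0"
    if l: "2 \<le> l" "l \<le> p - 1" for l
  proof -
    have d: "2 * pi > 0" by simp
    show "(\<lambda>k. sqrt (lam (int l) k) - (arccos (z l) + 2 * pi * real k) / ell) \<longlonglongrightarrow> 0"
      using sqrt_asymptotics[OF ell_pos d val_up_limit[OF l]] unfolding theta[OF l] lam_def .
    have "(\<lambda>k. val (- int l, k) - 2 * pi * real k) \<longlonglongrightarrow> - arccos (theta (l - 1))"
      using tendsto_minus[OF val_down_limit[OF l]] by simp
    from sqrt_asymptotics[OF ell_pos d this]
    show "(\<lambda>k. sqrt (lam (- int l) k) - (- arccos (z l) + 2 * pi * real k) / ell) \<longlonglongrightarrow> 0"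
      unfolding theta[OF l] lam_def .
  qed
  show ?thesis using count one up down by (intro exI[of _ lam]) blast
qed

end
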